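(* Let $l\in\{+1,-1\}$ and let $\Gamma_l\subset D^l$ be a $K_B$-bounded contour. The analytic continuation of the transfer function $M_1(z)$, $z\in\mathbb{C}\setminus\Delta_0$, through the spectral interval $\Delta_0$ into the subdomain $D(\Gamma_l)\subset D^l$ bounded by the set $\Delta_0$ and the contour $\Gamma_l$ is given by $$M_1(z,\Gamma_l):=\widetilde A_1-z+V_1(z,\Gamma_l),\qquad V_1(z,\Gamma_l):=\int_{\Gamma_l}d\mu\,K_B'(\mu)\,\frac{z}{z-\mu}.$$ For $z\in D^l\cap D(\Gamma_l)$ the function $M_1(z,\Gamma_l)$ may be written as $$M_1(z,\Gamma_l)=M_1(z)+2\pi\mathrm{i}\,l\,z\,K_B'(z).$$
   Context: Setting. $\mathcal H_0,\mathcal H_1$ are separable Hilbert spaces. $A_0$ is an unbounded selfadjoint operator in $\mathcal H_0$ whose spectrum is absolutely continuous and equal to $\Delta_0=[\alpha_0,+\infty)$, $\alpha_0>0$. $A_1$ is a bounded selfadjoint operator in $\mathcal H_1$. The (possibly unbounded) operators $T_{ij}:\mathcal H_j\to\mathcal H_i$ ($i,j\in\{0,1\}$, $i\ne j$) satisfy $T_{01}^*=T_{10}$ and $\mathcal D(T_{10})\supset\mathcal D(A_0^{1/2})$. Then $B_{10}:=T_{10}A_0^{-1/2}$ is bounded; put $B_{01}:=B_{10}^*$ (the bounded extension of $A_0^{-1/2}T_{01}$). Let $\widetilde A_1:=A_1-B_{10}B_{01}$, a bounded selfadjoint operator in $\mathcal H_1$; it is assumed that $\sigma(\widetilde A_1)\subset\Delta_0$.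 The transfer function is the operator-valued function $M_1(z):=\widetilde A_1-z+zB_{10}(z-A_0)^{-1}B_{01}$, $z\in\mathbb{C}\setminus\Delta_0$. Holomorphy of operator-valued functions is meant in the operator norm topology. The function $K_B$. Let $E_0$ be the spectral measure of $A_0$, $E^0(\mu):=E_0([\alpha_0,\mu))$ and $K_B(\mu):=B_{10}E^0(\mu)B_{01}$. It is assumed that: $K_B$ is differentiable on $\Delta_0$ in the operator norm topology; $K_B'$ is continuous within $\Delta_0$ and admits analytic continuation from $\Delta_0$ to a simply connected domain $D^+\subset\mathbb{C}^+$ (the upper half-plane) whose boundary includes the entire interval $\Delta_0$. Consequently it is also continued to $D^-:=\{z:\overline z\in D^+\}$, and $[K_B'(\mu)]^*=K_B'(\overline\mu)$ for $\mu\in D^\pm$; the continuations are again denoted $K_B'$. It is assumed that $\|K_B'(\mu)\|\le C|\mu-\alpha_0|^{\gamma}$, $\mu\in D^\pm$, for some $C>0$ and $\gamma\in(-1,0]$. For $l=\pm1$ write $D^l$ for $D^\pm$. Contours. $\Gamma_l$ denotes a rectifiable Jordan curve in $D^l$ resulting from continuous deformation of the interval $\Delta_0$, the finite end point $\alpha_0$ being fixed (oriented from $\alpha_0$ to infinity). It is called $K_B$-bounded if $\mathrm{Var}_1(B,\Gamma_l):=\int_{\Gamma_l}|d\mu|\,(1+|\mu|)^{-1}\|K_B'(\mu)\|<\infty$, where $|d\mu|$ is Lebesgue (arc-length) measure on $\Gamma_l$. The continuation of $M_1$ through $\Delta_0$ into $D(\Gamma_l)$ means the analytic continuation starting from the half-plane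 on the other side of $\Delta_0$ and crossing $\Delta_0$ into $D(\Gamma_l)$ (the values in $D(\Gamma_l)$ thus lie on an unphysical sheet of the Riemann surface of $M_1$), whereas $M_1(z)$ for $z\notin\Delta_0$ always denotes the original function. *)

theory Defs
  imports "HOL-Analysis.Analysis"
begin

section \<open>Complex Hilbert spaces and bounded operators\<close>

class scaleC =
  fixes scaleC :: "complex \<Rightarrow> 'a \<Rightarrow> 'a"  (infixr \<open>*\<^sub>C\<close> 75)

text \<open>The inner product \<open>cinner\<close> is linear in the first argument, and the norm (inherited from
  \<^class>\<open>real_inner\<close>) is the one it induces, since \<open>inner\<close> is its real part.\<close>

class complex_hilbert_space = real_inner + complete_space + scaleC +
  fixes cinner :: "'a \<Rightarrow> 'a \<Rightarrow> complex"
  assumes scaleC_add_right: "c *\<^sub>C (x + y) = c *\<^sub>C x + c *\<^sub>C y"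
    and scaleC_add_left: "(c + d) *\<^sub>C x = c *\<^sub>C x + d *\<^sub>C x"
    and scaleC_scaleC: "c *\<^sub>C d *\<^sub>C x = (c * d) *\<^sub>C x"
    and scaleR_scaleC: "r *\<^sub>R x = complex_of_real r *\<^sub>C x"
    and cinner_commute: "cinner x y = cnj (cinner y x)"
    and cinner_add_left: "cinner (x + y) z = cinner x z + cinner y z"
    and cinner_scaleC_left: "cinner (c *\<^sub>C x) y = c * cinner x y"
    and inner_eq_Re_cinner: "inner x y = Re (cinner x y)"

lemma norm_scaleC: "norm (c *\<^sub>C x) = cmod c * norm (x :: 'a :: complex_hilbert_space)"
proof -
  have "cinner (c *\<^sub>C x) (c *\<^sub>C x) = c * cnj c * cinner x x"
    by (metis cinner_commute cinner_scaleC_left complex_cnj_cnj complex_cnj_mult mult.assoc)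
  then have "inner (c *\<^sub>C x) (c *\<^sub>C x) = (cmod c)\<^sup>2 * inner x x"
    by (simp add: inner_eq_Re_cinner complex_norm_square[symmetric] del: of_real_power)
  then show ?thesis
    by (simp add: norm_eq_sqrt_inner real_sqrt_mult)
qed

lemma bounded_linear_scaleC: "bounded_linear (\<lambda>x :: 'a :: complex_hilbert_space. c *\<^sub>C x)"
proof (rule bounded_linear_intro[where K = "cmod c"])
  fix x y :: 'a and r :: real
  show "c *\<^sub>C (x + y) = c *\<^sub>C x + c *\<^sub>C y"
    by (rule scaleC_add_right)
  show "c *\<^sub>C r *\<^sub>R x = r *\<^sub>R c *\<^sub>C x"
    by (simp add: scaleR_scaleC scaleC_scaleC mult.commute)
  show "norm (c *\<^sub>C x) \<le> norm x * cmod c"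
    by (simp add: norm_scaleC mult.commute)
qed

instantiation blinfun :: (real_normed_vector, complex_hilbert_space) scaleC
begin

lift_definition scaleC_blinfun :: "complex \<Rightarrow> 'a \<Rightarrow>\<^sub>L 'b \<Rightarrow> 'a \<Rightarrow>\<^sub>L 'b" is "\<lambda>c T x. c *\<^sub>C T x"
  by (rule bounded_linear_compose[OF bounded_linear_scaleC])

instance ..

end

text \<open>Bounded operators are elements of the type of bounded real-linear maps, whose norm is the
  operator norm.  Being one half of an adjoint pair with respect to \<open>cinner\<close> forces complex
  linearity, so this is not required separately below.\<close>

definition bounded_adjoint ::
  "('a::complex_hilbert_space \<Rightarrow>\<^sub>L 'b::complex_hilbert_space) \<Rightarrow> ('b \<Rightarrow>\<^sub>L 'a) \<Rightarrow> bool" where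
  "bounded_adjoint B C \<longleftrightarrow> (\<forall>x y. cinner (B x) y = cinner x (C y))"

text \<open>Complex differentiability of operator-valued functions in the operator norm.\<close>

definition op_holomorphic_on ::
  "(complex \<Rightarrow> 'a::complex_hilbert_space \<Rightarrow>\<^sub>L 'b::complex_hilbert_space) \<Rightarrow> complex set \<Rightarrow> bool" where
  "op_holomorphic_on F S \<longleftrightarrow>
     (\<forall>z\<in>S. \<exists>L. (F has_derivative (\<lambda>h. h *\<^sub>C L)) (at z within S))"

text \<open>On the domain \<open>U\<close>, \<open>G\<close> is the (unique) analytic continuation of the restriction of \<open>F\<close> to the
  nonempty open set \<open>S\<close>.\<close>

definition analytic_continuation ::
  "(complex \<Rightarrow> 'a::complex_hilbert_space \<Rightarrow>\<^sub>L 'b::complex_hilbert_space) \<Rightarrow> complex set \<Rightarrow>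
   (complex \<Rightarrow> 'a \<Rightarrow>\<^sub>L 'b) \<Rightarrow> complex set \<Rightarrow> bool" where
  "analytic_continuation F S G U \<longleftrightarrow>
     open S \<and> S \<noteq> {} \<and> open U \<and> connected U \<and> S \<subseteq> U \<and>
     op_holomorphic_on G U \<and> (\<forall>z\<in>S. G z = F z)"

section \<open>Unbounded operators\<close>

text \<open>An operator is given by its domain \<open>D\<close> and a function whose values outside \<open>D\<close> are irrelevant.\<close>

definition linear_operator ::
  "'a::complex_hilbert_space set \<Rightarrow> ('a \<Rightarrow> 'b::complex_hilbert_space) \<Rightarrow> bool" where
  "linear_operator D T \<longleftrightarrow>
     0 \<in> D \<and> (\<forall>x\<in>D. \<forall>y\<in>D. x + y \<in> D \<and> T (x + y) = T x + T y) \<and>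
     (\<forall>c. \<forall>x\<in>D. c *\<^sub>C x \<in> D \<and> T (c *\<^sub>C x) = c *\<^sub>C T x)"

text \<open>\<open>(D', T')\<close> is the adjoint of the densely defined operator \<open>(D, T)\<close>.\<close>

definition adjoint_operator ::
  "'a::complex_hilbert_space set \<Rightarrow> ('a \<Rightarrow> 'b::complex_hilbert_space) \<Rightarrow>
   'b set \<Rightarrow> ('b \<Rightarrow> 'a) \<Rightarrow> bool" where
  "adjoint_operator D T D' T' \<longleftrightarrow>
     linear_operator D T \<and> closure D = UNIV \<and>
     D' = {y. \<exists>z. \<forall>x\<in>D. cinner (T x) y = cinner x z} \<and>
     (\<forall>y\<in>D'. \<forall>x\<in>D. cinner (T x) y = cinner x (T' y))"

definition selfadjoint_operator ::
  "'a::complex_hilbert_space set \<Rightarrow> ('a \<Rightarrow> 'a) \<Rightarrow> bool" where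
  "selfadjoint_operator D A \<longleftrightarrow> adjoint_operator D A D A"

definition is_resolvent ::
  "'a::complex_hilbert_space set \<Rightarrow> ('a \<Rightarrow> 'a) \<Rightarrow> complex \<Rightarrow> ('a \<Rightarrow>\<^sub>L 'a) \<Rightarrow> bool" where
  "is_resolvent D A z R \<longleftrightarrow>
     (\<forall>x. R x \<in> D \<and> z *\<^sub>C R x - A (R x) = x) \<and> (\<forall>x\<in>D. R (z *\<^sub>C x - A x) = x)"

definition spectrum ::
  "'a::complex_hilbert_space set \<Rightarrow> ('a \<Rightarrow> 'a) \<Rightarrow> complex set" where
  "spectrum D A = {z. \<nexists>R. is_resolvent D A z R}"

text \<open>The operator \<open>(z - A)\<^sup>-\<^sup>1\<close>, for \<open>z\<close> outside the spectrum.\<close>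

definition resolvent ::
  "'a::complex_hilbert_space set \<Rightarrow> ('a \<Rightarrow> 'a) \<Rightarrow> complex \<Rightarrow> 'a \<Rightarrow>\<^sub>L 'a" where
  "resolvent D A z = (THE R. is_resolvent D A z R)"

section \<open>Spectral measures\<close>

definition projection_valued_measure ::
  "(real set \<Rightarrow> 'a::complex_hilbert_space \<Rightarrow>\<^sub>L 'a) \<Rightarrow> bool" where
  "projection_valued_measure E \<longleftrightarrow>
     (\<forall>S\<in>sets borel. E S o\<^sub>L E S = E S \<and> bounded_adjoint (E S) (E S)) \<and>
     E UNIV = id_blinfun \<and>
     (\<forall>F :: nat \<Rightarrow> real set. range F \<subseteq> sets borel \<longrightarrow> disjoint_family F \<longrightarrow>
        (\<forall>x. (\<lambda>n. E (F n) x) sums E (\<Union>n. F n) x))"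

definition scalar_spectral_measure ::
  "(real set \<Rightarrow> 'a::complex_hilbert_space \<Rightarrow>\<^sub>L 'a) \<Rightarrow> 'a \<Rightarrow> real measure" where
  "scalar_spectral_measure E x =
     measure_of UNIV (sets borel) (\<lambda>S. ennreal (Re (cinner (E S x) x)))"

definition spectral_integral_domain ::
  "(real set \<Rightarrow> 'a::complex_hilbert_space \<Rightarrow>\<^sub>L 'a) \<Rightarrow> (real \<Rightarrow> real) \<Rightarrow> 'a set" where
  "spectral_integral_domain E f =
     {x. (\<integral>\<^sup>+ t. ennreal ((f t)\<^sup>2) \<partial>scalar_spectral_measure E x) < \<infinity>}"

text \<open>\<open>(D, A)\<close> is the operator \<open>\<integral> f dE\<close>; by polarization it is determined by its quadratic form.\<close>

definition is_spectral_integral ::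
  "(real set \<Rightarrow> 'a::complex_hilbert_space \<Rightarrow>\<^sub>L 'a) \<Rightarrow> (real \<Rightarrow> real) \<Rightarrow> 'a set \<Rightarrow> ('a \<Rightarrow> 'a) \<Rightarrow> bool" where
  "is_spectral_integral E f D A \<longleftrightarrow>
     linear_operator D A \<and> D = spectral_integral_domain E f \<and>
     (\<forall>x\<in>D. cinner (A x) x = of_real (\<integral>t. f t \<partial>scalar_spectral_measure E x))"

definition is_spectral_measure ::
  "(real set \<Rightarrow> 'a::complex_hilbert_space \<Rightarrow>\<^sub>L 'a) \<Rightarrow> 'a set \<Rightarrow> ('a \<Rightarrow> 'a) \<Rightarrow> bool" where
  "is_spectral_measure E D A \<longleftrightarrow>
     projection_valued_measure E \<and> is_spectral_integral E (\<lambda>t. t) D A"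

definition purely_absolutely_continuous ::
  "(real set \<Rightarrow> 'a::complex_hilbert_space \<Rightarrow>\<^sub>L 'a) \<Rightarrow> bool" where
  "purely_absolutely_continuous E \<longleftrightarrow>
     (\<forall>x. absolutely_continuous lborel (scalar_spectral_measure E x))"

section \<open>Contours\<close>

text \<open>Length of a curve on \<open>[a, b]\<close>: supremum of the lengths of the inscribed polygons.\<close>

definition curve_length :: "(real \<Rightarrow> complex) \<Rightarrow> real \<Rightarrow> real \<Rightarrow> ereal" where
  "curve_length c a b =
     (SUP (n, p) \<in> {(n :: nat, p). mono p \<and> p 0 = a \<and> p n = b}.
        ereal (\<Sum>i<n. dist (c (p i)) (c (p (Suc i)))))"

text \<open>The unbounded contours \<open>\<Gamma>\<close> are given by their arc-length parametrization
  \<open>\<gamma> : [0, \<infinity>) \<rightarrow> \<complex>\<close>, so that \<open>|d\<mu>|\<close> is \<open>ds\<close> and \<open>d\<mu>\<close> is \<open>\<gamma>' s ds\<close>, where \<open>\<gamma>' s\<close> exists for almost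
  every \<open>s\<close>.\<close>

definition arc_length_parametrized :: "(real \<Rightarrow> complex) \<Rightarrow> bool" where
  "arc_length_parametrized \<gamma> \<longleftrightarrow> (\<forall>a b. 0 \<le> a \<longrightarrow> a \<le> b \<longrightarrow> curve_length \<gamma> a b = ereal (b - a))"

text \<open>\<open>\<gamma>\<close> arises by a continuous deformation \<open>H\<close> of the half-line \<open>[\<alpha>, \<infinity>)\<close> into \<open>D\<close> that keeps the end
  point \<open>\<alpha>\<close>, and the end at infinity, fixed.\<close>

definition deformation_of_halfline :: "complex set \<Rightarrow> real \<Rightarrow> (real \<Rightarrow> complex) \<Rightarrow> bool" where
  "deformation_of_halfline D \<alpha> \<gamma> \<longleftrightarrow>
     (\<exists>H :: real \<times> real \<Rightarrow> complex.
        continuous_on ({0..1} \<times> {0..}) H \<and>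
        (\<forall>t\<ge>0. H (0, t) = of_real (\<alpha> + t)) \<and>
        (\<forall>t\<ge>0. H (1, t) = \<gamma> t) \<and>
        (\<forall>s\<in>{0..1}. H (s, 0) = of_real \<alpha>) \<and>
        (\<forall>s\<in>{0<..1}. \<forall>t>0. H (s, t) \<in> D) \<and>
        (\<forall>r. \<exists>t0. \<forall>s\<in>{0..1}. \<forall>t\<ge>t0. 0 \<le> t \<longrightarrow> r \<le> cmod (H (s, t))))"

definition contour_in :: "complex set \<Rightarrow> real \<Rightarrow> (real \<Rightarrow> complex) \<Rightarrow> bool" where
  "contour_in D \<alpha> \<gamma> \<longleftrightarrow>
     continuous_on {0..} \<gamma> \<and> inj_on \<gamma> {0..} \<and>
     \<gamma> 0 = of_real \<alpha> \<and> \<gamma> ` {0<..} \<subseteq> D \<and>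
     filterlim \<gamma> at_infinity at_top \<and>
     arc_length_parametrized \<gamma> \<and>
     deformation_of_halfline D \<alpha> \<gamma>"

text \<open>The integrand of \<open>\<integral>\<^sub>\<Gamma> d\<mu> F(\<mu>)\<close> in terms of the parameter.\<close>

definition curve_integrand ::
  "(real \<Rightarrow> complex) \<Rightarrow> (complex \<Rightarrow> 'a::complex_hilbert_space \<Rightarrow>\<^sub>L 'b::complex_hilbert_space) \<Rightarrow>
   real \<Rightarrow> 'a \<Rightarrow>\<^sub>L 'b" where
  "curve_integrand \<gamma> F s = vector_derivative \<gamma> (at s) *\<^sub>C F (\<gamma> s)"

definition curve_integral ::
  "(real \<Rightarrow> complex) \<Rightarrow> (complex \<Rightarrow> 'a::complex_hilbert_space \<Rightarrow>\<^sub>L 'b::complex_hilbert_space) \<Rightarrow>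
   'a \<Rightarrow>\<^sub>L 'b" where
  "curve_integral \<gamma> F = integral {0..} (curve_integrand \<gamma> F)"

section \<open>The transfer function\<close>

definition Var1 ::
  "(complex \<Rightarrow> 'a::complex_hilbert_space \<Rightarrow>\<^sub>L 'b::complex_hilbert_space) \<Rightarrow> (real \<Rightarrow> complex) \<Rightarrow> ennreal" where
  "Var1 K' \<gamma> = (\<integral>\<^sup>+s\<in>{0<..}. ennreal (norm (K' (\<gamma> s)) / (1 + cmod (\<gamma> s))) \<partial>lborel)"

definition K_B ::
  "('a::complex_hilbert_space \<Rightarrow>\<^sub>L 'b::complex_hilbert_space) \<Rightarrow> ('b \<Rightarrow>\<^sub>L 'a) \<Rightarrow>
   (real set \<Rightarrow> 'a \<Rightarrow>\<^sub>L 'a) \<Rightarrow> real \<Rightarrow> real \<Rightarrow> 'b \<Rightarrow>\<^sub>L 'b" where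
  "K_B B10 B01 E \<alpha> \<mu> = B10 o\<^sub>L E {\<alpha>..<\<mu>} o\<^sub>L B01"

definition transfer_function ::
  "('b::complex_hilbert_space \<Rightarrow>\<^sub>L 'b) \<Rightarrow> ('a::complex_hilbert_space \<Rightarrow>\<^sub>L 'b) \<Rightarrow> ('b \<Rightarrow>\<^sub>L 'a) \<Rightarrow>
   'a set \<Rightarrow> ('a \<Rightarrow> 'a) \<Rightarrow> complex \<Rightarrow> 'b \<Rightarrow>\<^sub>L 'b" where
  "transfer_function At B10 B01 D0 A0 z =
     At - z *\<^sub>C id_blinfun + z *\<^sub>C (B10 o\<^sub>L resolvent D0 A0 z o\<^sub>L B01)"

definition V1_integrand ::
  "(complex \<Rightarrow> 'b::complex_hilbert_space \<Rightarrow>\<^sub>L 'b) \<Rightarrow> complex \<Rightarrow> complex \<Rightarrow> 'b \<Rightarrow>\<^sub>L 'b" where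
  "V1_integrand K' z \<mu> = (z / (z - \<mu>)) *\<^sub>C K' \<mu>"

definition M1_continued ::
  "('b::complex_hilbert_space \<Rightarrow>\<^sub>L 'b) \<Rightarrow> (complex \<Rightarrow> 'b \<Rightarrow>\<^sub>L 'b) \<Rightarrow> (real \<Rightarrow> complex) \<Rightarrow>
   complex \<Rightarrow> 'b \<Rightarrow>\<^sub>L 'b" where
  "M1_continued At K' \<gamma> z = At - z *\<^sub>C id_blinfun + curve_integral \<gamma> (V1_integrand K' z)"

definition signed_domain :: "complex set \<Rightarrow> int \<Rightarrow> complex set" where
  "signed_domain Dp l = (if l = 1 then Dp else cnj ` Dp)"

text \<open>The domain obtained by crossing \<open>(\<alpha>, \<infinity>)\<close> from the half-plane \<open>l Im z < 0\<close> into \<open>G\<close>; here \<open>G\<close> lies in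
  the opposite half-plane.\<close>

definition crossing_domain :: "int \<Rightarrow> real \<Rightarrow> complex set \<Rightarrow> complex set" where
  "crossing_domain l \<alpha> G = {z. of_int l * Im z < 0} \<union> of_real ` {\<alpha><..} \<union> G"

end

theory Submission
  imports Defs "HOL-Complex_Analysis.Complex_Analysis"
begin

text \<open>Tested against vectors, the identity to prove is scalar: with \<open>k(\<mu>) = \<langle>K\<^sub>B'(\<mu>) x, y\<rangle>\<close>, the spectral
  theorem gives \<open>\<langle>B\<^sub>1\<^sub>0 (z - A\<^sub>0)\<^sup>-\<^sup>1 B\<^sub>0\<^sub>1 x, y\<rangle> = \<integral> k(t) / (z - t) dt\<close> over the half-line, and for \<open>z\<close> on the
  far side of it the half-line is deformed into \<open>\<Gamma>\<close>.  The integrand need not decay fast enough at infinity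
  (the case \<open>g = 0\<close>), so it is first multiplied by \<open>1 / (1 - \<i> \<epsilon> \<mu>)\<close>, which is bounded by one in the upper
  half-plane.  The deformation uses a primitive on the simply connected \<open>D\<^sup>l\<close>, extended to the half-line:
  its values at \<open>\<alpha>\<^sub>0 + R\<close> and at the point where the circle of radius \<open>R\<close> about \<open>\<alpha>\<^sub>0\<close> first meets \<open>\<Gamma>\<close>
  differ by an arc integral, which vanishes as \<open>R \<rightarrow> 0\<close> and \<open>R \<rightarrow> \<infinity>\<close>.  Inside \<open>D(\<Gamma>)\<close>
  the jump \<open>2\<pi>\<i> k(z)\<close> is found near one point of the half-line by Cauchy's formula for a rectangle, and
  spreads by the identity theorem.  The spectral theorem enters only through estimates of \<open>A\<^sub>0\<close> on
  spectral subspaces of short intervals, which give the derivative of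
  \<open>s \<mapsto> \<langle>(z - A\<^sub>0)\<^sup>-\<^sup>1 E[\<alpha>\<^sub>0, s) v, w\<rangle>\<close>.\<close>

section \<open>Lipschitz curves\<close>

text \<open>A contour is merely rectifiable: its arc-length parametrization is 1-Lipschitz and
  differentiable only off a null set. This is why a fundamental theorem for Lipschitz curves is
  needed, and why the chain rule along \<gamma> is replaced by a comparison of increments. The
  integrals defining the continuation are gauge integrals in an operator space that need not be
  separable; integrability comes from approximation under a real majorant instead of from
  measurability. Holomorphy in operator norm is proved for this integral directly, and testing
  against vectors serves only for the identities. Of \<open>A0\<close> as an integral against
  \<open>E0\<close> the definitions provide just the quadratic form, so that spectral subspaces
  reduce \<open>A0\<close> must be derived by polarization. For \<open>g = 0\<close> the bound on
  \<open>KB'\<close> does not make the half-line integral absolutely convergent; its convergence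
  comes from positivity of the diagonal matrix elements of \<open>KB'\<close>, whose total integral
  is at most the squared norm of \<open>B01 x\<close>. The case \<open>l = -1\<close> is the mirror
  image of \<open>l = 1\<close>: adjoints exchange the two test vectors and conjugate the
  variable.\<close>

text \<open>The means in \<open>integrable_ccontinuous_explicit\<close> are taken over cubes with
  lower corner \<open>x\<close>; on the line these are difference quotients to the right, which is
  why one side is treated alone.\<close>

lemma indefinite_integral_right_derivative_ae:
  fixes h :: "real \<Rightarrow> real"
  assumes "\<And>a b. h integrable_on {a..b}" and F: "\<And>a b. a \<le> b \<Longrightarrow> F b - F a = integral {a..b} h"
  obtains N where "negligible N" "\<And>x. x \<notin> N \<Longrightarrow> (F has_real_derivative h x) (at_right x)"
proof -
  have "\<And>a b. h integrable_on cbox a b" using assms by simp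
  then obtain N where N: "negligible N" "\<And>x e. \<lbrakk>x \<notin> N; 0 < e\<rbrakk> \<Longrightarrow>
     \<exists>d>0. \<forall>u. 0 < u \<and> u < d \<longrightarrow> norm (integral (cbox x (x + u *\<^sub>R One)) h /\<^sub>R u ^ DIM(real) - h x) < e"
    using integrable_ccontinuous_explicit by blast
  show thesis
  proof (rule that[OF N(1)])
    fix x assume x: "x \<notin> N"
    show "(F has_real_derivative h x) (at_right x)"
      unfolding has_field_derivative_iff
    proof (rule tendstoI)
      fix e :: real assume "0 < e"
      from N(2)[OF x this] obtain d where d: "d > 0"
        "\<And>u. 0 < u \<Longrightarrow> u < d \<Longrightarrow> \<bar>integral {x..x+u} h / u - h x\<bar> < e"
        by (auto simp: divide_inverse_commute)
      have "dist ((F y - F x) / (y - x)) (h x) < e" if "y \<in> {x<..<x+d}" for y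
        using d(2)[of "y - x"] F[of x y] that by (simp add: dist_real_def)
      then show "\<forall>\<^sub>F y in at_right x. dist ((F y - F x) / (y - x)) (h x) < e"
        using d(1) eventually_at_right_field[of _ x] by (auto intro!: exI[of _ "x+d"])
    qed
  qed
qed

text \<open>Reflection at the origin turns the left difference quotients of \<open>F\<close> into
  right ones of \<open>\<lambda>x. - F (- x)\<close>.\<close>

lemma indefinite_integral_derivative_ae:
  fixes h :: "real \<Rightarrow> real"
  assumes h: "\<And>a b. h integrable_on {a..b}" and F: "\<And>a b. a \<le> b \<Longrightarrow> F b - F a = integral {a..b} h"
  obtains N where "negligible N" "\<And>x. x \<notin> N \<Longrightarrow> (F has_real_derivative h x) (at x)"
proof -
  obtain N1 where N1: "negligible N1" "\<And>x. x \<notin> N1 \<Longrightarrow> (F has_real_derivative h x) (at_right x)"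
    using indefinite_integral_right_derivative_ae[OF assms] by blast
  have "(\<lambda>x. h (- x)) integrable_on {a..b}" for a b
    using h[of "-b" "-a"] Henstock_Kurzweil_Integration.integrable_reflect_real[of h "-a" "-b"] by simp
  moreover have "- F (- b) - (- F (- a)) = integral {a..b} (\<lambda>x. h (- x))" if "a \<le> b" for a b
    using F[of "-b" "-a"] that Henstock_Kurzweil_Integration.integral_reflect_real[of "-a" "-b" h] by simp
  ultimately obtain N2 where N2: "negligible N2"
    "\<And>x. x \<notin> N2 \<Longrightarrow> ((\<lambda>x. - F (- x)) has_real_derivative h (- x)) (at_right x)"
    using indefinite_integral_right_derivative_ae[of "\<lambda>x. h (- x)" "\<lambda>x. - F (- x)"] by blast
  show thesis
  proof (rule that)
    show "negligible (N1 \<union> uminus ` N2)"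
    proof (rule negligible_Un[OF N1(1) negligible_locally_Lipschitz_image[OF _ N2(1)]])
      fix x
      have "\<forall>y\<in>N2 \<inter> UNIV. norm (- y - - x) \<le> 1 * norm (y - x)"
        by (simp add: abs_minus_commute)
      then show "\<exists>T B. open T \<and> x \<in> T \<and> (\<forall>y\<in>N2 \<inter> T. norm (- y - - x) \<le> B * norm (y - x))"
        using open_UNIV by blast
    qed simp
    fix x assume x: "x \<notin> N1 \<union> uminus ` N2"
    have "- x \<notin> N2" using x by (metis UnI2 image_eqI minus_minus)
    from N2(2)[OF this] have "((\<lambda>y. (- F (- y) + F x) / (y + x)) \<longlongrightarrow> h x) (at_right (- x))"
      by (simp add: has_field_derivative_iff)
    then have "((\<lambda>y. (- F y + F x) / (- y + x)) \<longlongrightarrow> h x) (at_left x)"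
      by (simp add: at_left_minus[of x] filterlim_filtermap add.commute[of x])
    moreover have "(- F y + F x) / (- y + x) = (F y - F x) / (y - x)" for y
      by (metis minus_divide_divide minus_add_distrib minus_minus add.commute uminus_add_conv_diff)
    ultimately have "(F has_real_derivative h x) (at_left x)"
      by (simp add: has_field_derivative_iff)
    then show "(F has_real_derivative h x) (at x)"
      using N1(2)[of x] x by (simp add: has_field_derivative_iff filterlim_at_split)
  qed
qed

text \<open>The pushforward of Lebesgue measure under the inverse of the bi-Lipschitz map \<open>f + 2 id\<close> is
  absolutely continuous, and its density provides the derivative.\<close>

lemma lipschitz_indefinite_integral:
  fixes f :: "real \<Rightarrow> real"
  assumes lip: "\<And>x y. \<bar>f x - f y\<bar> \<le> \<bar>x - y\<bar>"
  obtains h where "\<And>a b. h integrable_on {a..b}" "\<And>a b. a \<le> b \<Longrightarrow> f b - f a = integral {a..b} h"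
proof -
  \<comment> \<open>Slopes of \<open>f\<close> lie in [-1, 1], so those of \<open>F\<close> lie in
    [1, 3]: the lower bound makes \<open>F\<close> invertible, the upper bound makes it preserve
    null sets.\<close>
  define F where "F x = f x + 2 * x" for x
  have F_mono: "y - x \<le> F y - F x" if "x \<le> y" for x y
    using lip[of x y] that by (simp add: F_def abs_le_iff)
  have F_lip: "\<bar>F y - F x\<bar> \<le> 3 * \<bar>y - x\<bar>" for x y
  proof -
    have "F y - F x = (f y - f x) + 2 * (y - x)" by (simp add: F_def)
    also have "\<bar>\<dots>\<bar> \<le> \<bar>f y - f x\<bar> + \<bar>2 * (y - x)\<bar>" by (rule abs_triangle_ineq)
    also have "\<dots> \<le> 3 * \<bar>y - x\<bar>" using lip[of y x] unfolding abs_mult by simp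
    finally show ?thesis .
  qed
  have smono: "strict_mono F"
  proof (rule strict_monoI)
    show "F x < F y" if "x < y" for x y using F_mono[of x y] that by simp
  qed
  have contF: "continuous_on UNIV F"
    by (rule lipschitz_on_continuous_on[of 3], rule lipschitz_onI)
       (use F_lip in \<open>auto simp: dist_real_def abs_minus_commute\<close>)
  have surj: "\<exists>x. F x = y" for y
  proof -
    have "F (min 0 (y - F 0)) \<le> y" "y \<le> F (max 0 (y - F 0))"
      using F_mono[of "min 0 (y - F 0)" 0] F_mono[of 0 "max 0 (y - F 0)"] by linarith+
    then show ?thesis
      using IVT'[of F "min 0 (y - F 0)" y "max 0 (y - F 0)", OF _ _ _ continuous_on_subset[OF contF]]
      by (auto simp: min_def max_def split: if_splits)
  qed
  define K where "K = inv F"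
  have KF: "K (F x) = x" for x
    unfolding K_def using smono by (simp add: strict_mono_eq inv_f_f strict_mono_imp_inj_on)
  have FK: "F (K y) = y" for y
    unfolding K_def using surj by (metis f_inv_into_f rangeI)
  have K_le: "K y \<le> x \<longleftrightarrow> y \<le> F x" for x y
    by (metis FK smono strict_mono_less_eq)
  have K_less: "K y < x \<longleftrightarrow> y < F x" for x y
    by (metis FK smono strict_mono_less)
  have K_ge: "x \<le> K y \<longleftrightarrow> F x \<le> y" for x y
    by (metis FK smono strict_mono_less_eq)
  have "mono K" by (rule monoI) (simp add: K_le FK)
  then have [measurable]: "K \<in> borel_measurable borel" by (rule borel_measurable_mono)
  define M where "M = distr lborel borel K"
  \<comment> \<open>The preimage of a set under \<open>K\<close> is its image under
    \<open>F\<close>, and a Lipschitz map sends null sets to null sets.\<close>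
  have "absolutely_continuous lborel M"
    unfolding absolutely_continuous_def
  proof
    fix S assume S: "S \<in> null_sets (lborel :: real measure)"
    then have Sb: "S \<in> sets borel" by (auto simp: null_sets_def)
    have "negligible S"
      using S by (simp add: negligible_iff_null_sets null_sets_completionI)
    then have "negligible (F ` S)"
    proof (rule negligible_locally_Lipschitz_image[rotated])
      show "\<exists>T B. open T \<and> x \<in> T \<and> (\<forall>y\<in>S \<inter> T. norm (F y - F x) \<le> B * norm (y - x))" for x
        by (rule exI[of _ UNIV], rule exI[of _ 3]) (use F_lip in auto)
    qed simp
    moreover have "K -` S = F ` S"
      by (auto simp: KF FK intro: image_eqI[of _ F "K _"])
    moreover have "K -` S \<in> sets borel"
      using measurable_sets[OF \<open>K \<in> borel_measurable borel\<close> Sb] by simp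
    ultimately have "emeasure lborel (K -` S) = 0"
      by (auto simp: negligible_iff_null_sets null_sets_completion_iff dest: null_setsD1)
    then show "S \<in> null_sets M"
      using Sb by (simp add: M_def null_sets_def emeasure_distr)
  qed
  then obtain g where g: "g \<in> borel_measurable lborel" "density lborel g = M"
    using sigma_finite_measure.Radon_Nikodym[OF sigma_finite_lborel, of M] by (auto simp: M_def)
  have M_Icc: "emeasure M {a..b} = ennreal (F b - F a)" if "a \<le> b" for a b
  proof -
    have "K -` {a..b} = {F a..F b}" by (auto simp: K_le K_ge)
    then show ?thesis
      using that smono by (simp add: M_def emeasure_distr strict_mono_less_eq)
  qed
  define h where "h x = enn2real (g x)" for x
  have gm[measurable]: "g \<in> borel_measurable borel" using g(1) by simp
  \<comment> \<open>The density takes extended values; its integral over each bounded interval is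
    finite by \<open>M_Icc\<close>, which permits the passage to the real function
    \<open>h\<close>.\<close>
  have fin: "AE x in lborel. g x \<noteq> \<infinity>"
  proof -
    have "AE x in lborel. \<forall>n. x \<in> {-real n..real n} \<longrightarrow> g x \<noteq> \<infinity>"
      unfolding AE_all_countable
    proof
      fix n
      have "(\<integral>\<^sup>+x. g x * indicator {-real n..real n} x \<partial>lborel) = emeasure M {-real n..real n}"
        using g by (simp add: emeasure_density flip: g(2))
      also have "\<dots> \<noteq> \<infinity>" by (simp add: M_Icc)
      finally have "AE x in lborel. g x * indicator {-real n..real n} x \<noteq> \<infinity>"
        by (intro nn_integral_noteq_infinite) auto
      then show "AE x in lborel. x \<in> {-real n..real n} \<longrightarrow> g x \<noteq> \<infinity>"
        by eventually_elim (auto simp: indicator_def)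
    qed
    then show ?thesis
    proof eventually_elim
      case (elim x)
      obtain n where "\<bar>x\<bar> \<le> real n" using real_arch_simple by blast
      then show ?case using elim by (auto simp: abs_le_iff)
    qed
  qed
  have hI: "(h has_integral (F b - F a)) {a..b}" if "a \<le> b" for a b
  proof -
    have "(\<integral>\<^sup>+x. ennreal (h x * indicator {a..b} x) \<partial>lborel) = (\<integral>\<^sup>+x. g x * indicator {a..b} x \<partial>lborel)"
      by (rule nn_integral_cong_AE) (use fin in eventually_elim, auto simp: h_def indicator_def less_top)
    also have "\<dots> = emeasure M {a..b}"
      using g by (simp add: emeasure_density flip: g(2))
    finally have "(\<integral>\<^sup>+x. ennreal (h x * indicator {a..b} x) \<partial>lborel) = ennreal (F b - F a)"
      using M_Icc that by simp
    then have "((\<lambda>x. h x * indicator {a..b} x) has_integral (F b - F a)) UNIV"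
      by (intro nn_integral_has_integral) (use F_mono[OF that] that in \<open>auto simp: h_def\<close>)
    then show ?thesis
      by (subst has_integral_restrict_UNIV[symmetric]) (simp add: indicator_def if_distrib[of "(*) _"] of_bool_def cong: if_cong)
  qed
  have fI: "((\<lambda>x. h x - 2) has_integral (f b - f a)) {a..b}" if "a \<le> b" for a b
    using has_integral_diff[OF hI[OF that] has_integral_const_real[of 2 a b]] that
    by (simp add: F_def algebra_simps)
  show thesis
  proof (rule that)
    show "(\<lambda>x. h x - 2) integrable_on {a..b}" for a b
      using fI[of a b] by (cases "a \<le> b") (auto simp: integrable_on_def)
    show "f b - f a = integral {a..b} (\<lambda>x. h x - 2)" if ab: "a \<le> b" for a b
      using integral_unique[OF fI[OF ab]] by simp
  qed
qed

text \<open>Real and imaginary parts are 1-Lipschitz, so the real case yields an integrable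
  derivative for each. The bound on the speed is read off from the complex difference quotients,
  since the componentwise bounds would only give \<open>sqrt 2\<close>.\<close>

lemma lipschitz_ftc:
  fixes f :: "real \<Rightarrow> complex"
  assumes lip: "\<And>x y. a \<le> x \<Longrightarrow> a \<le> y \<Longrightarrow> dist (f x) (f y) \<le> dist x y"
  obtains N where "negligible N"
    "\<And>x. a < x \<Longrightarrow> x \<notin> N \<Longrightarrow> (f has_vector_derivative vector_derivative f (at x)) (at x)"
    "\<And>x. a < x \<Longrightarrow> x \<notin> N \<Longrightarrow> norm (vector_derivative f (at x)) \<le> 1"
    "\<And>b c. a \<le> b \<Longrightarrow> b \<le> c \<Longrightarrow> ((\<lambda>s. vector_derivative f (at s)) has_integral f c - f b) {b..c}"
proof -
  \<comment> \<open>The constant continuation to the left of \<open>a\<close> stays 1-Lipschitz and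
    agrees with \<open>f\<close> near every point beyond \<open>a\<close>.\<close>
  define p where "p x = f (max a x)" for x
  have p: "dist (p x) (p y) \<le> dist x y" for x y
    using lip[of "max a x" "max a y"] by (auto simp: p_def dist_real_def)
  have "\<bar>Re (p x) - Re (p y)\<bar> \<le> \<bar>x - y\<bar>" "\<bar>Im (p x) - Im (p y)\<bar> \<le> \<bar>x - y\<bar>" for x y
    using p[of x y] abs_Re_le_cmod[of "p x - p y"] abs_Im_le_cmod[of "p x - p y"]
    by (auto simp: dist_norm)
  then obtain u v where
    u: "\<And>a b. u integrable_on {a..b}" "\<And>a b. a \<le> b \<Longrightarrow> Re (p b) - Re (p a) = integral {a..b} u" and
    v: "\<And>a b. v integrable_on {a..b}" "\<And>a b. a \<le> b \<Longrightarrow> Im (p b) - Im (p a) = integral {a..b} v"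
    using lipschitz_indefinite_integral[of "\<lambda>x. Re (p x)"] lipschitz_indefinite_integral[of "\<lambda>x. Im (p x)"] by metis
  obtain N1 where N1: "negligible N1" "\<And>x. x \<notin> N1 \<Longrightarrow> ((\<lambda>x. Re (p x)) has_real_derivative u x) (at x)"
    using indefinite_integral_derivative_ae[OF u] by blast
  obtain N2 where N2: "negligible N2" "\<And>x. x \<notin> N2 \<Longrightarrow> ((\<lambda>x. Im (p x)) has_real_derivative v x) (at x)"
    using indefinite_integral_derivative_ae[OF v] by blast
  have der: "(f has_vector_derivative Complex (u x) (v x)) (at x)" if "a < x" "x \<notin> N1 \<union> N2" for x
  proof -
    have "((\<lambda>x. of_real (Re (p x)) + \<i> * of_real (Im (p x))) has_vector_derivative
        of_real (u x) + \<i> * of_real (v x)) (at x)"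
      using N1(2)[of x] N2(2)[of x] that
      by (intro has_vector_derivative_add has_vector_derivative_mult_right has_vector_derivative_of_real)
         (auto simp: has_real_derivative_iff_has_vector_derivative)
    then have "(p has_vector_derivative Complex (u x) (v x)) (at x)"
      by (simp add: Complex_eq complex_eq[symmetric])
    then show ?thesis
      by (rule has_vector_derivative_transform_within_open[where S = "{a<..}"])
         (use that in \<open>auto simp: p_def max_def\<close>)
  qed
  have vd: "vector_derivative f (at x) = Complex (u x) (v x)" if "a < x" "x \<notin> N1 \<union> N2" for x
    using der[OF that] by (rule vector_derivative_at)
  show thesis
  proof (rule that)
    show "negligible (N1 \<union> N2)" using N1 N2 by simp
    fix x assume x: "a < x" "x \<notin> N1 \<union> N2"
    show d: "(f has_vector_derivative vector_derivative f (at x)) (at x)"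
      using der[OF x] vd[OF x] by simp
    let ?v = "vector_derivative f (at x)"
    let ?q = "\<lambda>y. norm (f y - f x - (y - x) *\<^sub>R ?v) / norm (y - x)"
    have "(?q \<longlongrightarrow> 0) (at x)"
      using d by (simp add: has_vector_derivative_def has_derivative_iff_norm)
    then have "((\<lambda>y. 1 + ?q y) \<longlongrightarrow> 1 + 0) (at x)"
      by (intro tendsto_intros)
    moreover have "\<forall>\<^sub>F y in at x. norm ?v \<le> 1 + ?q y"
    proof -
      have "\<forall>\<^sub>F y in at x. y \<in> {a<..}" by (rule eventually_at_in_open') (use x in auto)
      moreover have "\<forall>\<^sub>F y in at x. y \<noteq> x" by (simp add: eventually_at_filter)
      ultimately show ?thesis
      proof eventually_elim
        case (elim y)
        have "\<bar>y - x\<bar> * norm ?v = norm (f y - f x - (f y - f x - (y - x) *\<^sub>R ?v))" by simp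
        also have "\<dots> \<le> norm (f y - f x) + norm (f y - f x - (y - x) *\<^sub>R ?v)"
          by (rule norm_triangle_ineq4)
        also have "norm (f y - f x) \<le> \<bar>y - x\<bar>"
          using lip[of y x] elim x by (simp add: dist_norm)
        finally show ?case using elim by (simp add: field_simps)
      qed
    qed
    ultimately show "norm ?v \<le> 1"
      using tendsto_lowerbound[of "\<lambda>y. 1 + ?q y" 1 "at x" "norm ?v"] by simp
  next
    fix b c assume bc: "a \<le> b" "b \<le> c"
    have "((\<lambda>s. of_real (u s) + \<i> * of_real (v s)) has_integral 
        (of_real (Re (p c) - Re (p b)) + \<i> * of_real (Im (p c) - Im (p b)))) {b..c}"
      using u v bc by (intro has_integral_add has_integral_mult_right has_integral_of_real) (auto simp: integrable_integral)
    then have "((\<lambda>s. Complex (u s) (v s)) has_integral f c - f b) {b..c}"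
      using bc by (auto simp: Complex_eq[symmetric] p_def max_def complex_eq_iff elim!: has_integral_eq_rhs)
    then show "((\<lambda>s. vector_derivative f (at s)) has_integral f c - f b) {b..c}"
      by (rule has_integral_spike[rotated 2, where S = "insert a (N1 \<union> N2)"])
         (use N1(1) N2(1) vd bc in auto)
  qed
qed

section \<open>Integrals along curves with values in a Banach space\<close>

instance complex_hilbert_space \<subseteq> banach ..

text \<open>Riemann sums of \<open>f\<close> and \<open>g\<close> over the same tagged division
  differ by at most the Riemann sum of \<open>h\<close>, which is small once the gauge is fine; so
  the Cauchy criterion passes from \<open>g\<close> to \<open>f\<close>. The argument works in any
  Banach space.\<close>

lemma integrable_on_cbox_approximable:
  fixes f :: "'n::euclidean_space \<Rightarrow> 'a::banach"
  assumes approx: "\<And>e. e > 0 \<Longrightarrow> \<exists>g h. g integrable_on cbox a b \<and> h integrable_on cbox a b \<and>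
      integral (cbox a b) h \<le> e \<and> (\<forall>x\<in>cbox a b. norm (f x - g x) \<le> (h x :: real))"
  shows "f integrable_on cbox a b"
  unfolding integrable_Cauchy
proof (intro allI impI)
  fix e :: real assume "e > 0"
  \<comment> \<open>A fine Riemann sum of \<open>h\<close> is at most \<open>e / 8 + e / 8\<close>;
    two such errors and two of size \<open>e / 8\<close> for \<open>g\<close> add up to
    \<open>3 * e / 4\<close>.\<close>
  then have e8: "e / 8 > 0" by simp
  then obtain g h where g: "g integrable_on cbox a b" and h: "h integrable_on cbox a b"
    and hle: "integral (cbox a b) h \<le> e / 8" and fg: "\<And>x. x \<in> cbox a b \<Longrightarrow> norm (f x - g x) \<le> h x"
    using approx by blast
  obtain d1 where d1: "gauge d1"
    "\<And>p. p tagged_division_of cbox a b \<Longrightarrow> d1 fine p \<Longrightarrow>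
       norm ((\<Sum>(x,K)\<in>p. measure lborel K *\<^sub>R g x) - integral (cbox a b) g) < e / 8"
    using integrable_integral[OF g] e8 unfolding has_integral by meson
  obtain d2 where d2: "gauge d2"
    "\<And>p. p tagged_division_of cbox a b \<Longrightarrow> d2 fine p \<Longrightarrow>
       norm ((\<Sum>(x,K)\<in>p. measure lborel K *\<^sub>R h x) - integral (cbox a b) h) < e / 8"
    using integrable_integral[OF h] e8 unfolding has_integral by meson
  have close: "norm ((\<Sum>(x,K)\<in>p. measure lborel K *\<^sub>R f x) - (\<Sum>(x,K)\<in>p. measure lborel K *\<^sub>R g x)) \<le> e / 4"
    if p: "p tagged_division_of cbox a b" "d2 fine p" for p
  proof -
    have "(\<Sum>(x,K)\<in>p. measure lborel K *\<^sub>R f x) - (\<Sum>(x,K)\<in>p. measure lborel K *\<^sub>R g x) =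
        (\<Sum>(x,K)\<in>p. measure lborel K *\<^sub>R (f x - g x))"
      by (simp add: sum_subtractf[symmetric] case_prod_unfold scaleR_diff_right)
    also have "norm \<dots> \<le> (\<Sum>(x,K)\<in>p. measure lborel K *\<^sub>R h x)"
    proof (rule sum_norm_le)
      fix y assume "y \<in> p"
      moreover obtain x K where y: "y = (x, K)" by (cases y)
      ultimately have "x \<in> cbox a b" using p(1) by (auto dest: tagged_division_ofD)
      then show "norm (case y of (x, K) \<Rightarrow> measure lborel K *\<^sub>R (f x - g x)) \<le> (case y of (x, K) \<Rightarrow> measure lborel K *\<^sub>R h x)"
        using fg by (simp add: y mult_left_mono)
    qed
    also have "\<dots> \<le> e / 4" using d2(2)[OF p] hle unfolding real_norm_def by linarith
    finally show ?thesis .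
  qed
  show "\<exists>\<gamma>. gauge \<gamma> \<and> (\<forall>p q. p tagged_division_of cbox a b \<and> \<gamma> fine p \<and>
          q tagged_division_of cbox a b \<and> \<gamma> fine q \<longrightarrow>
          norm ((\<Sum>(x,K)\<in>p. measure lborel K *\<^sub>R f x) - (\<Sum>(x,K)\<in>q. measure lborel K *\<^sub>R f x)) < e)"
  proof (intro exI[of _ "\<lambda>x. d1 x \<inter> d2 x"] conjI allI impI; (elim conjE)?)
    show "gauge (\<lambda>x. d1 x \<inter> d2 x)" using d1(1) d2(1) by (rule gauge_Int)
    fix p q assume p: "p tagged_division_of cbox a b" "(\<lambda>x. d1 x \<inter> d2 x) fine p"
      and q: "q tagged_division_of cbox a b" "(\<lambda>x. d1 x \<inter> d2 x) fine q"
    let ?s = "\<lambda>p f. \<Sum>(x,K)\<in>p. measure lborel K *\<^sub>R f x"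
    have "dist (?s p f) (?s p g) \<le> e / 4" "dist (?s q f) (?s q g) \<le> e / 4"
      "dist (?s p g) (integral (cbox a b) g) < e / 8" "dist (?s q g) (integral (cbox a b) g) < e / 8"
      using close[OF p(1)] close[OF q(1)] d1(2)[OF p(1)] d1(2)[OF q(1)] p(2) q(2)
      by (auto simp: fine_Int dist_norm)
    then have "dist (?s p f) (?s q f) < e"
      using dist_triangle[of "?s p f" "?s q f" "?s p g"] dist_triangle[of "?s p g" "?s q f" "integral (cbox a b) g"]
        dist_triangle[of "integral (cbox a b) g" "?s q f" "?s q g"] \<open>e > 0\<close> by (simp add: dist_commute)
    then show "norm (?s p f - ?s q f) < e" by (simp add: dist_norm)
  qed
qed

text \<open>The majorant dominates norms and is therefore nonnegative, so its integral over any box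
  inherits the bound valid on \<open>S\<close>. The approximation is thus uniform over boxes, as
  \<open>integrable_alt\<close> demands.\<close>

lemma integrable_on_approximable:
  fixes f :: "'n::euclidean_space \<Rightarrow> 'a::banach"
  assumes approx: "\<And>e. e > 0 \<Longrightarrow> \<exists>g h. g integrable_on S \<and> h integrable_on S \<and>
      integral S h \<le> e \<and> (\<forall>x\<in>S. norm (f x - g x) \<le> (h x :: real))"
  shows "f integrable_on S"
proof -
  let ?r = "\<lambda>f x. if x \<in> S then f x else 0"
  have *: "\<exists>g h. g integrable_on S \<and> (\<forall>a b. ?r g integrable_on cbox a b) \<and> (\<forall>a b. ?r h integrable_on cbox a b) \<and>
      (\<forall>a b. integral (cbox a b) (?r h) \<le> e) \<and> (\<forall>x. norm (?r f x - ?r g x) \<le> (?r h x :: real))"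
    if e: "e > 0" for e
  proof -
    obtain g h where gh: "g integrable_on S" "h integrable_on S" "integral S h \<le> e"
      "\<And>x. x\<in>S \<Longrightarrow> norm (f x - g x) \<le> (h x :: real)" using approx[OF e] by blast
    have h0: "0 \<le> ?r h x" for x using order_trans[OF norm_ge_zero gh(4)[of x]] by simp
    have hU: "?r h integrable_on UNIV" using gh(2) by (simp add: integrable_restrict_UNIV)
    have hc: "?r h integrable_on cbox a b" for a b using hU integrable_on_subcbox by blast
    have "integral (cbox a b) (?r h) \<le> e" for a b
    proof -
      have "integral (cbox a b) (?r h) \<le> integral UNIV (?r h)"
        by (rule integral_subset_le) (use hU hc h0 in auto)
      also have "\<dots> = integral S h" by (rule integral_restrict_UNIV)
      finally show ?thesis using gh(3) by simp
    qed
    moreover have "?r g integrable_on cbox a b" for a b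
      using gh(1) integrable_altD(1) by blast
    ultimately show ?thesis using gh hc by (intro exI[of _ g] exI[of _ h]) auto
  qed
  have cb: "?r f integrable_on cbox a b" for a b
  proof (rule integrable_on_cbox_approximable)
    fix e :: real assume "e > 0"
    from *[OF this] obtain g h where "g integrable_on S" and g: "\<forall>a b. ?r g integrable_on cbox a b"
      and h: "\<forall>a b. ?r h integrable_on cbox a b" "\<forall>a b. integral (cbox a b) (?r h) \<le> e"
      and fg: "\<forall>x. norm (?r f x - ?r g x) \<le> (?r h x :: real)"
      by (elim exE conjE) (rule that, assumption+)
    then show "\<exists>g h. g integrable_on cbox a b \<and> h integrable_on cbox a b \<and>
        integral (cbox a b) h \<le> e \<and> (\<forall>x\<in>cbox a b. norm (?r f x - g x) \<le> (h x :: real))"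
      by (intro exI[of _ "?r g"] exI[of _ "?r h"]) auto
  qed
  show ?thesis
  proof (subst integrable_alt, intro conjI allI impI cb)
    fix e :: real assume "e > 0"
    then have e4: "e / 4 > 0" by simp
    from *[OF e4] obtain g h where gS: "g integrable_on S" and g: "\<forall>a b. ?r g integrable_on cbox a b"
      and h: "\<forall>a b. ?r h integrable_on cbox a b" "\<forall>a b. integral (cbox a b) (?r h) \<le> e / 4"
      and fg: "\<forall>x. norm (?r f x - ?r g x) \<le> (?r h x :: real)"
      by (elim exE conjE) (rule that, assumption+)
    note gh = gS g[rule_format] h[rule_format] fg[rule_format]
    obtain B where B: "B > 0" "\<And>a b c d. ball 0 B \<subseteq> cbox a b \<Longrightarrow> ball 0 B \<subseteq> cbox c d \<Longrightarrow>
        norm (integral (cbox a b) (?r g) - integral (cbox c d) (?r g)) < e / 4"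
      using conjunct2[OF iffD1[OF integrable_alt gh(1)]] e4 by meson
    have close: "norm (integral (cbox a b) (?r f) - integral (cbox a b) (?r g)) \<le> e / 4" for a b
    proof -
      have "norm (integral (cbox a b) (\<lambda>x. ?r f x - ?r g x)) \<le> integral (cbox a b) (?r h)"
        by (rule integral_norm_bound_integral) (use integrable_diff[OF cb gh(2)] gh in auto)
      then show ?thesis using gh(4)[of a b] integral_diff[OF cb gh(2)] by simp
    qed
    show "\<exists>B>0. \<forall>a b c d. ball 0 B \<subseteq> cbox a b \<and> ball 0 B \<subseteq> cbox c d \<longrightarrow>
       norm (integral (cbox a b) (?r f) - integral (cbox c d) (?r f)) < e"
    proof (intro exI[of _ B] conjI allI impI B(1); elim conjE)
      fix a b c d :: 'n assume ab: "ball 0 B \<subseteq> cbox a b" and cd: "ball 0 B \<subseteq> cbox c d"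
      let ?I = "\<lambda>a b f. integral (cbox a b) (?r f)"
      have "dist (integral (cbox a b) (?r f)) (integral (cbox a b) (?r g)) \<le> e / 4"
        "dist (integral (cbox c d) (?r f)) (integral (cbox c d) (?r g)) \<le> e / 4"
        "dist (integral (cbox a b) (?r g)) (integral (cbox c d) (?r g)) < e / 4"
        using close B(2)[OF ab cd] by (auto simp: dist_norm)
      then have "dist (integral (cbox a b) (?r f)) (integral (cbox c d) (?r f)) < e"
        using dist_triangle[of "integral (cbox a b) (?r f)" "integral (cbox c d) (?r f)" "integral (cbox a b) (?r g)"] 
         dist_triangle[of "integral (cbox a b) (?r g)" "integral (cbox c d) (?r f)" "integral (cbox c d) (?r g)"] \<open>e > 0\<close>
        by (simp add: dist_commute)
      then show "norm (integral (cbox a b) (?r f) - integral (cbox c d) (?r f)) < e" by (simp add: dist_norm)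
    qed
  qed
qed

text \<open>Converts a positive distance from the curve into domination by the weight
  \<open>1 / (1 + cmod c)\<close> of \<open>Var1\<close>, with a constant depending only on
  \<open>z\<close> and \<open>d\<close>.\<close>

lemma cauchy_kernel_bound:
  fixes z c :: complex
  assumes "0 < d" "d \<le> cmod (z - c)"
  shows "1 / cmod (z - c) \<le> ((1 + cmod z) / d + 1) / (1 + cmod c)"
proof -
  have "cmod c \<le> cmod z + cmod (z - c)"
    using norm_triangle_ineq4[of z "z - c"] by simp
  moreover have "(1 + cmod z) \<le> (1 + cmod z) / d * cmod (z - c)"
    using assms mult_left_mono[of d "cmod (z - c)" "(1 + cmod z) / d"] by simp
  ultimately have "1 + cmod c \<le> ((1 + cmod z) / d + 1) * cmod (z - c)"
    by (simp add: algebra_simps)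
  moreover have "0 < cmod (z - c)" "0 < 1 + cmod c" using assms by (linarith, simp add: add_pos_nonneg)
  ultimately show ?thesis by (simp add: field_simps)
qed

text \<open>Covers multiplication of complex numbers and the complex scalar action on operators, so
  that scalar and operator-valued Cauchy integrals share one proof.\<close>

locale normed_complex_action = bounded_bilinear prod
  for prod :: "complex \<Rightarrow> 'a::banach \<Rightarrow> 'a" +
  assumes norm_prod_le: "norm (prod c x) \<le> cmod c * norm x"
    and prod_prod: "prod c (prod d x) = prod (c * d) x"
begin

text \<open>On each piece of a fine division \<open>W\<close> is nearly constant, and
  \<open>u\<close> times a constant vector is integrable. As \<open>u\<close> is bounded by one, the
  error is uniform.\<close>

lemma integrable_prod_continuous:
  fixes u :: "real \<Rightarrow> complex"
  assumes u: "u integrable_on {a..b}" and bnd: "\<And>s. s \<in> {a..b} \<Longrightarrow> norm (u s) \<le> 1"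
    and W: "continuous_on {a..b} W"
  shows "(\<lambda>s. prod (u s) (W s)) integrable_on {a..b}"
  unfolding box_real(2)[symmetric]
proof (rule integrable_uniform_limit)
  fix e :: real assume e: "e > 0"
  then obtain d where "0 < d" and d: "\<And>x x'. \<lbrakk>x \<in> {a..b}; x' \<in> {a..b}; dist x' x < d\<rbrakk> \<Longrightarrow> dist (W x') (W x) < e"
    using compact_uniformly_continuous[OF W compact_Icc] unfolding uniformly_continuous_on_def by metis
  obtain p where ptag: "p tagged_division_of cbox a b" and finep: "(\<lambda>x. ball x d) fine p"
    using fine_division_exists[OF gauge_ball[OF \<open>0 < d\<close>], of a b] .
  let ?f = "\<lambda>s. prod (u s) (W s)"
  have "\<forall>i\<in>snd ` p. \<exists>g. (\<forall>x\<in>i. norm (?f x - g x) \<le> e) \<and> g integrable_on i"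
  proof clarsimp
    fix x l assume as: "(x, l) \<in> p"
    obtain a' b' where l: "l = cbox a' b'" "l \<subseteq> {a..b}" "x \<in> l"
      using as tagged_division_ofD(2-4)[OF ptag as] by (metis box_real(2))
    have "(\<lambda>s. prod (u s) (W x)) integrable_on l"
      using integrable_linear[OF integrable_on_subinterval[OF u] bounded_linear_left[of "W x"]] l
      by (auto simp: o_def)
    moreover have "norm (?f y - prod (u y) (W x)) \<le> e" if y: "y \<in> l" for y
    proof -
      have "y \<in> ball x d" using as finep y by fastforce
      then have "norm (W y - W x) \<le> e"
        using d[of x y] y l by (auto simp: dist_norm dist_commute less_imp_le)
      then have "cmod (u y) * norm (W y - W x) \<le> 1 * e"
        using bnd[of y] y l by (intro mult_mono) auto
      then show ?thesis
        using norm_prod_le[of "u y" "W y - W x"] by (simp add: diff_right)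
    qed
    ultimately show "\<exists>g. (\<forall>x\<in>l. norm (?f x - g x) \<le> e) \<and> g integrable_on l"
      by (intro exI[of _ "\<lambda>s. prod (u s) (W x)"]) simp
  qed
  from approximable_on_division[OF less_imp_le[OF e] division_of_tagged_division[OF ptag] this]
  obtain g where "\<forall>x\<in>cbox a b. norm (?f x - g x) \<le> e" "g integrable_on cbox a b" .
  then show "\<exists>g. (\<forall>x\<in>cbox a b. norm (?f x - g x) \<le> e) \<and> g integrable_on cbox a b" by (intro exI conjI)
qed

text \<open>Restriction to the compact intervals \<open>J n\<close> is covered by the continuous
  case; what is cut off is majorized by \<open>w\<close> outside \<open>J n\<close>, whose integral
  tends to 0.\<close>

lemma integrable_prod_dominated:
  fixes u :: "real \<Rightarrow> complex"
  assumes u: "\<And>a b. 0 < a \<Longrightarrow> u integrable_on {a..b}"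
    and N: "negligible N" "\<And>s. 0 < s \<Longrightarrow> s \<notin> N \<Longrightarrow> norm (u s) \<le> 1"
    and W: "continuous_on {0<..} W"
    and w: "w integrable_on {0<..}" "\<And>s. 0 < s \<Longrightarrow> norm (W s) \<le> w s"
  shows "(\<lambda>s. prod (u s) (W s)) integrable_on {0<..}" (is ?int)
    and "norm (integral {0<..} (\<lambda>s. prod (u s) (W s))) \<le> integral {0<..} w" (is ?bound)
proof -
  \<comment> \<open>\<open>u\<close> will be a \<open>vector_derivative\<close>, whose value on the
    exceptional set is arbitrary and possibly large; zero there restores the bound at every
    point.\<close>
  define v where "v s = (if s \<in> N then 0 else u s)" for s
  have v1: "norm (v s) \<le> 1" if "0 < s" for s using N(2)[OF that] by (simp add: v_def)
  have v: "v integrable_on {a..b}" if "0 < a" for a b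
    using u[OF that] by (rule integrable_spike[OF _ N(1)]) (simp add: v_def)
  let ?f = "\<lambda>s. prod (v s) (W s)"
  have fab: "?f integrable_on {a..b}" if "0 < a" for a b
    by (rule integrable_prod_continuous) (use that v v1 in \<open>auto intro: continuous_on_subset[OF W]\<close>)
  have w0: "0 \<le> w s" if "0 < s" for s using order_trans[OF norm_ge_zero w(2)[OF that]] .
  have fw: "norm (?f s) \<le> w s" if "0 < s" for s
  proof -
    have "norm (?f s) \<le> cmod (v s) * norm (W s)" by (rule norm_prod_le)
    also have "\<dots> \<le> 1 * w s" using v1 w w0 that by (intro mult_mono) auto
    finally show ?thesis by simp
  qed
  define J where "J n = {1 / real (Suc n)..real (Suc n)}" for n
  let ?w = "\<lambda>n s. if s \<in> J n then w s else 0"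
  have Jsub: "J n \<subseteq> {0<..}" for n by (auto simp: J_def intro: less_le_trans[rotated])
  have wJ: "w integrable_on J n" for n
    unfolding J_def by (rule integrable_on_subinterval[OF w(1)]) (use Jsub[of n] J_def in auto)
  have wn: "?w n integrable_on {0<..}" for n
    using wJ[of n] Jsub[of n] by (simp add: integrable_restrict_Int Int_absorb2)
  have "(\<lambda>n. integral {0<..} (?w n)) \<longlonglongrightarrow> integral {0<..} w"
  proof (rule dominated_convergence(2)[OF wn w(1)])
    fix s :: real assume s: "s \<in> {0<..}"
    show "norm (?w n s) \<le> w s" for n using s w0 by simp
    have "\<forall>\<^sub>F n in sequentially. 1 / real (Suc n) < s \<and> s < real (Suc n)"
    proof (rule eventually_conj)
      show "\<forall>\<^sub>F n in sequentially. 1 / real (Suc n) < s"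
        using order_tendstoD(2)[OF LIMSEQ_inverse_real_of_nat, of s] s by (simp add: inverse_eq_divide)
      show "\<forall>\<^sub>F n in sequentially. s < real (Suc n)"
        using filterlim_compose[OF filterlim_real_sequentially filterlim_Suc] by (simp add: filterlim_at_top_dense)
    qed
    then have "\<forall>\<^sub>F n in sequentially. ?w n s = w s"
      by eventually_elim (auto simp: J_def)
    then show "(\<lambda>n. ?w n s) \<longlonglongrightarrow> w s" by (rule tendsto_eventually)
  qed
  then have lim: "(\<lambda>n. integral {0<..} w - integral {0<..} (?w n)) \<longlonglongrightarrow> 0"
    using tendsto_diff[OF tendsto_const[of "integral {0<..} w"]] by fastforce
  have int: "?f integrable_on {0<..}"
  proof (rule integrable_on_approximable)
    fix e :: real assume e: "e > 0"
    from eventually_happens'[OF sequentially_bot order_tendstoD(2)[OF lim e]]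
    obtain n where n: "integral {0<..} w - integral {0<..} (?w n) < e" by (elim exE)
    let ?g = "\<lambda>s. if s \<in> J n then ?f s else 0" and ?h = "\<lambda>s. w s - ?w n s"
    have "?g integrable_on {0<..}"
      using fab[of "1 / real (Suc n)" "real (Suc n)"] Jsub[of n] 
      unfolding J_def[symmetric] by (simp add: integrable_restrict_Int Int_absorb2)
    moreover have "?h integrable_on {0<..}" by (intro integrable_diff w wn)
    moreover have "integral {0<..} ?h \<le> e" using n by (subst integral_diff[OF w(1) wn]) simp
    moreover have "\<forall>s\<in>{0<..}. norm (?f s - ?g s) \<le> ?h s" using fw by auto
    ultimately show "\<exists>g h. g integrable_on {0<..} \<and> h integrable_on {0<..} \<and>
      integral {0<..} h \<le> e \<and> (\<forall>s\<in>{0<..}. norm (?f s - g s) \<le> (h s :: real))"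
      by (intro exI[of _ ?g] exI[of _ ?h]) simp
  qed
  show ?int
    by (rule integrable_spike[OF int N(1)]) (simp add: v_def)
  have "integral {0<..} (\<lambda>s. prod (u s) (W s)) = integral {0<..} ?f"
    by (rule integral_spike[OF N(1)]) (simp add: v_def)
  also have "norm \<dots> \<le> integral {0<..} w"
    by (rule integral_norm_bound_integral[OF int w(1)]) (use fw in auto)
  finally show ?bound .
qed

text \<open>The second-order remainder of the kernel is the square of \<open>z' - z\<close> times a
  product of three Cauchy kernels: two are bounded by \<open>1 / d\<close>, the third supplies the
  weight. This gives differentiation under the integral sign with a quadratic error.\<close>

lemma cauchy_transform:
  fixes u c :: "real \<Rightarrow> complex"
  assumes u: "\<And>a b. 0 < a \<Longrightarrow> u integrable_on {a..b}"
    and N: "negligible N" "\<And>s. 0 < s \<Longrightarrow> s \<notin> N \<Longrightarrow> norm (u s) \<le> 1"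
    and W: "continuous_on {0<..} W" and c: "continuous_on {0<..} c"
    and w: "(\<lambda>s. norm (W s) / (1 + cmod (c s))) integrable_on {0<..}"
    and d: "0 < d" "\<And>s. 0 < s \<Longrightarrow> d \<le> cmod (z - c s)"
  shows "(\<lambda>s. prod (u s) (prod (1 / (z - c s)) (W s))) integrable_on {0<..}"
    and "\<exists>L. ((\<lambda>z. integral {0<..} (\<lambda>s. prod (u s) (prod (1 / (z - c s)) (W s)))) has_derivative (\<lambda>h. prod h L)) (at z)"
proof -
  define w where "w s = norm (W s) / (1 + cmod (c s))" for s
  have w_int: "w integrable_on {0<..}" using w by (simp add: w_def[abs_def])
  have w0: "0 \<le> w s" for s by (simp add: w_def)
  define k where "k z s = prod (1 / (z - c s)) (W s)" for z s
  have int: "(\<lambda>s. prod (u s) (prod (p s) (W s))) integrable_on {0<..} \<and>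
      norm (integral {0<..} (\<lambda>s. prod (u s) (prod (p s) (W s)))) \<le> C * integral {0<..} w"
    if p: "continuous_on {0<..} p" "\<And>s. 0 < s \<Longrightarrow> cmod (p s) \<le> C / (1 + cmod (c s))" for p C
  proof -
    have *: "continuous_on {0<..} (\<lambda>s. prod (p s) (W s))" 
      by (intro continuous_on p W)
    have **: "norm (prod (p s) (W s)) \<le> C * w s" if "0 < s" for s
    proof -
      have "norm (prod (p s) (W s)) \<le> cmod (p s) * norm (W s)" by (rule norm_prod_le)
      also have "\<dots> \<le> C / (1 + cmod (c s)) * norm (W s)"
        by (intro mult_right_mono p that) simp
      finally show ?thesis by (simp add: w_def)
    qed
    show ?thesis
      using integrable_prod_dominated[OF u N *, of "\<lambda>s. C * w s"] ** integrable_cmul[OF w_int, of C] by simp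
  qed
  have nz: "z' - c s \<noteq> 0" if "0 < s" "dist z' z < d" for s z'
    using d(2)[OF that(1)] that(2) by (auto simp: dist_norm norm_minus_commute)
  have far: "d / 2 \<le> cmod (z' - c s)" if "0 < s" "dist z' z < d / 2" for s z'
  proof -
    have "cmod (z - c s) \<le> cmod (z - z') + cmod (z' - c s)"
      using norm_triangle_ineq[of "z - z'" "z' - c s"] by simp
    then show ?thesis using d(2)[OF that(1)] that(2) by (simp add: dist_norm norm_minus_commute)
  qed
  have cont: "continuous_on {0<..} (\<lambda>s. 1 / (z' - c s))" if "dist z' z < d" for z'
    using nz that by (intro continuous_intros c) auto
  \<comment> \<open>From \<open>cauchy_kernel_bound\<close> at distance \<open>d / 2\<close>, with
    \<open>cmod z'\<close> estimated by \<open>cmod z + d\<close>: one constant for all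
    \<open>z'\<close> in the ball of radius \<open>d / 2\<close>.\<close>
  define C where "C = (1 + cmod z + d) / (d / 2) + 1"
  have C0: "0 \<le> C" using d by (simp add: C_def)
  have kb: "cmod (1 / (z' - c s)) \<le> C / (1 + cmod (c s))" if "0 < s" "dist z' z < d / 2" for s z'
  proof -
    have "cmod z' \<le> cmod z + d"
      using norm_triangle_ineq2[of z' z] that(2) d(1) by (simp add: dist_norm)
    then have "((1 + cmod z') / (d/2) + 1) \<le> C"
      using d(1) by (auto simp: C_def intro!: divide_right_mono)
    then have "((1 + cmod z') / (d/2) + 1) / (1 + cmod (c s)) \<le> C / (1 + cmod (c s))"
      by (intro divide_right_mono) (auto simp: add_nonneg_nonneg)
    then show ?thesis
      using cauchy_kernel_bound[OF _ far[OF that]] d(1) by (simp add: norm_divide)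
  qed
  let ?I = "\<lambda>z. integral {0<..} (\<lambda>s. prod (u s) (k z s))"
  have ik: "(\<lambda>s. prod (u s) (k z' s)) integrable_on {0<..}" if "dist z' z < d / 2" for z'
    using int[OF cont kb] that d(1) by (auto simp: k_def)
  show "(\<lambda>s. prod (u s) (prod (1 / (z - c s)) (W s))) integrable_on {0<..}"
    using ik[of z] d(1) by (simp add: k_def)
  \<comment> \<open>Derivative of \<open>1 / (z - c s)\<close> with respect to
    \<open>z\<close>.\<close>
  define q where "q s = - (1 / (z - c s)) * (1 / (z - c s))" for s
  define L where "L = integral {0<..} (\<lambda>s. prod (u s) (prod (q s) (W s)))"
  have q: "continuous_on {0<..} q" unfolding q_def using d(1) by (intro continuous_intros cont) auto
  have inv_d: "cmod (1 / (z - c s)) \<le> 1 / d" if "0 < s" for s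
    using d(1) d(2)[OF that] by (simp add: norm_divide frac_le)
  have qb: "cmod (q s) \<le> (1 / d * C) / (1 + cmod (c s))" if "0 < s" for s
    using mult_mono[OF inv_d[OF that] kb[OF that, of z]] d(1) by (simp add: q_def norm_mult norm_divide)
  note iq = int[OF q qb]
  have est: "norm (?I z' - ?I z - prod (z' - z) L) \<le> (cmod (z' - z))\<^sup>2 * (1 / d * (1 / d) * C * integral {0<..} w)"
    if z': "dist z' z < d / 2" for z'
  proof -
    define h where "h = z' - z"
    define r where "r s = h * h * ((1 / (z - c s)) * (1 / (z - c s)) * (1 / (z' - c s)))" for s
    have rc: "continuous_on {0<..} r"
      unfolding r_def using d(1) z' by (intro continuous_intros cont) auto
    have rb: "cmod (r s) \<le> (cmod h)\<^sup>2 * (1 / d * (1 / d) * C) / (1 + cmod (c s))" if s: "0 < s" for s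
    proof -
      have "cmod (1 / (z - c s)) * cmod (1 / (z - c s)) * cmod (1 / (z' - c s)) \<le> 1 / d * (1 / d) * (C / (1 + cmod (c s)))"
        using d(1) by (intro mult_mono inv_d s kb z') auto
      then have "(cmod h)\<^sup>2 * (cmod (1 / (z - c s)) * cmod (1 / (z - c s)) * cmod (1 / (z' - c s))) \<le> (cmod h)\<^sup>2 * (1 / d * (1 / d) * (C / (1 + cmod (c s))))"
        by (intro mult_left_mono) auto
      moreover have "cmod (r s) = (cmod h)\<^sup>2 * (cmod (1 / (z - c s)) * cmod (1 / (z - c s)) * cmod (1 / (z' - c s)))"
        unfolding r_def norm_mult power2_eq_square ..
      ultimately show ?thesis by (simp add: mult.assoc)
    qed
    have "?I z' - ?I z - prod h L = integral {0<..} (\<lambda>s. prod (u s) (k z' s) - prod (u s) (k z s) - prod h (prod (u s) (prod (q s) (W s))))"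
    proof -
      have "prod h L = integral {0<..} (\<lambda>s. prod h (prod (u s) (prod (q s) (W s))))"
        unfolding L_def using integral_linear[OF conjunct1[OF iq] bounded_linear_right[of h]] by (simp add: o_def)
      moreover have "(\<lambda>s. prod h (prod (u s) (prod (q s) (W s)))) integrable_on {0<..}"
        using integrable_linear[OF conjunct1[OF iq] bounded_linear_right[of h]] by (simp add: o_def)
      ultimately show ?thesis
        using ik[of z] ik[OF z'] d(1) by (simp add: integral_diff integrable_diff)
    qed
    also have "\<dots> = integral {0<..} (\<lambda>s. prod (u s) (prod (r s) (W s)))"
    proof (rule integral_cong)
      fix s :: real assume s: "s \<in> {0<..}"
      have nz1: "z - c s \<noteq> 0" "z' - c s \<noteq> 0" using nz[of s z] nz[of s z'] s d(1) z' by auto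
      have "1 / (z' - c s) - 1 / (z - c s) - h * q s = r s"
        using nz1 by (simp add: h_def q_def r_def divide_simps) (simp add: algebra_simps)
      then have "prod (r s) (W s) = k z' s - k z s - prod h (prod (q s) (W s))"
        by (simp add: k_def prod_prod flip: diff_left)
      then show "prod (u s) (k z' s) - prod (u s) (k z s) - prod h (prod (u s) (prod (q s) (W s))) = prod (u s) (prod (r s) (W s))"
        by (simp add: diff_right prod_prod mult.commute mult.left_commute)
    qed
    finally show ?thesis
      using conjunct2[OF int[OF rc rb]] by (simp add: h_def mult.assoc)
  qed
  have "(?I has_derivative (\<lambda>h. prod h L)) (at z)"
    unfolding has_derivative_iff_norm
  proof
    let ?K = "1 / d * (1 / d) * C * integral {0<..} w"
    show "((\<lambda>y. norm (?I y - ?I z - prod (y - z) L) / norm (y - z)) \<longlongrightarrow> 0) (at z)"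
    proof (rule Lim_null_comparison)
      have "((\<lambda>y. cmod (y - z) * ?K) \<longlongrightarrow> cmod (z - z) * ?K) (at z)"
        by (intro tendsto_intros)
      then show "((\<lambda>y. cmod (y - z) * ?K) \<longlongrightarrow> 0) (at z)" by simp
      have "\<forall>\<^sub>F y in at z. dist y z < d / 2"
        using d(1) eventually_at by (metis half_gt_zero)
      moreover have "\<forall>\<^sub>F y in at z. y \<noteq> z" by (simp add: eventually_at_filter)
      ultimately show "\<forall>\<^sub>F y in at z. norm (norm (?I y - ?I z - prod (y - z) L) / norm (y - z)) \<le> cmod (y - z) * ?K"
      proof eventually_elim
        case (elim y)
        then show ?case using est[of y] by (simp add: divide_le_eq power2_eq_square mult_ac)
      qed
    qed
  qed (rule bounded_linear_left)
  then show "\<exists>L. ((\<lambda>z. integral {0<..} (\<lambda>s. prod (u s) (prod (1 / (z - c s)) (W s)))) has_derivative (\<lambda>h. prod h L)) (at z)"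
    by (auto simp: k_def)
qed

end

lemma normed_complex_action_times: "normed_complex_action ((*) :: complex \<Rightarrow> complex \<Rightarrow> complex)"
  by (intro normed_complex_action.intro bounded_bilinear_mult normed_complex_action_axioms.intro)
     (auto simp: norm_mult)

lemma blinfun_apply_scaleC [simp]: "blinfun_apply (c *\<^sub>C T) x = c *\<^sub>C blinfun_apply T x"
  by (simp add: scaleC_blinfun.rep_eq)

lemma normed_complex_action_blinfun:
  "normed_complex_action ((*\<^sub>C) :: complex \<Rightarrow> ('a::real_normed_vector \<Rightarrow>\<^sub>L 'b::complex_hilbert_space) \<Rightarrow> _)"
proof
  have le: "norm (c *\<^sub>C T) \<le> cmod c * norm T" for c and T :: "'a \<Rightarrow>\<^sub>L 'b"
    by (rule norm_blinfun_bound) (auto simp: norm_scaleC mult.assoc intro!: mult_left_mono norm_blinfun)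
  then show "norm (c *\<^sub>C T) \<le> cmod c * norm T" for c and T :: "'a \<Rightarrow>\<^sub>L 'b" .
  show "\<exists>K. \<forall>c (T :: 'a \<Rightarrow>\<^sub>L 'b). norm (c *\<^sub>C T) \<le> cmod c * norm T * K"
    using le by (intro exI[of _ 1]) simp
  fix c d :: complex and S T :: "'a \<Rightarrow>\<^sub>L 'b" and r :: real
  show "(c + d) *\<^sub>C T = c *\<^sub>C T + d *\<^sub>C T" "c *\<^sub>C (S + T) = c *\<^sub>C S + c *\<^sub>C T"
    "c *\<^sub>C d *\<^sub>C T = (c * d) *\<^sub>C T"
    by (auto intro!: blinfun_eqI simp: blinfun.add_left scaleC_add_left scaleC_add_right scaleC_scaleC)
  show "(r *\<^sub>R c) *\<^sub>C T = r *\<^sub>R c *\<^sub>C T" "c *\<^sub>C r *\<^sub>R T = r *\<^sub>R c *\<^sub>C T"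
    by (auto intro!: blinfun_eqI simp: blinfun.scaleR_left scaleR_scaleC scaleC_scaleC scaleR_conv_of_real mult.commute)
qed

section \<open>Deformation of the half-line into a contour\<close>

interpretation times_action: normed_complex_action "(*) :: complex \<Rightarrow> complex \<Rightarrow> complex"
  by (rule normed_complex_action_times)

section \<open>Cauchy transforms with respect to a weighted curve\<close>

lemma continuous_dominated_integrable:
  fixes f :: "real \<Rightarrow> real"
  assumes f: "continuous_on {0<..} f" and h: "h integrable_on {0<..}" and le: "\<And>s. 0 < s \<Longrightarrow> \<bar>f s\<bar> \<le> h s"
  shows "f integrable_on {0<..}"
proof -
  have "(\<lambda>s. 1 * complex_of_real (f s)) integrable_on {0<..}"
    by (rule times_action.integrable_prod_dominated(1)[OF _ negligible_empty _ _ h])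
       (use le in \<open>auto intro!: continuous_intros f integrable_const_ivl\<close>)
  from integrable_linear[OF this bounded_linear_Re] show ?thesis by (simp add: o_def)
qed

text \<open>\<open>v\<close> stands for the derivative of \<open>c\<close> but is tied to it by
  nothing. This admits the contour with its derivative corrected on a null set, the half-line, and a
  displaced half-line with a segment switched off by weight zero.\<close>

locale weighted_curve =
  fixes c v \<kappa> :: "real \<Rightarrow> complex"
  assumes c: "continuous_on {0<..} c" and \<kappa>: "continuous_on {0<..} \<kappa>"
    and v: "\<And>a b. 0 < a \<Longrightarrow> v integrable_on {a..b}" and v1: "\<And>s. 0 < s \<Longrightarrow> cmod (v s) \<le> 1"
    and weight: "(\<lambda>s. cmod (\<kappa> s) / (1 + cmod (c s))) integrable_on {0<..}"
begin

definition transform :: "complex \<Rightarrow> complex" where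
  "transform z = integral {0<..} (\<lambda>s. v s * (1 / (z - c s) * \<kappa> s))"

lemma weight_const:
  assumes d: "0 < d" "\<And>s. 0 < s \<Longrightarrow> d \<le> cmod (z - c s)"
  obtains M where "\<And>s. 0 < s \<Longrightarrow> cmod (1 / (z - c s) * \<kappa> s) \<le> M * (cmod (\<kappa> s) / (1 + cmod (c s)))"
proof
  fix s :: real assume s: "0 < s"
  let ?M = "(1 + cmod z) / d + 1"
  have "cmod (1 / (z - c s) * \<kappa> s) = 1 / cmod (z - c s) * cmod (\<kappa> s)"
    by (simp add: norm_mult norm_divide)
  also have "\<dots> \<le> ?M / (1 + cmod (c s)) * cmod (\<kappa> s)"
    by (intro mult_right_mono cauchy_kernel_bound d s) simp
  finally show "cmod (1 / (z - c s) * \<kappa> s) \<le> ?M * (cmod (\<kappa> s) / (1 + cmod (c s)))" by simp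
qed

lemma cont_kernel:
  assumes d: "0 < d" "\<And>s. 0 < s \<Longrightarrow> d \<le> cmod (z - c s)"
  shows "continuous_on {0<..} (\<lambda>s. 1 / (z - c s) * \<kappa> s)"
  by (rule continuous_on_mult[OF continuous_on_divide[OF continuous_on_const
        continuous_on_diff[OF continuous_on_const c]] \<kappa>]) (use d in force)

lemma integrable_kernel:
  assumes d: "0 < d" "\<And>s. 0 < s \<Longrightarrow> d \<le> cmod (z - c s)"
    and p: "continuous_on {0<..} p" "\<And>s. 0 < s \<Longrightarrow> cmod (p s) \<le> 1"
  shows "(\<lambda>s. v s * (p s * (1 / (z - c s) * \<kappa> s))) integrable_on {0<..}"
proof -
  obtain M where M: "\<And>s. 0 < s \<Longrightarrow> cmod (1 / (z - c s) * \<kappa> s) \<le> M * (cmod (\<kappa> s) / (1 + cmod (c s)))"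
    using weight_const[OF d] by blast
  show ?thesis
  proof (rule times_action.integrable_prod_dominated(1)[where N = "{}" and w = "\<lambda>s. M * (cmod (\<kappa> s) / (1 + cmod (c s)))"])
    show "continuous_on {0<..} (\<lambda>s. p s * (1 / (z - c s) * \<kappa> s))"
      by (rule continuous_on_mult[OF p(1) cont_kernel[OF d]])
    show "(\<lambda>s. M * (cmod (\<kappa> s) / (1 + cmod (c s)))) integrable_on {0<..}"
      using integrable_cmul[OF weight, of M] by simp
    fix s :: real assume s: "0 < s"
    have "cmod (p s * (1 / (z - c s) * \<kappa> s)) = cmod (p s) * cmod (1 / (z - c s) * \<kappa> s)" by (rule norm_mult)
    also have "\<dots> \<le> 1 * (M * (cmod (\<kappa> s) / (1 + cmod (c s))))"
      by (intro mult_mono p s M) auto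
    finally show "cmod (p s * (1 / (z - c s) * \<kappa> s)) \<le> M * (cmod (\<kappa> s) / (1 + cmod (c s)))" by simp
  qed (use v v1 in auto)
qed

text \<open>Serves to remove regularizing factors: they are bounded by one, so a single majorant
  from \<open>weight_const\<close> works for all \<open>n\<close>.\<close>

lemma transform_limit:
  assumes d: "0 < d" "\<And>s. 0 < s \<Longrightarrow> d \<le> cmod (z - c s)"
    and p: "\<And>n. continuous_on {0<..} (p n)" "\<And>n s. 0 < s \<Longrightarrow> cmod (p n s) \<le> 1"
    and lim: "\<And>s. 0 < s \<Longrightarrow> (\<lambda>n. p n s) \<longlonglongrightarrow> 1"
  shows "(\<lambda>n. integral {0<..} (\<lambda>s. v s * (p n s * (1 / (z - c s) * \<kappa> s)))) \<longlonglongrightarrow> transform z"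
proof -
  obtain M where M: "\<And>s. 0 < s \<Longrightarrow> cmod (1 / (z - c s) * \<kappa> s) \<le> M * (cmod (\<kappa> s) / (1 + cmod (c s)))"
    using weight_const[OF d] by blast
  show ?thesis unfolding transform_def
  proof (rule dominated_convergence(2)[where h = "\<lambda>s. M * (cmod (\<kappa> s) / (1 + cmod (c s)))"])
    show "(\<lambda>s. v s * (p n s * (1 / (z - c s) * \<kappa> s))) integrable_on {0<..}" for n
      by (rule integrable_kernel[OF d p])
    show "(\<lambda>s. M * (cmod (\<kappa> s) / (1 + cmod (c s)))) integrable_on {0<..}"
      using integrable_cmul[OF weight, of M] by simp
    fix s :: real assume "s \<in> {0<..}" then have s: "0 < s" by simp
    show "cmod (v s * (p n s * (1 / (z - c s) * \<kappa> s))) \<le> M * (cmod (\<kappa> s) / (1 + cmod (c s)))" for n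
    proof -
      have "cmod (v s) * (cmod (p n s) * cmod (1 / (z - c s) * \<kappa> s)) \<le> 1 * (1 * (M * (cmod (\<kappa> s) / (1 + cmod (c s)))))"
        by (intro mult_mono p v1 s M) auto
      then show ?thesis by (simp only: norm_mult mult_1)
    qed
    have "(\<lambda>n. v s * (p n s * (1 / (z - c s) * \<kappa> s))) \<longlonglongrightarrow> v s * (1 * (1 / (z - c s) * \<kappa> s))"
      by (intro tendsto_intros lim s)
    then show "(\<lambda>n. v s * (p n s * (1 / (z - c s) * \<kappa> s))) \<longlonglongrightarrow> v s * (1 / (z - c s) * \<kappa> s)" by simp
  qed
qed

text \<open>The end points are general sequences because on the contour they are dictated by where
  circles about \<alpha> meet it.\<close>

lemma truncation_limit:
  assumes d: "0 < d" "\<And>s. 0 < s \<Longrightarrow> d \<le> cmod (z - c s)"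
    and p: "continuous_on {0<..} p" "\<And>s. 0 < s \<Longrightarrow> cmod (p s) \<le> 1"
    and a: "\<And>n. 0 < a n" "a \<longlonglongrightarrow> 0" and b: "filterlim b at_top sequentially"
  shows "(\<lambda>n. integral {a n..b n} (\<lambda>s. v s * (p s * (1 / (z - c s) * \<kappa> s)))) \<longlonglongrightarrow>
     integral {0<..} (\<lambda>s. v s * (p s * (1 / (z - c s) * \<kappa> s)))"
proof -
  obtain M where M: "\<And>s. 0 < s \<Longrightarrow> cmod (1 / (z - c s) * \<kappa> s) \<le> M * (cmod (\<kappa> s) / (1 + cmod (c s)))"
    using weight_const[OF d] by blast
  let ?h = "\<lambda>s. v s * (p s * (1 / (z - c s) * \<kappa> s))"
  let ?w = "\<lambda>s. M * (cmod (\<kappa> s) / (1 + cmod (c s)))"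
  have sub: "{a n..b n} \<subseteq> {0<..}" for n using a(1)[of n] by auto
  have h: "?h integrable_on {0<..}" by (rule integrable_kernel[OF d p])
  have eq: "integral {a n..b n} ?h = integral {0<..} (\<lambda>s. if s \<in> {a n..b n} then ?h s else 0)" for n
    using sub[of n] by (subst integral_restrict_Int) (simp add: Int_absorb2)
  have hw: "cmod (?h s) \<le> ?w s" if s: "0 < s" for s
  proof -
    have "cmod (v s) * (cmod (p s) * cmod (1 / (z - c s) * \<kappa> s)) \<le> 1 * (1 * ?w s)"
      by (intro mult_mono p v1 s M) auto
    then show ?thesis by (simp only: norm_mult mult_1)
  qed
  show ?thesis
    unfolding eq
  proof (rule dominated_convergence(2)[where h = ?w])
    show "(\<lambda>s. if s \<in> {a n..b n} then ?h s else 0) integrable_on {0<..}" for n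
    proof -
      have "?h integrable_on {a n..b n}" by (rule integrable_on_subinterval[OF h sub])
      then show ?thesis using sub[of n] by (subst integrable_restrict_Int) (simp add: Int_absorb2)
    qed
    show "?w integrable_on {0<..}" using integrable_cmul[OF weight, of M] by simp
    fix s :: real assume s: "s \<in> {0<..}"
    have w0: "0 \<le> ?w s" using order_trans[OF norm_ge_zero M[of s]] s by simp
    show "cmod (if s \<in> {a n..b n} then ?h s else 0) \<le> ?w s" for n
      using hw[of s] w0 s by simp
    have "\<forall>\<^sub>F n in sequentially. a n < s" using order_tendstoD(2)[OF a(2)] s by simp
    moreover have "\<forall>\<^sub>F n in sequentially. s < b n" using b by (simp add: filterlim_at_top_dense)
    ultimately have "\<forall>\<^sub>F n in sequentially. (if s \<in> {a n..b n} then ?h s else 0) = ?h s"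
      by eventually_elim simp
    then show "(\<lambda>n. if s \<in> {a n..b n} then ?h s else 0) \<longlonglongrightarrow> ?h s" by (rule tendsto_eventually)
  qed
qed

lemma transform_differentiable:
  assumes d: "0 < d" "\<And>s. 0 < s \<Longrightarrow> d \<le> cmod (z - c s)"
  shows "transform field_differentiable (at z)"
proof -
  from times_action.cauchy_transform(2)[OF v negligible_empty v1 \<kappa> c weight d]
  obtain L where "(transform has_derivative (\<lambda>h. h * L)) (at z)"
    unfolding transform_def[abs_def] by blast
  then show ?thesis
    unfolding field_differentiable_def has_field_derivative_def by (auto simp: mult.commute[of _ L])
qed

end

section \<open>Geometry of the domain between half-line and contour\<close>

text \<open>A compact initial piece has positive distance from \<open>z\<close>, and on the rest the
  modulus is at least \<open>cmod z + 1\<close>.\<close>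

lemma dist_proper_curve:
  fixes \<gamma> :: "real \<Rightarrow> complex"
  assumes \<gamma>_cont: "continuous_on {0..} \<gamma>" and \<gamma>_inf: "filterlim \<gamma> at_infinity at_top"
    and a: "z \<notin> \<gamma> ` {a..}" "0 \<le> a"
  obtains d where "0 < d" "\<And>s. a \<le> s \<Longrightarrow> d \<le> cmod (z - \<gamma> s)"
proof -
  have "\<forall>\<^sub>F s in at_top. cmod z + 1 \<le> cmod (\<gamma> s)"
    using \<gamma>_inf filterlim_at_infinity[OF order_refl, of \<gamma> at_top] add_nonneg_pos[OF norm_ge_zero zero_less_one]
    by metis
  then obtain S where S: "\<And>s. S \<le> s \<Longrightarrow> cmod z + 1 \<le> cmod (\<gamma> s)"
    by (auto simp: eventually_at_top_linorder)
  have "compact (\<gamma> ` {a..S})"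
    by (intro compact_continuous_image continuous_on_subset[OF \<gamma>_cont]) (use a(2) in auto)
  then have "closed (\<gamma> ` {a..S})" by (rule compact_imp_closed)
  moreover have "z \<notin> \<gamma> ` {a..S}" using a(1) by auto
  ultimately obtain e where e: "0 < e" "\<And>s. s \<in> {a..S} \<Longrightarrow> e \<le> dist z (\<gamma> s)"
    using separate_point_closed[of "\<gamma> ` {a..S}" z] by auto
  show thesis
  proof (rule that[of "min e 1"])
    fix s :: real assume "a \<le> s"
    show "min e 1 \<le> cmod (z - \<gamma> s)"
    proof (cases "s \<le> S")
      case True
      then show ?thesis using e(2)[of s] \<open>a \<le> s\<close> by (simp add: dist_norm)
    next
      case False
      then have "1 \<le> cmod (\<gamma> s) - cmod z" using S[of s] by simp
      also have "\<dots> \<le> cmod (\<gamma> s - z)" by (rule norm_triangle_ineq2)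
      finally show ?thesis by (simp add: norm_minus_commute)
    qed
  qed (use e in auto)
qed

text \<open>The scalar problem for a matrix element \<open>k\<close> of \<open>KB'\<close>,
  normalised to the upper half-plane; the lower one is reached by conjugation.
  \<open>weight_\<gamma>\<close> will come from the finiteness of \<open>Var1\<close>,
  \<open>weight_real\<close> from the spectral measure.\<close>

locale halfplane_contour =
  fixes D G :: "complex set" and \<alpha> C g :: real and k :: "complex \<Rightarrow> complex" and \<gamma> :: "real \<Rightarrow> complex"
  assumes D: "open D" "simply_connected D" "D \<subseteq> {z. 0 < Im z}"
    and k_hol: "k holomorphic_on D"
    and k_cont: "continuous_on (of_real ` {\<alpha><..} \<union> D) k"
    and k_bound: "\<And>\<mu>. \<mu> \<in> D \<Longrightarrow> cmod (k \<mu>) \<le> C * cmod (\<mu> - of_real \<alpha>) powr g"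
    and g: "0 < C" "-1 < g" "g \<le> 0"
    and G: "open G" "connected G" "G \<subseteq> D"
    and G_frontier: "frontier G = of_real ` {\<alpha>..} \<union> \<gamma> ` {0..}"
    and \<gamma>0: "\<gamma> 0 = of_real \<alpha>" and \<gamma>D: "\<And>s. 0 < s \<Longrightarrow> \<gamma> s \<in> D"
    and \<gamma>_lip: "\<And>x y. 0 \<le> x \<Longrightarrow> 0 \<le> y \<Longrightarrow> dist (\<gamma> x) (\<gamma> y) \<le> dist x y"
    and \<gamma>_inf: "filterlim \<gamma> at_infinity at_top"
    and weight_\<gamma>: "(\<lambda>s. cmod (k (\<gamma> s)) / (1 + cmod (\<gamma> s))) integrable_on {0<..}"
    and weight_real: "(\<lambda>s. cmod (k (of_real (\<alpha> + s))) / (1 + cmod (complex_of_real (\<alpha> + s)))) integrable_on {0<..}"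
begin

lemma \<gamma>_cont: "continuous_on {0..} \<gamma>"
  by (rule lipschitz_on_continuous_on[of 1], rule lipschitz_onI) (use \<gamma>_lip in auto)

lemma \<gamma>_Im: "0 < s \<Longrightarrow> 0 < Im (\<gamma> s)"
  using \<gamma>D D(3) by blast

lemma dist_\<gamma>:
  assumes "z \<notin> \<gamma> ` {a..}" "0 \<le> a"
  obtains d where "0 < d" "\<And>s. a \<le> s \<Longrightarrow> d \<le> cmod (z - \<gamma> s)"
  using dist_proper_curve[OF \<gamma>_cont \<gamma>_inf assms] by blast

lemma real_notin_\<gamma>: "\<alpha> < t \<Longrightarrow> of_real t \<notin> \<gamma> ` {0..}"
proof
  assume t: "\<alpha> < t" and "of_real t \<in> \<gamma> ` {0..}"
  then obtain s where s: "of_real t = \<gamma> s" "0 \<le> s" by auto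
  with t \<gamma>0 have "s \<noteq> 0" by auto
  then have "0 < Im (\<gamma> s)" using \<gamma>_Im s(2) by simp
  then show False by (simp flip: s(1))
qed

text \<open>\<gamma> keeps a positive distance from \<open>t\<close>, so a small open half-disc
  above \<open>t\<close> misses the frontier of \<open>G\<close>. It meets \<open>G\<close> because
  \<open>t\<close> is a frontier point, and being connected it cannot leave.\<close>

lemma half_disc:
  assumes t: "\<alpha> < t"
  obtains r where "0 < r" "r < t - \<alpha>" "{\<mu> \<in> ball (of_real t) r. 0 < Im \<mu>} \<subseteq> G"
proof -
  obtain d where d: "0 < d" "\<And>s. 0 \<le> s \<Longrightarrow> d \<le> cmod (of_real t - \<gamma> s)"
    using dist_\<gamma>[OF real_notin_\<gamma>[OF t] order_refl] by blast
  define r where "r = min d ((t - \<alpha>) / 2)"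
  have r: "0 < r" "r < t - \<alpha>" "r \<le> d" using d(1) t by (auto simp: r_def min_def)
  let ?U = "ball (complex_of_real t) r \<inter> {\<mu>. 0 < Im \<mu>}"
  have "of_real t \<in> frontier G" using G_frontier t by auto
  then have "of_real t \<in> closure G" by (simp add: frontier_def)
  then obtain y where "y \<in> G" "dist y (of_real t) < r"
    using r(1) by (auto simp: closure_approachable)
  then have "y \<in> ?U \<inter> G" using G(3) D(3) by (auto simp: dist_commute)
  then have ne: "?U \<inter> G \<noteq> {}" by blast
  have "?U \<subseteq> G"
  proof (rule ccontr)
    assume "\<not> ?U \<subseteq> G"
    moreover have "connected ?U"
      by (intro convex_connected convex_Int convex_ball convex_halfspace_Im_gt)
    ultimately have "?U \<inter> frontier G \<noteq> {}"
      using ne connected_Int_frontier[of ?U G] by blast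
    then obtain \<mu> where \<mu>: "\<mu> \<in> ?U" "\<mu> \<in> frontier G" by blast
    then obtain s where "\<mu> = \<gamma> s" "0 \<le> s" unfolding G_frontier by auto
    then show False using d(2)[of s] \<mu>(1) r(3) by (simp add: dist_norm)
  qed
  then show thesis using r by (intro that[of r]) auto
qed

lemma half_disc_closed:
  assumes "\<alpha> < t" "r < t - \<alpha>" "{\<mu> \<in> ball (of_real t) r. 0 < Im \<mu>} \<subseteq> G"
    and \<mu>: "\<mu> \<in> ball (of_real t) r" "0 \<le> Im \<mu>"
  shows "\<mu> \<in> of_real ` {\<alpha><..} \<union> D"
proof (cases "Im \<mu> = 0")
  case True
  then have \<mu>_eq: "\<mu> = of_real (Re \<mu>)" by (simp add: complex_eq_iff)
  have "\<bar>t - Re \<mu>\<bar> < r"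
    using abs_Re_le_cmod[of "of_real t - \<mu>"] \<mu>(1) by (simp add: dist_norm)
  then show ?thesis using assms(2) by (subst \<mu>_eq) (auto simp: image_iff)
next
  case False
  then show ?thesis using assms G(3) by auto
qed

text \<open>Simple connectedness gives a primitive inside \<open>D\<close>; near a real point a
  convex half-disc gives one up to its diameter, and the two differ by a constant above it.\<close>

lemma boundary_primitive:
  assumes f: "f holomorphic_on D" "continuous_on (of_real ` {\<alpha><..} \<union> D) f"
  obtains Q where "\<And>\<mu>. \<mu> \<in> D \<Longrightarrow> (Q has_field_derivative f \<mu>) (at \<mu>)"
    "\<And>t. \<alpha> < t \<Longrightarrow> \<exists>r>0. r < t - \<alpha> \<and> {\<mu> \<in> ball (of_real t) r. 0 < Im \<mu>} \<subseteq> G \<and>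
        (Q has_field_derivative f (of_real t)) (at (of_real t) within {\<mu> \<in> ball (of_real t) r. 0 \<le> Im \<mu>})"
proof -
  obtain P where P: "\<And>\<mu>. \<mu> \<in> D \<Longrightarrow> (P has_field_derivative f \<mu>) (at \<mu>)"
    using D f(1) by (metis simply_connected_eq_global_primitive)
  \<comment> \<open>Vertical limits fix the boundary values independently of any half-disc, so the
    local extensions agree automatically.\<close>
  define Q where "Q \<mu> = (if 0 < Im \<mu> then P \<mu> else Lim (at_right 0) (\<lambda>\<delta>. P (\<mu> + \<i> * of_real \<delta>)))" for \<mu>
  show thesis
  proof (rule that[of Q])
    fix \<mu> assume \<mu>: "\<mu> \<in> D"
    show "(Q has_field_derivative f \<mu>) (at \<mu>)"
      by (rule has_field_derivative_transform_within_open[OF P[OF \<mu>] D(1) \<mu>]) (use D(3) in \<open>auto simp: Q_def\<close>)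
  next
    fix t assume t: "\<alpha> < t"
    obtain r where r: "0 < r" "r < t - \<alpha>" "{\<mu> \<in> ball (of_real t) r. 0 < Im \<mu>} \<subseteq> G"
      using half_disc[OF t] by blast
    define H where "H = {\<mu> \<in> ball (complex_of_real t) r. 0 \<le> Im \<mu>}"
    define U where "U = {\<mu> \<in> ball (complex_of_real t) r. 0 < Im \<mu>}"
    have U_eq: "U = ball (of_real t) r \<inter> {\<mu>. 0 < Im \<mu>}" and H_eq: "H = ball (of_real t) r \<inter> {\<mu>. 0 \<le> Im \<mu>}"
      by (auto simp: U_def H_def)
    have U: "open U" "convex U" "U \<subseteq> D" "U \<subseteq> H"
      using r(3) G(3) by (auto simp: U_eq H_eq intro!: open_Int open_halfspace_Im_gt convex_Int convex_halfspace_Im_gt)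
    have "convex H" unfolding H_eq by (intro convex_Int convex_ball convex_halfspace_Im_ge)
    have Hsub: "H \<subseteq> of_real ` {\<alpha><..} \<union> D"
      using half_disc_closed[OF t r(2,3)] by (auto simp: H_def)
    have int: "interior H \<subseteq> D"
    proof
      fix \<mu> assume \<mu>: "\<mu> \<in> interior H"
      then obtain e where e: "0 < e" "ball \<mu> e \<subseteq> H" by (auto simp: mem_interior)
      \<comment> \<open>An interior point has a lower neighbour still in \<open>H\<close>, hence
        positive imaginary part.\<close>
      have "\<mu> - \<i> * of_real (e / 2) \<in> ball \<mu> e" using e(1) by (simp add: dist_norm norm_mult)
      with e have "\<mu> - \<i> * of_real (e / 2) \<in> H" "\<mu> \<in> H" by auto
      then have "\<mu> \<in> U" using e(1) by (auto simp: H_def U_def)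
      then show "\<mu> \<in> D" using U by blast
    qed
    have dH: "f field_differentiable at \<mu>" if "\<mu> \<in> interior H - {}" for \<mu>
      using that int f(1) D(1) holomorphic_on_imp_differentiable_at by blast
    obtain q where q: "\<And>\<mu>. \<mu> \<in> H \<Longrightarrow> (q has_field_derivative f \<mu>) (at \<mu> within H)"
      using holomorphic_convex_primitive[OF \<open>convex H\<close> finite.emptyI continuous_on_subset[OF f(2) Hsub] dH] by metis
    have "\<exists>a. \<forall>\<mu>\<in>U. P \<mu> - q \<mu> = a"
    proof (rule has_field_derivative_zero_constant[OF U(2)])
      fix \<mu> assume \<mu>: "\<mu> \<in> U"
      have "(P has_field_derivative f \<mu>) (at \<mu> within U)"
        using P[of \<mu>] \<mu> U by (meson has_field_derivative_at_within subsetD)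
      moreover have "(q has_field_derivative f \<mu>) (at \<mu> within U)"
        using q[of \<mu>] \<mu> U by (meson has_field_derivative_subset subsetD)
      ultimately show "((\<lambda>\<mu>. P \<mu> - q \<mu>) has_field_derivative 0) (at \<mu> within U)"
        using DERIV_diff by fastforce
    qed
    then obtain a where a: "\<And>\<mu>. \<mu> \<in> U \<Longrightarrow> P \<mu> = q \<mu> + a" by (auto simp: algebra_simps)
    have QH: "Q \<mu> = q \<mu> + a" if \<mu>: "\<mu> \<in> H" for \<mu>
    proof (cases "0 < Im \<mu>")
      case True
      then show ?thesis using a[of \<mu>] \<mu> by (simp add: Q_def H_def U_def)
    next
      case False
      then have Im: "Im \<mu> = 0" using \<mu> by (simp add: H_def)
      let ?p = "\<lambda>\<delta>::real. \<mu> + \<i> * of_real \<delta>"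
      have "(?p \<longlongrightarrow> \<mu> + \<i> * of_real 0) (at_right 0)" by (intro tendsto_intros)
      then have p: "(?p \<longlongrightarrow> \<mu>) (at_right 0)" by simp
      have "\<mu> \<in> ball (of_real t) r" using \<mu> by (simp add: H_def)
      then have "\<forall>\<^sub>F \<delta> in at_right 0. ?p \<delta> \<in> ball (of_real t) r"
        using topological_tendstoD[OF p open_ball] by blast
      then have ev: "\<forall>\<^sub>F \<delta> in at_right 0. ?p \<delta> \<in> U"
        using eventually_at_right_less[of 0] by eventually_elim (simp add: U_def Im)
      have "continuous (at \<mu> within H) q"
        using q[OF \<mu>] DERIV_continuous by blast
      then have "(q \<longlongrightarrow> q \<mu>) (at \<mu> within H)" by (simp add: continuous_within)
      moreover have "filterlim ?p (at \<mu> within H) (at_right 0)"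
        unfolding filterlim_at using p ev eventually_at_right_less[of 0]
        by (auto elim: eventually_elim2 simp: subsetD[OF U(4)])
      ultimately have "((\<lambda>\<delta>. q (?p \<delta>)) \<longlongrightarrow> q \<mu>) (at_right 0)" by (rule filterlim_compose)
      then have "((\<lambda>\<delta>. q (?p \<delta>) + a) \<longlongrightarrow> q \<mu> + a) (at_right 0)" by (intro tendsto_intros)
      moreover have "\<forall>\<^sub>F \<delta> in at_right 0. q (?p \<delta>) + a = P (?p \<delta>)"
        using ev by eventually_elim (simp add: a)
      ultimately have "((\<lambda>\<delta>. P (?p \<delta>)) \<longlongrightarrow> q \<mu> + a) (at_right 0)"
        by (rule Lim_transform_eventually)
      then show ?thesis using False by (simp add: Q_def tendsto_Lim)
    qed
    have tH: "of_real t \<in> H" using r(1) by (simp add: H_def)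
    have "((\<lambda>\<mu>. q \<mu> + a) has_field_derivative f (of_real t)) (at (of_real t) within H)"
      using DERIV_add[OF q[OF tH] DERIV_const[of a]] by simp
    then have "(Q has_field_derivative f (of_real t)) (at (of_real t) within H)"
      by (rule has_field_derivative_transform_within[OF _ zero_less_one tH]) (simp add: QH)
    then show "\<exists>r>0. r < t - \<alpha> \<and> {\<mu> \<in> ball (of_real t) r. 0 < Im \<mu>} \<subseteq> G \<and>
        (Q has_field_derivative f (of_real t)) (at (of_real t) within {\<mu> \<in> ball (of_real t) r. 0 \<le> Im \<mu>})"
      using r by (auto simp: H_def)
  qed
qed

text \<open>The angle sought is the first at which the circle leaves \<open>G\<close>; it is at most
  \<open>pi\<close>, where the circle is back on the real axis. The exit point is a frontier point
  off the half-line, because the circle returns to the real axis only to the left of \<alpha>; so it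
  lies on \<gamma>.\<close>

lemma arc_exit:
  assumes R: "0 < R"
  obtains \<theta> b where "0 < \<theta>" "\<theta> \<le> pi" "0 < b" "of_real \<alpha> + of_real R * cis \<theta> = \<gamma> b"
    "\<And>\<phi>. 0 < \<phi> \<Longrightarrow> \<phi> \<le> \<theta> \<Longrightarrow> of_real \<alpha> + of_real R * cis \<phi> \<in> D"
proof -
  let ?p = "\<lambda>\<phi>. of_real \<alpha> + of_real R * cis \<phi>"
  have pc: "continuous_on UNIV ?p" by (intro continuous_intros)
  have pt: "(?p \<longlongrightarrow> ?p x) (at x within S)" for x S
    using continuous_on_imp_continuous_within[OF pc, of S x] by (simp only: continuous_within subset_UNIV UNIV_I simp_thms)
  have "\<alpha> < \<alpha> + R" using R by simp
  from half_disc[OF this] obtain r where r: "0 < r" "{\<mu> \<in> ball (of_real (\<alpha> + R)) r. 0 < Im \<mu>} \<subseteq> G" .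
  have "(?p \<longlongrightarrow> ?p 0) (at_right 0)"
    using pt .
  moreover have "?p 0 \<in> ball (of_real (\<alpha> + R)) r" using r(1) by simp
  ultimately have "\<forall>\<^sub>F \<phi> in at_right 0. ?p \<phi> \<in> ball (of_real (\<alpha> + R)) r"
    using topological_tendstoD open_ball by blast
  then obtain e where e: "0 < e" "\<And>\<phi>. 0 < \<phi> \<Longrightarrow> \<phi> < e \<Longrightarrow> ?p \<phi> \<in> ball (of_real (\<alpha> + R)) r"
    by (auto simp: eventually_at_right_field)
  define \<delta> where "\<delta> = min (e / 2) (pi / 2)"
  have \<delta>: "0 < \<delta>" "\<delta> < e" "\<delta> < pi" using e(1) pi_gt_zero by (auto simp: \<delta>_def min_def)
  have small: "?p \<phi> \<in> G" if "0 < \<phi>" "\<phi> \<le> \<delta>" for \<phi>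
    using e(2)[of \<phi>] that \<delta> r(2) R sin_gt_zero[of \<phi>] by auto
  \<comment> \<open>Angles start at \<open>\<delta>\<close>: the point at angle 0 is real, hence
    outside \<open>G\<close>, and would make the infimum 0.\<close>
  define A where "A = {\<phi> \<in> {\<delta>..pi}. ?p \<phi> \<notin> G}"
  have "A = {\<delta>..pi} \<inter> ?p -` (- G)" by (auto simp: A_def)
  also have "closed \<dots>"
    using G(1) by (intro continuous_closed_preimage continuous_on_subset[OF pc]) auto
  finally have "closed A" .
  moreover have piA: "pi \<in> A" using G(3) D(3) \<delta> by (auto simp: A_def)
  moreover have bdd: "bdd_below A" by (rule bdd_belowI[of _ \<delta>]) (simp add: A_def)
  ultimately have \<theta>A: "Inf A \<in> A" using closed_contains_Inf by blast
  define \<theta> where "\<theta> = Inf A"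
  have \<theta>: "\<delta> \<le> \<theta>" "\<theta> \<le> pi" "?p \<theta> \<notin> G" using \<theta>A by (auto simp: A_def \<theta>_def)
  have below: "?p \<phi> \<in> G" if "0 < \<phi>" "\<phi> < \<theta>" for \<phi>
  proof (cases "\<phi> \<le> \<delta>")
    case False
    have "\<phi> \<notin> A" using that(2) cInf_lower[OF _ bdd, of \<phi>] by (auto simp: \<theta>_def)
    then show ?thesis using False that \<theta> by (auto simp: A_def)
  qed (use small that in blast)
  have "?p \<theta> \<in> closure G"
  proof (rule Lim_in_closed_set[of _ ?p "at_left \<theta>"])
    show "\<forall>\<^sub>F \<phi> in at_left \<theta>. ?p \<phi> \<in> closure G"
      unfolding eventually_at_left_field
      using below \<theta> \<delta> closure_subset[of G] by (intro exI[of _ 0]) auto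
    show "(?p \<longlongrightarrow> ?p \<theta>) (at_left \<theta>)"
      using pt .
  qed auto
  then have "?p \<theta> \<in> frontier G" using \<theta>(3) G(1) by (simp add: frontier_def interior_open)
  moreover have "?p \<theta> \<notin> of_real ` {\<alpha>..}"
  proof
    assume "?p \<theta> \<in> of_real ` {\<alpha>..}"
    then obtain x where x: "?p \<theta> = of_real x" "\<alpha> \<le> x" by auto
    have "sin \<theta> = 0" using arg_cong[OF x(1), of Im] R by simp
    then have "\<theta> = pi" using \<theta> \<delta> sin_gt_zero[of \<theta>] by force
    then show False using arg_cong[OF x(1), of Re] x(2) R by simp
  qed
  ultimately obtain b where b: "?p \<theta> = \<gamma> b" "0 \<le> b" unfolding G_frontier by auto
  have "b \<noteq> 0"
  proof
    assume "b = 0"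
    then have "of_real R * cis \<theta> = 0" using b \<gamma>0 by simp
    then show False using R by simp
  qed
  then have "0 < b" using b by simp
  show thesis
  proof (rule that[OF _ \<theta>(2) \<open>0 < b\<close> b(1)])
    show "0 < \<theta>" using \<theta> \<delta> by simp
    show "?p \<phi> \<in> D" if "0 < \<phi>" "\<phi> \<le> \<theta>" for \<phi>
      using below[of \<phi>] that G(3) b(1) \<gamma>D[OF \<open>0 < b\<close>] by (cases "\<phi> = \<theta>") auto
  qed
qed

text \<open>Mean value inequality along an arc of length at most \<open>pi * R\<close>. At its real
  starting point only the behaviour of \<open>Q\<close> from above is available, hence the separate
  continuity argument at angle 0.\<close>

lemma arc_estimate:
  assumes Q: "\<And>\<mu>. \<mu> \<in> D \<Longrightarrow> (Q has_field_derivative f \<mu>) (at \<mu>)"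
    "\<And>t. \<alpha> < t \<Longrightarrow> \<exists>r>0. r < t - \<alpha> \<and> {\<mu> \<in> ball (of_real t) r. 0 < Im \<mu>} \<subseteq> G \<and>
        (Q has_field_derivative f (of_real t)) (at (of_real t) within {\<mu> \<in> ball (of_real t) r. 0 \<le> Im \<mu>})"
    and R: "0 < R" and M: "\<And>\<mu>. \<mu> \<in> D \<Longrightarrow> cmod (\<mu> - of_real \<alpha>) = R \<Longrightarrow> cmod (f \<mu>) \<le> M"
  obtains b where "0 < b" "cmod (\<gamma> b - of_real \<alpha>) = R" "cmod (Q (\<gamma> b) - Q (of_real (\<alpha> + R))) \<le> pi * R * M"
proof -
  let ?p = "\<lambda>\<phi>. of_real \<alpha> + of_real R * cis \<phi>"
  obtain \<theta> b where \<theta>: "0 < \<theta>" "\<theta> \<le> pi" and b: "0 < b" "?p \<theta> = \<gamma> b"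
    and pD: "\<And>\<phi>. 0 < \<phi> \<Longrightarrow> \<phi> \<le> \<theta> \<Longrightarrow> ?p \<phi> \<in> D"
    using arc_exit[OF R] by blast
  have p0: "?p 0 = of_real (\<alpha> + R)" by simp
  have pd: "(?p has_vector_derivative of_real R * (\<i> * cis \<phi>)) (at \<phi>)" for \<phi>
    by (auto intro!: derivative_eq_intros simp: has_vector_derivative_def has_derivative_cis mult_ac scaleR_conv_of_real)
  have pdist: "cmod (?p \<phi> - of_real \<alpha>) = R" for \<phi> using R by (simp add: norm_mult)
  have M0: "0 \<le> M" using M[OF pD[OF \<theta>(1) order_refl] pdist] norm_ge_zero order_trans by blast
  have der: "((\<lambda>\<phi>. Q (?p \<phi>)) has_vector_derivative (of_real R * (\<i> * cis \<phi>)) * f (?p \<phi>)) (at \<phi>)"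
    if "0 < \<phi>" "\<phi> \<le> \<theta>" for \<phi>
    using field_vector_diff_chain_at[OF pd Q(1)[OF pD[OF that]]] by (simp add: o_def)
  have cont: "continuous_on {0..\<theta>} (\<lambda>\<phi>. Q (?p \<phi>))"
      unfolding continuous_on_eq_continuous_within
    proof
      fix \<phi> assume \<phi>: "\<phi> \<in> {0..\<theta>}"
      show "continuous (at \<phi> within {0..\<theta>}) (\<lambda>\<phi>. Q (?p \<phi>))"
      proof (cases "\<phi> = 0")
        case False
        then show ?thesis
          using \<phi> der[of \<phi>] continuous_at_imp_continuous_at_within[OF has_vector_derivative_continuous] by force
      next
        case True
        obtain r where r: "r > 0" "(Q has_field_derivative f (of_real (\<alpha> + R)))
            (at (of_real (\<alpha> + R)) within {\<mu> \<in> ball (of_real (\<alpha> + R)) r. 0 \<le> Im \<mu>})"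
          using Q(2)[of "\<alpha> + R"] R by auto
        let ?H = "{\<mu> \<in> ball (of_real (\<alpha> + R)) r. 0 \<le> Im \<mu>}"
        have Qc: "(Q \<longlongrightarrow> Q (?p 0)) (at (?p 0) within ?H)"
          using DERIV_continuous[OF r(2)] by (simp add: continuous_within p0)
        have pl: "(?p \<longlongrightarrow> ?p 0) (at 0 within {0..\<theta>})"
          using continuous_at_imp_continuous_at_within[OF has_vector_derivative_continuous[OF pd[of 0]], of "{0..\<theta>}"]
          by (simp only: continuous_within)
        have "?p 0 \<in> ball (of_real (\<alpha> + R)) r" using r(1) by simp
        then have "\<forall>\<^sub>F \<phi> in at 0 within {0..\<theta>}. ?p \<phi> \<in> ball (of_real (\<alpha> + R)) r"
          using topological_tendstoD[OF pl open_ball] by blast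
        moreover have "\<forall>\<^sub>F \<phi> in at 0 within {0..\<theta>}. \<phi> \<in> {0<..\<theta>}"
          by (auto simp: eventually_at_filter)
        ultimately have "\<forall>\<^sub>F \<phi> in at 0 within {0..\<theta>}. ?p \<phi> \<in> ?H \<and> ?p \<phi> \<noteq> ?p 0"
        proof eventually_elim
          case (elim \<phi>)
          have Im: "0 < Im (?p \<phi>)" using pD[of \<phi>] D(3) elim by auto
          then have "?p \<phi> \<noteq> ?p 0" by (metis p0 Im_complex_of_real less_irrefl)
          then show ?case using elim Im by auto
        qed
        then have "filterlim ?p (at (?p 0) within ?H) (at 0 within {0..\<theta>})"
          unfolding filterlim_at using pl by simp
        from filterlim_compose[OF Qc this] show ?thesis
          by (simp add: continuous_within True)
      qed
    qed
  have cont': "continuous_on {0..\<theta>} (\<lambda>\<phi>. M * R * \<phi>)" by (intro continuous_intros)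
  have der': "((\<lambda>\<phi>. M * R * \<phi>) has_vector_derivative M * R) (at \<phi>)" for \<phi>
    by (auto intro!: derivative_eq_intros simp: has_real_derivative_iff_has_vector_derivative[symmetric])
  have bnd: "norm ((of_real R * (\<i> * cis \<phi>)) * f (?p \<phi>)) \<le> M * R" if "0 < \<phi>" "\<phi> < \<theta>" for \<phi>
    using mult_right_mono[OF M[OF pD[of \<phi>] pdist], of R] that R by (simp add: norm_mult mult.commute)
  have "norm (Q (?p \<theta>) - Q (?p 0)) \<le> M * R * \<theta> - M * R * 0"
    using differentiable_bound_general[OF \<theta>(1) cont cont' der der' bnd] less_imp_le by blast
  also have "\<dots> \<le> M * R * pi" using \<theta>(2) M0 R by (simp add: mult_left_mono)
  finally have "cmod (Q (\<gamma> b) - Q (of_real (\<alpha> + R))) \<le> pi * R * M"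
    unfolding b(2) p0 by (simp add: mult_ac)
  moreover have "cmod (\<gamma> b - of_real \<alpha>) = R" using pdist[of \<theta>] b(2) by simp
  ultimately show thesis using that b(1) by blast
qed

text \<open>A derivative within the closed half-disc restricts to an ordinary derivative in the real
  parameter, because the half-disc contains a real interval about the point.\<close>

lemma real_line_integral:
  assumes Q: "\<And>t. \<alpha> < t \<Longrightarrow> \<exists>r>0. r < t - \<alpha> \<and> {\<mu> \<in> ball (of_real t) r. 0 < Im \<mu>} \<subseteq> G \<and>
        (Q has_field_derivative f (of_real t)) (at (of_real t) within {\<mu> \<in> ball (of_real t) r. 0 \<le> Im \<mu>})"
    and ab: "0 < a" "a \<le> b"
  shows "((\<lambda>s. f (of_real (\<alpha> + s))) has_integral Q (of_real (\<alpha> + b)) - Q (of_real (\<alpha> + a))) {a..b}"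
proof (rule fundamental_theorem_of_calculus[OF ab(2)])
  fix s assume s: "s \<in> {a..b}"
  let ?t = "\<alpha> + s"
  obtain r where r: "r > 0" "(Q has_field_derivative f (of_real ?t))
            (at (of_real ?t) within {\<mu> \<in> ball (of_real ?t) r. 0 \<le> Im \<mu>})"
    using Q[of ?t] s ab by auto
  have d: "((\<lambda>s. complex_of_real (\<alpha> + s)) has_vector_derivative 1) (at s within ball s r)"
    by (auto intro!: derivative_eq_intros)
  have "(\<lambda>s. complex_of_real (\<alpha> + s)) ` ball s r \<subseteq> {\<mu> \<in> ball (of_real ?t) r. 0 \<le> Im \<mu>}"
  proof clarify
    fix u assume "u \<in> ball s r"
    then have "dist (\<alpha> + s) (\<alpha> + u) < r" by (simp add: dist_real_def)
    then show "complex_of_real (\<alpha> + u) \<in> ball (of_real ?t) r \<and> 0 \<le> Im (complex_of_real (\<alpha> + u))"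
      by (simp only: mem_ball dist_of_real Im_complex_of_real) simp
  qed
  then have "(Q has_field_derivative f (of_real ?t)) (at (of_real ?t) within (\<lambda>s. complex_of_real (\<alpha> + s)) ` ball s r)"
    by (rule has_field_derivative_subset[OF r(2)])
  from field_vector_diff_chain_within[OF d this]
  have "((\<lambda>s. Q (of_real (\<alpha> + s))) has_vector_derivative f (of_real ?t)) (at s within ball s r)"
    by (simp add: o_def)
  then have "((\<lambda>s. Q (of_real (\<alpha> + s))) has_vector_derivative f (of_real ?t)) (at s)"
    using r(1) at_within_open[of s "ball s r"] by simp
  then show "((\<lambda>s. Q (of_real (\<alpha> + s))) has_vector_derivative f (of_real ?t)) (at s within {a..b})"
    by (rule has_vector_derivative_at_within)
qed

text \<open>The chain rule may fail where \<gamma> is not differentiable. But the indefinite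
  integral \<open>q\<close> and \<open>Q\<close> along \<gamma> both have increments
  \<open>f (\<gamma> x) * (\<gamma> y - \<gamma> x)\<close> up to a small multiple of
  \<open>\<bar>y - x\<bar>\<close>, so their difference has derivative zero at every
  parameter.\<close>

lemma curve_primitive_integral:
  assumes Q: "\<And>\<mu>. \<mu> \<in> D \<Longrightarrow> (Q has_field_derivative f \<mu>) (at \<mu>)" and f: "continuous_on D f"
    and v: "\<And>a b. 0 < a \<Longrightarrow> a \<le> b \<Longrightarrow> (v has_integral \<gamma> b - \<gamma> a) {a..b}" "\<And>s. 0 < s \<Longrightarrow> cmod (v s) \<le> 1"
    and ab: "0 < a" "a \<le> b"
  shows "((\<lambda>s. v s * f (\<gamma> s)) has_integral Q (\<gamma> b) - Q (\<gamma> a)) {a..b}"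
proof -
  let ?h = "\<lambda>s. v s * f (\<gamma> s)"
  have f\<gamma>: "continuous_on {0<..} (\<lambda>s. f (\<gamma> s))"
    by (rule continuous_on_compose2[OF f]) (use \<gamma>D in \<open>auto intro: continuous_on_subset[OF \<gamma>_cont]\<close>)
  have hi: "?h integrable_on {x..y}" if "0 < x" for x y
  proof (cases "x \<le> y")
    case True
    show ?thesis
      by (rule times_action.integrable_prod_continuous)
         (use that True v in \<open>auto intro: continuous_on_subset[OF f\<gamma>] has_integral_integrable\<close>)
  qed (simp add: integrable_on_empty)
  define q where "q y = integral {a..y} ?h" for y
  \<comment> \<open>Freezing \<open>f\<close> at \<open>m\<close> makes the integral explicit, as
    \<open>v\<close> integrates to the increments of \<gamma>.\<close>
  have step: "cmod (q y - q x - f m * (\<gamma> y - \<gamma> x)) \<le> e * (y - x)"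
    if xy: "a \<le> x" "x \<le> y" and e: "0 \<le> e" and fe: "\<And>s. s \<in> {x..y} \<Longrightarrow> cmod (f (\<gamma> s) - f m) \<le> e" for x y e m
  proof -
    have x0: "0 < x" using xy ab by simp
    have "q x + integral {x..y} ?h = q y"
      unfolding q_def by (rule Henstock_Kurzweil_Integration.integral_combine) (use xy hi[OF ab(1)] in auto)
    then have "integral {x..y} ?h = q y - q x" by (simp add: algebra_simps)
    then have qq: "(?h has_integral q y - q x) {x..y}"
      using integrable_integral[OF hi[OF x0, of y]] by simp
    have "((\<lambda>s. f m * v s) has_integral f m * (\<gamma> y - \<gamma> x)) {x..y}"
      by (rule has_integral_mult_right[OF v(1)[OF x0 xy(2)]])
    from has_integral_diff[OF qq this]
    have i: "((\<lambda>s. v s * (f (\<gamma> s) - f m)) has_integral q y - q x - f m * (\<gamma> y - \<gamma> x)) {x..y}"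
      by (simp add: algebra_simps)
    have "cmod (v s * (f (\<gamma> s) - f m)) \<le> e" if s: "s \<in> {x..y}" for s
      using mult_mono[OF v(2)[of s] fe[OF s]] s x0 by (simp add: norm_mult)
    then show ?thesis
      using has_integral_bound_real[OF e finite.emptyI i] xy by simp
  qed
  have Q\<gamma>: "((\<lambda>s. q s - Q (\<gamma> s)) has_derivative (\<lambda>h. 0)) (at x within {a..b})" if x: "x \<in> {a..b}" for x
    unfolding has_derivative_within_alt
  proof (intro conjI allI impI bounded_linear_zero)
    fix e :: real assume "e > 0"
    then have e2: "e / 2 > 0" by simp
    have x0: "0 < x" using x ab by simp
    have "isCont (\<lambda>s. f (\<gamma> s)) x"
      using f\<gamma> x0 by (simp add: continuous_on_eq_continuous_at)
    then obtain d1 where d1: "d1 > 0" "\<And>s. dist s x < d1 \<Longrightarrow> dist (f (\<gamma> s)) (f (\<gamma> x)) < e / 2"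
      using e2 unfolding continuous_at_eps_delta by (metis dist_norm real_norm_def)
    have "(Q has_derivative (\<lambda>h. f (\<gamma> x) * h)) (at (\<gamma> x))"
      using Q[OF \<gamma>D[OF x0]] by (simp add: has_field_derivative_def)
    then obtain d2 where d2: "d2 > 0" "\<And>w. cmod (w - \<gamma> x) < d2 \<Longrightarrow>
        cmod (Q w - Q (\<gamma> x) - f (\<gamma> x) * (w - \<gamma> x)) \<le> e / 2 * cmod (w - \<gamma> x)"
      using e2 unfolding has_derivative_within_alt[of _ _ _ UNIV, simplified] by meson
    show "\<exists>d>0. \<forall>y\<in>{a..b}. norm (y - x) < d \<longrightarrow>
       norm (q y - Q (\<gamma> y) - (q x - Q (\<gamma> x)) - 0) \<le> e * norm (y - x)"
    proof (intro exI[of _ "min d1 d2"] conjI ballI impI)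
      fix y assume y: "y \<in> {a..b}" "norm (y - x) < min d1 d2"
      have lip: "cmod (\<gamma> y - \<gamma> x) \<le> \<bar>y - x\<bar>"
        using \<gamma>_lip[of y x] y x0 ab by (simp add: dist_norm)
      have 1: "cmod (q y - q x - f (\<gamma> x) * (\<gamma> y - \<gamma> x)) \<le> e / 2 * \<bar>y - x\<bar>"
      proof (cases "x \<le> y")
        case True
        have "cmod (f (\<gamma> s) - f (\<gamma> x)) \<le> e / 2" if "s \<in> {x..y}" for s
          using d1(2)[of s] that y(2) by (simp add: dist_norm)
        then show ?thesis using step[of x y "e/2" "\<gamma> x"] True x e2 by simp
      next
        case False
        have "cmod (f (\<gamma> s) - f (\<gamma> x)) \<le> e / 2" if "s \<in> {y..x}" for s
          using d1(2)[of s] that y(2) False by (simp add: dist_norm)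
        then have "cmod (q x - q y - f (\<gamma> x) * (\<gamma> x - \<gamma> y)) \<le> e / 2 * (x - y)"
          using step[of y x "e/2" "\<gamma> x"] False y e2 by simp
        moreover have "q x - q y - f (\<gamma> x) * (\<gamma> x - \<gamma> y) = - (q y - q x - f (\<gamma> x) * (\<gamma> y - \<gamma> x))"
          by (simp add: algebra_simps)
        ultimately show ?thesis using False by (metis abs_minus_commute abs_of_nonneg diff_ge_0_iff_ge linear norm_minus_cancel)
      qed
      have "cmod (Q (\<gamma> y) - Q (\<gamma> x) - f (\<gamma> x) * (\<gamma> y - \<gamma> x)) \<le> e / 2 * cmod (\<gamma> y - \<gamma> x)"
        using d2(2)[of "\<gamma> y"] lip y(2) by simp
      also have "\<dots> \<le> e / 2 * \<bar>y - x\<bar>" using lip e2 by (intro mult_left_mono) auto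
      finally have 2: "cmod (Q (\<gamma> y) - Q (\<gamma> x) - f (\<gamma> x) * (\<gamma> y - \<gamma> x)) \<le> e / 2 * \<bar>y - x\<bar>" .
      have "q y - Q (\<gamma> y) - (q x - Q (\<gamma> x)) - 0 = (q y - q x - f (\<gamma> x) * (\<gamma> y - \<gamma> x)) - 
         (Q (\<gamma> y) - Q (\<gamma> x) - f (\<gamma> x) * (\<gamma> y - \<gamma> x))" by simp
      also have "cmod \<dots> \<le> e / 2 * \<bar>y - x\<bar> + e / 2 * \<bar>y - x\<bar>"
        by (rule order_trans[OF norm_triangle_ineq4 add_mono[OF 1 2]])
      finally show "norm (q y - Q (\<gamma> y) - (q x - Q (\<gamma> x)) - 0) \<le> e * norm (y - x)" by simp
    qed (use d1 d2 in simp)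
  qed
  obtain k where k: "\<And>x. x \<in> {a..b} \<Longrightarrow> q x - Q (\<gamma> x) = k"
    using has_derivative_zero_constant[OF convex_real_interval(5) Q\<gamma>] by blast
  have "q b - Q (\<gamma> b) = q a - Q (\<gamma> a)"
    using k[of a] k[of b] ab by simp
  then have "q b = Q (\<gamma> b) - Q (\<gamma> a)"
    by (simp add: q_def diff_eq_eq)
  then show ?thesis using integrable_integral[OF hi[OF ab(1), of b]] by (simp add: q_def)
qed

end

text \<open>Used for the three upper sides of the rectangle in \<open>local_jump\<close>, whose
  contributions remain holomorphic across the omitted bottom side. The power 1 in the integrand is
  there to match \<open>Cauchy_next_derivative\<close>.\<close>

lemma linepath_cauchy_differentiable:
  assumes k: "continuous_on (closed_segment a b) k" and z: "z \<notin> closed_segment a b"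
  shows "(\<lambda>z. contour_integral (linepath a b) (\<lambda>w. k w / (w - z))) field_differentiable (at z)"
proof -
  have int: "((\<lambda>u. k u / (u - w) ^ 1) has_contour_integral contour_integral (linepath a b) (\<lambda>u. k u / (u - w))) (linepath a b)"
    if "w \<in> UNIV - path_image (linepath a b)" for w
  proof -
    have "(\<lambda>u. k u / (u - w)) contour_integrable_on linepath a b"
      by (rule contour_integrable_continuous_linepath) (use that in \<open>auto intro!: continuous_intros k\<close>)
    then show ?thesis by (simp add: has_contour_integral_integral)
  qed
  show ?thesis
    unfolding field_differentiable_def
    using Cauchy_next_derivative(2)[of "linepath a b" k "cmod (b - a)" UNIV 1, OF _ _ int] k z by force
qed

section \<open>Comparison of the Cauchy transforms over contour and half-line\<close>

context halfplane_contour
begin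

text \<open>Where \<open>\<gamma>\<close> is not differentiable, \<^const>\<open>vector_derivative\<close> is an arbitrary value, possibly of large norm.\<close>

definition speed :: "real \<Rightarrow> complex" where
  "speed s = (if cmod (vector_derivative \<gamma> (at s)) \<le> 1 then vector_derivative \<gamma> (at s) else 0)"

lemma speed_le: "cmod (speed s) \<le> 1"
  by (simp add: speed_def)

lemma speed_ae:
  obtains N where "negligible N" "\<And>s. 0 < s \<Longrightarrow> s \<notin> N \<Longrightarrow> speed s = vector_derivative \<gamma> (at s)"
  using lipschitz_ftc[of 0 \<gamma>, OF \<gamma>_lip] by (metis speed_def)

lemma speed_integral:
  assumes "0 \<le> a" "a \<le> b"
  shows "(speed has_integral \<gamma> b - \<gamma> a) {a..b}"
proof -
  obtain N where N: "negligible N" "\<And>s. 0 < s \<Longrightarrow> s \<notin> N \<Longrightarrow> speed s = vector_derivative \<gamma> (at s)"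
    using speed_ae by metis
  have "\<And>b c. 0 \<le> b \<Longrightarrow> b \<le> c \<Longrightarrow> ((\<lambda>s. vector_derivative \<gamma> (at s)) has_integral \<gamma> c - \<gamma> b) {b..c}"
    using lipschitz_ftc[of 0 \<gamma>, OF \<gamma>_lip] by metis
  from this[OF assms] show ?thesis
    by (rule has_integral_spike[of "insert 0 N", rotated 2]) (use N assms in auto)
qed

lemma k_\<gamma>_cont: "continuous_on {0<..} (\<lambda>s. k (\<gamma> s))"
  by (rule continuous_on_compose2[OF k_cont continuous_on_subset[OF \<gamma>_cont]]) (use \<gamma>D in auto)

lemma k_real_cont: "continuous_on {0<..} (\<lambda>s. k (of_real (\<alpha> + s)))"
  by (rule continuous_on_compose2[OF k_cont]) (auto intro!: continuous_intros simp del: of_real_add)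

sublocale Gam: weighted_curve \<gamma> speed "\<lambda>s. k (\<gamma> s)"
proof
  show "speed integrable_on {a..b}" if "0 < a" for a b
    by (cases "a \<le> b") (use that speed_integral[of a b] in \<open>auto simp: integrable_on_def\<close>)
  show "continuous_on {0<..} \<gamma>" by (rule continuous_on_subset[OF \<gamma>_cont]) auto
qed (use k_\<gamma>_cont speed_le weight_\<gamma> in auto)

sublocale Del: weighted_curve "\<lambda>s. of_real (\<alpha> + s)" "\<lambda>s. 1" "\<lambda>s. k (of_real (\<alpha> + s))"
  by standard (use k_real_cont weight_real in \<open>auto intro!: continuous_intros integrable_const_ivl\<close>)

lemma Im_dist_\<gamma>: "Im z < 0 \<Longrightarrow> 0 < s \<Longrightarrow> - Im z \<le> cmod (z - \<gamma> s)"
  using abs_Im_le_cmod[of "z - \<gamma> s"] \<gamma>_Im[of s] by simp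

lemma Im_dist_real: "\<bar>Im z\<bar> \<le> cmod (z - of_real (\<alpha> + s))"
  using abs_Im_le_cmod[of "z - of_real (\<alpha> + s)"] by simp

text \<open>The factor has its pole in the lower half-plane: for \<open>0 \<le> Im \<mu>\<close> its
  denominator has real part at least one. The third bound is the gain of one order of decay at
  infinity.\<close>

lemma regularizer:
  assumes e: "0 < e" and \<mu>: "0 \<le> Im \<mu>"
  shows "1 - \<i> * of_real e * \<mu> \<noteq> 0" "cmod (1 / (1 - \<i> * of_real e * \<mu>)) \<le> 1"
    "\<mu> \<noteq> 0 \<Longrightarrow> cmod (1 / (1 - \<i> * of_real e * \<mu>)) \<le> 1 / (e * cmod \<mu>)"
proof -
  let ?w = "1 - \<i> * of_real e * \<mu>"
  have Re: "Re ?w = 1 + e * Im \<mu>" and Im: "Im ?w = - e * Re \<mu>" by simp_all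
  have p: "0 \<le> e * Im \<mu>" using e \<mu> by simp
  have 1: "1 \<le> cmod ?w" using abs_Re_le_cmod[of ?w] p unfolding Re by linarith
  then show "?w \<noteq> 0" by auto
  show "cmod (1 / ?w) \<le> 1" using 1 by (simp add: norm_divide divide_le_eq)
  have "(e * cmod \<mu>)\<^sup>2 \<le> (cmod ?w)\<^sup>2"
  proof -
    have "(e * cmod \<mu>)\<^sup>2 = (e * Im \<mu>)\<^sup>2 + (e * Re \<mu>)\<^sup>2"
      by (simp add: power_mult_distrib cmod_power2 algebra_simps)
    also have "\<dots> \<le> (1 + e * Im \<mu>)\<^sup>2 + (e * Re \<mu>)\<^sup>2" using p by (intro add_right_mono power_mono) auto
    finally show ?thesis unfolding cmod_power2 Re Im by (simp add: power2_eq_square)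
  qed
  then have "e * cmod \<mu> \<le> cmod ?w" by (rule power2_le_imp_le) simp
  then show "cmod (1 / ?w) \<le> 1 / (e * cmod \<mu>)" if "\<mu> \<noteq> 0"
    using e that by (simp add: norm_divide frac_le)
qed

text \<open>Beyond any positive parameter the curve keeps a positive distance from its end point, so
  points near the end point have small parameters.\<close>

lemma small_parameter:
  assumes a: "\<And>n. 0 < a n" "(\<lambda>n. cmod (\<gamma> (a n) - of_real \<alpha>)) \<longlonglongrightarrow> 0"
  shows "a \<longlonglongrightarrow> 0"
proof (rule order_tendstoI)
  fix \<eta> :: real
  show "\<forall>\<^sub>F n in sequentially. \<eta> < a n" if "\<eta> < 0"
    using a(1) that less_trans by (intro always_eventually) blast
  assume \<eta>: "0 < \<eta>"
  have "of_real \<alpha> \<noteq> \<gamma> s" if "\<eta> \<le> s" for s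
    using \<gamma>_Im[of s] \<eta> that by (metis Im_complex_of_real less_le_trans less_irrefl)
  then have "of_real \<alpha> \<notin> \<gamma> ` {\<eta>..}" by auto
  then obtain d where d: "0 < d" "\<And>s. \<eta> \<le> s \<Longrightarrow> d \<le> cmod (of_real \<alpha> - \<gamma> s)"
    using dist_\<gamma>[of "of_real \<alpha>" \<eta>] \<eta> by (metis less_imp_le)
  have "\<forall>\<^sub>F n in sequentially. cmod (\<gamma> (a n) - of_real \<alpha>) < d"
    using order_tendstoD(2)[OF a(2) d(1)] .
  then show "\<forall>\<^sub>F n in sequentially. a n < \<eta>"
  proof eventually_elim
    case (elim n)
    then show ?case using d(2)[of "a n"] by (auto simp: norm_minus_commute not_le[symmetric])
  qed
qed

text \<open>By \<open>arc_estimate\<close> the two closing arcs contribute \<open>O(R^(1+g))\<close>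
  near \<alpha> and, thanks to the regularizer, \<open>O(1/R)\<close> far out; \<open>-1 < g\<close>
  serves the first estimate and \<open>g \<le> 0\<close> the second.\<close>

lemma regularized_deformation:
  assumes z: "Im z < 0" and e: "0 < e"
  defines "p \<equiv> \<lambda>\<mu>. 1 / (1 - \<i> * of_real e * \<mu>)"
  shows "integral {0<..} (\<lambda>s. speed s * (p (\<gamma> s) * (1 / (z - \<gamma> s) * k (\<gamma> s)))) =
    integral {0<..} (\<lambda>s. 1 * (p (of_real (\<alpha> + s)) * (1 / (z - of_real (\<alpha> + s)) * k (of_real (\<alpha> + s)))))"
proof -
  define f where "f \<mu> = p \<mu> * (1 / (z - \<mu>) * k \<mu>)" for \<mu>
  have nz: "z \<noteq> \<mu>" if "0 \<le> Im \<mu>" for \<mu> using that z by auto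
  have ImD: "0 < Im \<mu>" if "\<mu> \<in> D" for \<mu> using that D(3) by auto
  have Im': "0 \<le> Im \<mu>" if "\<mu> \<in> of_real ` {\<alpha><..} \<union> D" for \<mu> using that ImD by force
  have fh: "f holomorphic_on D"
    unfolding f_def p_def using regularizer(1)[OF e] nz ImD
    by (intro holomorphic_intros k_hol) (auto simp: less_imp_le)
  have fc: "continuous_on (of_real ` {\<alpha><..} \<union> D) f"
    unfolding f_def p_def using regularizer(1)[OF e] nz Im'
    by (intro continuous_intros k_cont) auto
  obtain Q where Q: "\<And>\<mu>. \<mu> \<in> D \<Longrightarrow> (Q has_field_derivative f \<mu>) (at \<mu>)"
    "\<And>t. \<alpha> < t \<Longrightarrow> \<exists>r>0. r < t - \<alpha> \<and> {\<mu> \<in> ball (of_real t) r. 0 < Im \<mu>} \<subseteq> G \<and>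
        (Q has_field_derivative f (of_real t)) (at (of_real t) within {\<mu> \<in> ball (of_real t) r. 0 \<le> Im \<mu>})"
    using boundary_primitive[OF fh fc] by blast
  have f_near: "cmod (f \<mu>) \<le> C * R powr g / - Im z" if \<mu>: "\<mu> \<in> D" "cmod (\<mu> - of_real \<alpha>) = R" for \<mu> R
  proof -
    have "- Im z \<le> cmod (z - \<mu>)" using abs_Im_le_cmod[of "z - \<mu>"] ImD[OF \<mu>(1)] z by simp
    then have "cmod (1 / (z - \<mu>)) \<le> 1 / - Im z" unfolding norm_divide norm_one by (intro frac_le) (use z in auto)
    then have "cmod (p \<mu>) * (cmod (1 / (z - \<mu>)) * cmod (k \<mu>)) \<le> 1 * (1 / - Im z * (C * R powr g))"
      using regularizer(2)[OF e] ImD[OF \<mu>(1)] k_bound[OF \<mu>(1)] \<mu>(2) z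
      by (intro mult_mono) (auto simp: p_def)
    then show ?thesis unfolding f_def norm_mult by simp
  qed
  \<comment> \<open>For \<open>R \<ge> L\<close> both \<open>cmod (z - \<mu>)\<close> and
    \<open>cmod \<mu>\<close> are at least \<open>R / 2\<close>; the summand 1 gives
    \<open>R powr g \<le> 1\<close>.\<close>
  define L where "L = 2 * cmod (z - of_real \<alpha>) + 2 * \<bar>\<alpha>\<bar> + 1"
  have L: "1 \<le> L" by (simp add: L_def)
  have f_far: "cmod (f \<mu>) \<le> 4 * C / (e * R\<^sup>2)" if \<mu>: "\<mu> \<in> D" "cmod (\<mu> - of_real \<alpha>) = R" and R: "L \<le> R" for \<mu> R
  proof -
    have R0: "0 < R" using R L by simp
    have "R \<le> cmod (z - of_real \<alpha>) + cmod (z - \<mu>)"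
      using norm_triangle_ineq4[of "z - of_real \<alpha>" "z - \<mu>"] \<mu>(2) by simp
    then have 1: "R / 2 \<le> cmod (z - \<mu>)" using R unfolding L_def by simp
    have "R \<le> cmod \<mu> + \<bar>\<alpha>\<bar>"
      using norm_triangle_ineq4[of \<mu> "of_real \<alpha>"] \<mu>(2) by simp
    then have 2: "R / 2 \<le> cmod \<mu>" using R norm_ge_zero[of "z - of_real \<alpha>"] unfolding L_def by linarith
    have "cmod (p \<mu>) \<le> 1 / (e * cmod \<mu>)"
      unfolding p_def by (rule regularizer(3)[OF e]) (use ImD[OF \<mu>(1)] in auto)
    also have "\<dots> \<le> 1 / (e * (R / 2))" using 2 e R0 by (intro frac_le mult_left_mono) auto
    finally have "cmod (p \<mu>) \<le> 1 / (e * (R / 2))" .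
    moreover have "cmod (1 / (z - \<mu>)) \<le> 1 / (R / 2)" by (simp only: norm_divide norm_one) (rule frac_le, use 1 R0 in auto)
    moreover have "cmod (k \<mu>) \<le> C"
    proof -
      have "R powr g \<le> R powr 0" using R L g(3) by (intro powr_mono) auto
      then have "C * R powr g \<le> C * 1" using g(1) R0 by (intro mult_left_mono) auto
      then show ?thesis using k_bound[OF \<mu>(1)] \<mu>(2) by simp
    qed
    ultimately have "cmod (p \<mu>) * (cmod (1 / (z - \<mu>)) * cmod (k \<mu>)) \<le> 1 / (e * (R / 2)) * (1 / (R / 2) * C)"
      using e R0 by (intro mult_mono) auto
    then show ?thesis unfolding f_def norm_mult by (simp add: power2_eq_square mult_ac)
  qed
  define \<rho> where "\<rho> n = 1 / real (Suc n)" for n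
  define S where "S n = real n + L" for n
  have \<rho>: "0 < \<rho> n" "\<rho> n \<le> 1" for n by (auto simp: \<rho>_def)
  have S: "0 < S n" "L \<le> S n" for n using L by (auto simp: S_def)
  have "\<exists>b. 0 < b \<and> cmod (\<gamma> b - of_real \<alpha>) = \<rho> n \<and>
      cmod (Q (\<gamma> b) - Q (of_real (\<alpha> + \<rho> n))) \<le> pi * \<rho> n * (C * \<rho> n powr g / - Im z)" for n
    by (rule arc_estimate[OF Q \<rho>(1) f_near]) auto
  then obtain a where a: "\<And>n. 0 < a n" "\<And>n. cmod (\<gamma> (a n) - of_real \<alpha>) = \<rho> n"
    "\<And>n. cmod (Q (\<gamma> (a n)) - Q (of_real (\<alpha> + \<rho> n))) \<le> pi * \<rho> n * (C * \<rho> n powr g / - Im z)" by metis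
  have "\<exists>b. 0 < b \<and> cmod (\<gamma> b - of_real \<alpha>) = S n \<and>
      cmod (Q (\<gamma> b) - Q (of_real (\<alpha> + S n))) \<le> pi * S n * (4 * C / (e * (S n)\<^sup>2))" for n
    by (rule arc_estimate[OF Q S(1) f_far]) (use S in auto)
  then obtain b where b: "\<And>n. 0 < b n" "\<And>n. cmod (\<gamma> (b n) - of_real \<alpha>) = S n"
    "\<And>n. cmod (Q (\<gamma> (b n)) - Q (of_real (\<alpha> + S n))) \<le> pi * S n * (4 * C / (e * (S n)\<^sup>2))" by metis
  have \<rho>_lim: "\<rho> \<longlonglongrightarrow> 0"
    unfolding \<rho>_def using LIMSEQ_inverse_real_of_nat by (simp add: inverse_eq_divide)
  have S_lim: "filterlim S at_top sequentially"
    by (rule filterlim_at_top_mono[OF filterlim_real_sequentially]) (use L in \<open>auto simp: S_def\<close>)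
  have a_lim: "a \<longlonglongrightarrow> 0" using small_parameter[OF a(1)] a(2) \<rho>_lim by simp
  \<comment> \<open>A 1-Lipschitz curve needs a parameter of at least \<open>S n\<close> to reach
    distance \<open>S n\<close> from its start.\<close>
  have "S n \<le> b n" for n
    using \<gamma>_lip[of "b n" 0] b(1)[of n] b(2)[of n] by (simp add: dist_norm \<gamma>0)
  then have b_lim: "filterlim b at_top sequentially"
    using filterlim_at_top_mono[OF S_lim] by (simp add: always_eventually)
  define U where "U n = integral {a n..b n} (\<lambda>s. speed s * f (\<gamma> s))" for n
  define V where "V n = integral {\<rho> n..S n} (\<lambda>s. 1 * f (of_real (\<alpha> + s)))" for n
  have pc: "continuous_on {0<..} (\<lambda>s. p (\<gamma> s))" "continuous_on {0<..} (\<lambda>s. p (of_real (\<alpha> + s)))"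
    unfolding p_def using regularizer(1)[OF e] \<gamma>_Im Gam.c
    by (auto intro!: continuous_intros simp: less_imp_le simp del: of_real_add)
  have p1: "cmod (p (\<gamma> s)) \<le> 1" "cmod (p (of_real (\<alpha> + s))) \<le> 1" if "0 < s" for s
    unfolding p_def using regularizer(2)[OF e, of "\<gamma> s"] regularizer(2)[OF e, of "of_real (\<alpha> + s)"] \<gamma>_Im[OF that] by simp_all
  have "0 < - Im z" using z by simp
  have limU: "U \<longlonglongrightarrow> integral {0<..} (\<lambda>s. speed s * f (\<gamma> s))"
    unfolding U_def f_def
    by (rule Gam.truncation_limit[OF \<open>0 < - Im z\<close> _ pc(1) p1(1) a(1) a_lim b_lim]) (use Im_dist_\<gamma>[OF z] in auto)
  have limV: "V \<longlonglongrightarrow> integral {0<..} (\<lambda>s. 1 * f (of_real (\<alpha> + s)))"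
    unfolding V_def f_def
    by (rule Del.truncation_limit[OF \<open>0 < - Im z\<close> _ pc(2) p1(2) \<rho>(1) \<rho>_lim S_lim])
       (use Im_dist_real[of z] z in \<open>auto simp del: of_real_add\<close>)
  have "\<forall>\<^sub>F n in sequentially. cmod (U n - V n) \<le> pi * \<rho> n * (C * \<rho> n powr g / - Im z) + pi * S n * (4 * C / (e * (S n)\<^sup>2))"
  proof -
    \<comment> \<open>\<open>a n\<close> and \<open>b n\<close> come from unrelated arcs; comparison
      with 1 puts them in order for large \<open>n\<close>.\<close>
    have "\<forall>\<^sub>F n in sequentially. a n < 1" using order_tendstoD(2)[OF a_lim] by simp
    moreover have "\<forall>\<^sub>F n in sequentially. 1 < b n" using b_lim by (simp add: filterlim_at_top_dense)
    ultimately show ?thesis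
    proof eventually_elim
      case (elim n)
      have "U n = Q (\<gamma> (b n)) - Q (\<gamma> (a n))"
        unfolding U_def using curve_primitive_integral[OF Q(1) holomorphic_on_imp_continuous_on[OF fh] speed_integral speed_le, of "a n" "b n"] a(1)[of n] elim
        by (simp add: integral_unique)
      moreover have "V n = Q (of_real (\<alpha> + S n)) - Q (of_real (\<alpha> + \<rho> n))"
        unfolding V_def using real_line_integral[OF Q(2) \<rho>(1)[of n], of "S n"] \<rho>[of n] S[of n] L
        by (simp add: integral_unique)
      ultimately have "U n - V n = (Q (\<gamma> (b n)) - Q (of_real (\<alpha> + S n))) - (Q (\<gamma> (a n)) - Q (of_real (\<alpha> + \<rho> n)))"
        by simp
      also have "cmod \<dots> \<le> pi * S n * (4 * C / (e * (S n)\<^sup>2)) + pi * \<rho> n * (C * \<rho> n powr g / - Im z)"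
        by (rule order_trans[OF norm_triangle_ineq4 add_mono[OF b(3) a(3)]])
      finally show ?case by simp
    qed
  qed
  moreover have "(\<lambda>n. pi * \<rho> n * (C * \<rho> n powr g / - Im z) + pi * S n * (4 * C / (e * (S n)\<^sup>2))) \<longlonglongrightarrow> 0"
  proof -
    have "(\<lambda>n. \<rho> n powr (1 + g)) \<longlonglongrightarrow> 0 powr (1 + g)"
      using g(2) \<rho>(1) by (intro tendsto_powr' \<rho>_lim tendsto_const) (auto simp: less_imp_le)
    then have t1: "(\<lambda>n. \<rho> n powr (1 + g) * (pi * C / - Im z)) \<longlonglongrightarrow> 0"
      using tendsto_mult_right[of _ "0 powr (1 + g)" _ "pi * C / - Im z"] by fastforce
    have e1: "pi * \<rho> n * (C * \<rho> n powr g / - Im z) = \<rho> n powr (1 + g) * (pi * C / - Im z)" for n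
      using \<rho>(1)[of n] by (simp add: powr_add)
    have t2: "(\<lambda>n. (pi * 4 * C / e) / S n) \<longlonglongrightarrow> 0"
      by (rule tendsto_divide_0[OF tendsto_const filterlim_at_top_imp_at_infinity[OF S_lim]])
    have e2: "pi * S n * (4 * C / (e * (S n)\<^sup>2)) = (pi * 4 * C / e) / S n" for n
      using S(1)[of n] by (simp add: power2_eq_square)
    show ?thesis
      unfolding e1 e2 using tendsto_add[OF t1 t2] by simp
  qed
  ultimately have "(\<lambda>n. U n - V n) \<longlonglongrightarrow> 0"
    by (rule Lim_null_comparison)
  moreover have "(\<lambda>n. U n - V n) \<longlonglongrightarrow> integral {0<..} (\<lambda>s. speed s * f (\<gamma> s)) - integral {0<..} (\<lambda>s. 1 * f (of_real (\<alpha> + s)))"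
    by (rule tendsto_diff[OF limU limV])
  ultimately have "integral {0<..} (\<lambda>s. speed s * f (\<gamma> s)) - integral {0<..} (\<lambda>s. 1 * f (of_real (\<alpha> + s))) = 0"
    using LIMSEQ_unique by blast
  then show ?thesis by (simp add: f_def)
qed

text \<open>Both transforms converge absolutely under their weights, so the parameter of the
  regularizer can be sent to 0.\<close>

lemma transform_lower_halfplane:
  assumes z: "Im z < 0"
  shows "Gam.transform z = Del.transform z"
proof -
  define p where "p n \<mu> = 1 / (1 - \<i> * of_real (inverse (real (Suc n))) * \<mu>)" for n \<mu>
  have e: "0 < inverse (real (Suc n))" for n by simp
  have lim: "(\<lambda>n. p n \<mu>) \<longlonglongrightarrow> 1" for \<mu>
  proof -
    have "(\<lambda>n. p n \<mu>) \<longlonglongrightarrow> 1 / (1 - \<i> * of_real 0 * \<mu>)"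
      unfolding p_def by (intro tendsto_intros LIMSEQ_inverse_real_of_nat) simp
    then show ?thesis by simp
  qed
  have pc: "continuous_on {0<..} (\<lambda>s. p n (\<gamma> s))" "continuous_on {0<..} (\<lambda>s. p n (of_real (\<alpha> + s)))" for n
    unfolding p_def using regularizer(1)[OF e] \<gamma>_Im Gam.c
    by (auto intro!: continuous_intros simp: less_imp_le simp del: of_real_add of_real_inverse)
  have p1: "cmod (p n (\<gamma> s)) \<le> 1" "cmod (p n (of_real (\<alpha> + s))) \<le> 1" if "0 < s" for n s
    unfolding p_def using regularizer(2)[OF e, of "\<gamma> s"] regularizer(2)[OF e, of "of_real (\<alpha> + s)"] \<gamma>_Im[OF that] by simp_all
  have "0 < - Im z" using z by simp
  have 1: "(\<lambda>n. integral {0<..} (\<lambda>s. speed s * (p n (\<gamma> s) * (1 / (z - \<gamma> s) * k (\<gamma> s))))) \<longlonglongrightarrow> Gam.transform z"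
    by (rule Gam.transform_limit[OF \<open>0 < - Im z\<close> _ pc(1) p1(1) lim]) (use Im_dist_\<gamma>[OF z] in auto)
  have 2: "(\<lambda>n. integral {0<..} (\<lambda>s. 1 * (p n (of_real (\<alpha> + s)) * (1 / (z - of_real (\<alpha> + s)) * k (of_real (\<alpha> + s)))))) \<longlonglongrightarrow> Del.transform z"
    by (rule Del.transform_limit[OF \<open>0 < - Im z\<close> _ pc(2) p1(2) lim])
       (use Im_dist_real[of z] z in \<open>auto simp del: of_real_add\<close>)
  show ?thesis
    using LIMSEQ_unique[OF 1] 2 regularized_deformation[OF z e] unfolding p_def by simp
qed

lemma Del_transform_differentiable: "Im z \<noteq> 0 \<Longrightarrow> Del.transform field_differentiable (at z)"
  using Im_dist_real[of z] by (intro Del.transform_differentiable[of "\<bar>Im z\<bar>"]) auto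

lemma Gam_transform_differentiable:
  assumes "Im z < 0 \<or> (Im z = 0 \<and> \<alpha> < Re z) \<or> z \<in> G"
  shows "Gam.transform field_differentiable (at z)"
proof -
  have "z \<notin> \<gamma> ` {0..}"
  proof
    assume "z \<in> \<gamma> ` {0..}"
    then obtain s where s: "z = \<gamma> s" "0 \<le> s" by auto
    from \<open>z \<in> \<gamma> ` {0..}\<close> have "z \<notin> G" using G_frontier G(1) frontier_disjoint_eq by blast
    with assms s show False
      using \<gamma>_Im[of s] \<gamma>0 by (cases "s = 0") auto
  qed
  from dist_\<gamma>[OF this order_refl] obtain d where "0 < d" "\<And>s. 0 \<le> s \<Longrightarrow> d \<le> cmod (z - \<gamma> s)" by blast
  then show ?thesis by (intro Gam.transform_differentiable[of d]) auto
qed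

text \<open>Replacing a short real segment by the other three sides of a rectangle above it continues the
  integral over the half-line across that segment; Cauchy's formula for the rectangle gives the jump.\<close>

lemma local_jump:
  obtains t r where "\<alpha> < t" "0 < r" "{\<mu> \<in> ball (of_real t) r. 0 < Im \<mu>} \<subseteq> G"
    "\<And>z. z \<in> ball (of_real t) r \<Longrightarrow> 0 < Im z \<Longrightarrow> Gam.transform z = Del.transform z + 2 * of_real pi * \<i> * k z"
proof -
  \<comment> \<open>One point of the half-line suffices; at distance 1 from \<alpha> the segment
    about it has parameters \<open>{1 - r..1 + r}\<close>.\<close>
  define t where "t = \<alpha> + 1"
  have t: "\<alpha> < t" by (simp add: t_def)
  obtain r0 where r0: "0 < r0" "r0 < t - \<alpha>" "{\<mu> \<in> ball (of_real t) r0. 0 < Im \<mu>} \<subseteq> G"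
    using half_disc[OF t] by blast
  \<comment> \<open>Points of the rectangle differ from \<open>t\<close> by at most \<open>r\<close>
    in each coordinate, so by at most \<open>2 * r\<close>, which is less than
    \<open>r0\<close>.\<close>
  define r where "r = r0 / 3"
  have r: "0 < r" "r < 1" using r0 by (auto simp: r_def t_def)
  define a1 a2 a3 a4 where "a1 = Complex (t - r) 0" and "a2 = Complex (t + r) 0" and "a3 = Complex (t + r) r" and "a4 = Complex (t - r) r"
  have Ksub: "cbox a1 a3 \<subseteq> {\<mu> \<in> ball (of_real t) r0. 0 \<le> Im \<mu>}"
  proof
    fix \<mu> assume "\<mu> \<in> cbox a1 a3"
    then have "\<bar>Re (of_real t - \<mu>)\<bar> \<le> r" "\<bar>Im (of_real t - \<mu>)\<bar> \<le> r" "0 \<le> Im \<mu>"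
      by (auto simp: in_cbox_complex_iff a1_def a3_def)
    then show "\<mu> \<in> {\<mu> \<in> ball (of_real t) r0. 0 \<le> Im \<mu>}"
      using cmod_le[of "of_real t - \<mu>"] r(1) by (simp add: dist_norm r_def)
  qed
  have kc: "continuous_on (cbox a1 a3) k"
    by (rule continuous_on_subset[OF k_cont]) (use Ksub half_disc_closed[OF t r0(2,3)] in blast)
  have boxD: "box a1 a3 \<subseteq> D"
  proof
    fix \<mu> assume \<mu>: "\<mu> \<in> box a1 a3"
    then have "\<mu> \<in> ball (of_real t) r0" using Ksub box_subset_cbox by blast
    moreover have "0 < Im \<mu>" using \<mu> by (simp add: in_box_complex_iff a1_def)
    ultimately show "\<mu> \<in> D" using r0(3) G(3) by blast
  qed
  have kd: "k field_differentiable at x" if "x \<in> interior (cbox a1 a3) - {}" for x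
    using that boxD k_hol D(1) holomorphic_on_imp_differentiable_at by auto
  have rect: "rectpath a1 a3 = linepath a1 a2 +++ linepath a2 a3 +++ linepath a3 a4 +++ linepath a4 a1"
    by (simp add: rectpath_def Let_def a1_def a2_def a3_def a4_def)
  have seg: "closed_segment a b \<subseteq> cbox a1 a3" if "a \<in> {a1, a2, a3, a4}" "b \<in> {a1, a2, a3, a4}" for a b
    by (rule closed_segment_subset[OF _ _ convex_box(1)])
       (use that r(1) in \<open>auto simp: in_cbox_complex_iff a1_def a2_def a3_def a4_def\<close>)
  \<comment> \<open>\<open>J\<close> collects three sides of the rectangle and \<open>B\<close> the
    real one. Their sum is 0 for \<open>z\<close> below the axis and the residue term for
    \<open>z\<close> inside, while \<open>J\<close> alone is holomorphic across the segment.\<close>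
  define J where "J z = contour_integral (linepath a2 a3) (\<lambda>w. k w / (w - z)) + contour_integral (linepath a3 a4) (\<lambda>w. k w / (w - z))
     + contour_integral (linepath a4 a1) (\<lambda>w. k w / (w - z))" for z
  define B where "B z = integral {t - r..t + r} (\<lambda>x. k (of_real x) / (of_real x - z))" for z
  have rect_int: "contour_integral (rectpath a1 a3) (\<lambda>w. k w / (w - z)) = B z + J z"
    if z: "z \<notin> path_image (rectpath a1 a3)" for z
  proof -
    have zs: "z \<notin> closed_segment a1 a2" "z \<notin> closed_segment a2 a3" "z \<notin> closed_segment a3 a4" "z \<notin> closed_segment a4 a1"
      using z by (auto simp: rect path_image_join)
    have ci: "(\<lambda>w. k w / (w - z)) contour_integrable_on linepath a b"
      if "closed_segment a b \<subseteq> cbox a1 a3" "z \<notin> closed_segment a b" for a b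
      by (rule contour_integrable_continuous_linepath)
         (use that in \<open>auto intro!: continuous_intros continuous_on_subset[OF kc]\<close>)
    have cis: "(\<lambda>w. k w / (w - z)) contour_integrable_on linepath a1 a2" "(\<lambda>w. k w / (w - z)) contour_integrable_on linepath a2 a3"
        "(\<lambda>w. k w / (w - z)) contour_integrable_on linepath a3 a4" "(\<lambda>w. k w / (w - z)) contour_integrable_on linepath a4 a1"
      by (rule ci[OF seg]; simp add: zs)+
    have "contour_integral (linepath a1 a2) (\<lambda>w. k w / (w - z)) = B z"
      unfolding B_def by (subst contour_integral_linepath_Reals_eq)
        (use r in \<open>auto simp: a1_def a2_def complex_is_Real_iff\<close>)
    then show ?thesis using cis by (simp add: rect J_def)
  qed
  have below: "B z + J z = 0" if z: "Im z < 0" for z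
  proof -
    have zK: "z \<notin> cbox a1 a3" using z by (auto simp: in_cbox_complex_iff a1_def)
    have pi: "path_image (rectpath a1 a3) \<subseteq> cbox a1 a3"
      using r(1) by (intro path_image_rectpath_subset_cbox) (auto simp: a1_def a3_def)
    have "((\<lambda>w. k w / (w - z)) has_contour_integral 0) (rectpath a1 a3)"
    proof (rule Cauchy_theorem_convex[where S = "cbox a1 a3" and K = "{}"])
      show "continuous_on (cbox a1 a3) (\<lambda>w. k w / (w - z))"
        using zK by (intro continuous_intros kc) auto
      show "(\<lambda>w. k w / (w - z)) field_differentiable at x" if "x \<in> interior (cbox a1 a3) - {}" for x
      proof -
        have "x \<noteq> z" using that zK interior_subset[of "cbox a1 a3"] by blast
        then show ?thesis by (intro field_differentiable_divide kd[OF that] derivative_intros) simp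
      qed
    qed (use pi convex_box in auto)
    then have "contour_integral (rectpath a1 a3) (\<lambda>w. k w / (w - z)) = 0" by (rule contour_integral_unique)
    moreover have "z \<notin> path_image (rectpath a1 a3)" using zK pi by blast
    ultimately show ?thesis using rect_int[of z] by simp
  qed
  have above: "B z + J z = 2 * of_real pi * \<i> * k z" if z: "z \<in> box a1 a3" for z
  proof -
    have pi: "path_image (rectpath a1 a3) \<subseteq> cbox a1 a3 - {z}"
      using r(1) path_image_rectpath_cbox_minus_box[of a1 a3] z by (auto simp: a1_def a3_def)
    have "((\<lambda>w. k w / (w - z)) has_contour_integral (2 * pi * \<i> * winding_number (rectpath a1 a3) z * k z)) (rectpath a1 a3)"
      by (rule Cauchy_integral_formula_weak[OF convex_box(1) finite.emptyI kc kd _ valid_path_rectpath pi])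
         (use z in auto)
    then have "contour_integral (rectpath a1 a3) (\<lambda>w. k w / (w - z)) = 2 * pi * \<i> * winding_number (rectpath a1 a3) z * k z"
      by (rule contour_integral_unique)
    moreover have "z \<notin> path_image (rectpath a1 a3)" using pi by blast
    ultimately show ?thesis using rect_int[of z] winding_number_rectpath[OF z] by simp
  qed
  (* Where the weight w vanishes, c dips below the real line, so that it stays away from t. *)
  define c where "c s = of_real (\<alpha> + s) - \<i> * of_real (max 0 (r - \<bar>s - 1\<bar>))" for s
  define w :: "real \<Rightarrow> complex" where "w s = (if s \<in> {1 - r..1 + r} then 0 else 1)" for s
  have c_far: "r / 2 \<le> cmod (c s - of_real t)" for s
  proof (cases "r / 2 \<le> \<bar>s - 1\<bar>")
    case True
    then show ?thesis using abs_Re_le_cmod[of "c s - of_real t"] by (simp add: c_def t_def)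
  next
    case False
    then show ?thesis using abs_Im_le_cmod[of "c s - of_real t"] by (simp add: c_def)
  qed
  interpret Off: weighted_curve c w "\<lambda>s. k (of_real (\<alpha> + s))"
  proof
    show cc: "continuous_on {0<..} c"
      unfolding c_def by (intro continuous_intros)
    show "continuous_on {0<..} (\<lambda>s. k (of_real (\<alpha> + s)))" by (rule k_real_cont)
    show "cmod (w s) \<le> 1" for s by (simp add: w_def)
    show "w integrable_on {a..b}" for a b
    proof -
      have "(\<lambda>s. if s \<in> {1 - r..1 + r} then 1 else 0 :: complex) integrable_on {a..b}"
        by (subst integrable_restrict_Int) (auto simp: Int_atLeastAtMost)
      then have "(\<lambda>s. 1 - (if s \<in> {1 - r..1 + r} then 1 else 0 :: complex)) integrable_on {a..b}"
        by (intro integrable_diff) auto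
      then show ?thesis by (rule integrable_eq) (simp add: w_def)
    qed
    show "(\<lambda>s. cmod (k (of_real (\<alpha> + s))) / (1 + cmod (c s))) integrable_on {0<..}"
    proof (rule continuous_dominated_integrable[OF _ weight_real])
      have "1 + cmod x \<noteq> 0" for x using norm_ge_zero[of x] by linarith
      then show "continuous_on {0<..} (\<lambda>s. cmod (k (of_real (\<alpha> + s))) / (1 + cmod (c s)))"
        by (auto intro!: continuous_intros k_real_cont cc simp del: of_real_add)
      fix s
      have "cmod (complex_of_real (\<alpha> + s)) \<le> cmod (c s)"
        using abs_Re_le_cmod[of "c s"] by (simp add: c_def del: of_real_add)
      then have "cmod (k (of_real (\<alpha> + s))) / (1 + cmod (c s)) \<le> cmod (k (of_real (\<alpha> + s))) / (1 + cmod (complex_of_real (\<alpha> + s)))"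
        by (intro divide_left_mono mult_pos_pos add_pos_nonneg) auto
      moreover have "0 \<le> cmod (k (of_real (\<alpha> + s))) / (1 + cmod (c s))" by (intro divide_nonneg_nonneg) auto
      ultimately show "\<bar>cmod (k (of_real (\<alpha> + s))) / (1 + cmod (c s))\<bar> \<le>
          cmod (k (of_real (\<alpha> + s))) / (1 + cmod (complex_of_real (\<alpha> + s)))"
        by (simp only: abs_of_nonneg)
    qed
  qed
  \<comment> \<open>\<open>c\<close> has distance at least \<open>r / 2\<close> from
    \<open>t\<close>, hence at least \<open>r / 4\<close> from this ball, and the three sides in
    \<open>J\<close> lie outside it.\<close>
  define ball4 where "ball4 = ball (complex_of_real t) (r / 4)"
  have Off_diff: "Off.transform field_differentiable (at z)" if "z \<in> ball4" for z
  proof (rule Off.transform_differentiable[of "r / 4"])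
    show "r / 4 \<le> cmod (z - c s)" for s
      using that c_far[of s] norm_triangle_ineq4[of "z - c s" "z - of_real t"]
      by (simp add: ball4_def dist_norm norm_minus_commute)
  qed (use r in simp)
  \<comment> \<open>The minus sign arises because \<open>B\<close> uses the kernel
    \<open>1 / (x - z)\<close> and the transforms use \<open>1 / (z - x)\<close>.\<close>
  have Del_split: "Del.transform z = Off.transform z - B z" if z: "Im z \<noteq> 0" for z
  proof -
    let ?h = "\<lambda>s. 1 / (z - of_real (\<alpha> + s)) * k (of_real (\<alpha> + s))"
    have h: "?h integrable_on {0<..}"
      using Del.integrable_kernel[of "\<bar>Im z\<bar>" z "\<lambda>_. 1"] Im_dist_real[of z] z by (simp del: of_real_add)
    have sub: "{1 - r..1 + r} \<subseteq> {0<..}" using r by auto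
    have hs: "(\<lambda>s. if s \<in> {1 - r..1 + r} then ?h s else 0) integrable_on {0<..}"
      using integrable_on_subinterval[OF h sub] sub by (subst integrable_restrict_Int) (simp add: Int_absorb2)
    have "Off.transform z = integral {0<..} (\<lambda>s. ?h s - (if s \<in> {1 - r..1 + r} then ?h s else 0))"
      unfolding Off.transform_def by (rule integral_cong) (auto simp: w_def c_def max_def)
    also have "\<dots> = integral {0<..} ?h - integral {0<..} (\<lambda>s. if s \<in> {1 - r..1 + r} then ?h s else 0)"
      by (rule integral_diff[OF h hs])
    also have "integral {0<..} (\<lambda>s. if s \<in> {1 - r..1 + r} then ?h s else 0) = integral {1 - r..1 + r} ?h"
      using sub by (subst integral_restrict_Int) (simp add: Int_absorb2)
    finally have Off_eq: "Off.transform z = integral {0<..} ?h - integral {1 - r..1 + r} ?h" .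
    have "?h = (\<lambda>x. - (k (of_real x) / (of_real x - z))) \<circ> (+) \<alpha>"
    proof
      fix s
      have "z - of_real (\<alpha> + s) = - (of_real (\<alpha> + s) - z)" by simp
      then show "?h s = ((\<lambda>x. - (k (of_real x) / (of_real x - z))) \<circ> (+) \<alpha>) s"
        by (simp only: o_def divide_minus_right) simp
    qed
    then have seg_eq: "integral {1 - r..1 + r} ?h = - B z"
      unfolding B_def by (simp only: integral_shift_Icc_real) (simp add: t_def algebra_simps)
    have "Del.transform z = integral {0<..} ?h"
      unfolding Del.transform_def mult_1 ..
    then show ?thesis unfolding Off_eq seg_eq by simp
  qed
  have J_hol: "J field_differentiable (at z)" if z: "z \<in> ball4" for z
  proof -
    have "cmod (z - of_real t) < r / 4" using z by (simp add: ball4_def dist_norm norm_minus_commute)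
    then have "\<bar>Re z - t\<bar> < r / 4" "\<bar>Im z\<bar> < r / 4"
      using abs_Re_le_cmod[of "z - of_real t"] abs_Im_le_cmod[of "z - of_real t"] by auto
    then have "z \<notin> closed_segment a2 a3" "z \<notin> closed_segment a3 a4" "z \<notin> closed_segment a4 a1"
      using r by (auto simp: closed_segment_same_Re closed_segment_same_Im a1_def a2_def a3_def a4_def)
    then show ?thesis
      unfolding J_def[abs_def]
      by (intro field_differentiable_add linepath_cauchy_differentiable continuous_on_subset[OF kc] seg) auto
  qed
  have ball4_sub: "ball4 \<subseteq> ball (of_real t) r0" using r by (auto simp: ball4_def r_def)
  \<comment> \<open>Below the axis \<open>B z\<close> equals \<open>- J z\<close>, so there the
    half-line transform, and with it the contour transform, is \<open>Off.transform z + J z\<close>.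
    The right side is holomorphic in the whole ball, so the equality persists above, where
    \<open>B z + J z\<close> no longer vanishes.\<close>
  have Gam_ball: "Gam.transform z = Off.transform z + J z" if "z \<in> ball4" for z
  proof (rule analytic_continuation_open[of "ball4 \<inter> {z. Im z < 0}" ball4 Gam.transform "\<lambda>z. Off.transform z + J z"])
    show "open (ball4 \<inter> {z. Im z < 0})" by (auto simp: ball4_def intro!: open_Int open_halfspace_Im_lt)
    show "ball4 \<inter> {z. Im z < 0} \<noteq> {}"
    proof -
      have "of_real t - \<i> * of_real (r / 8) \<in> ball4 \<inter> {z. Im z < 0}"
        using r by (simp add: ball4_def dist_norm norm_mult)
      then show ?thesis by blast
    qed
    show "Gam.transform holomorphic_on ball4"
      unfolding holomorphic_on_def
    proof
      fix z assume z: "z \<in> ball4"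
      then have zb: "z \<in> ball (of_real t) r0" using ball4_sub by blast
      then have "\<bar>t - Re z\<bar> < r0" using abs_Re_le_cmod[of "of_real t - z"] by (simp add: dist_norm)
      then have "\<alpha> < Re z" using r0(2) by linarith
      moreover have "z \<in> G" if "0 < Im z" using r0(3) zb that by blast
      ultimately have "Im z < 0 \<or> (Im z = 0 \<and> \<alpha> < Re z) \<or> z \<in> G"
        by (cases "Im z" "0 :: real" rule: linorder_cases) auto
      then show "Gam.transform field_differentiable at z within ball4"
        by (rule field_differentiable_at_within[OF Gam_transform_differentiable])
    qed
    show "(\<lambda>z. Off.transform z + J z) holomorphic_on ball4"
      unfolding holomorphic_on_def
      by (intro ballI field_differentiable_at_within[OF field_differentiable_add] Off_diff J_hol)
    show "Gam.transform z = Off.transform z + J z" if "z \<in> ball4 \<inter> {z. Im z < 0}" for z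
      using that transform_lower_halfplane[of z] Del_split[of z] below[of z] by (simp add: add_eq_0_iff)
  qed (use that in \<open>auto simp: ball4_def\<close>)
  show thesis
  proof (rule that[OF t, of "r / 4"])
    show "{\<mu> \<in> ball (of_real t) (r / 4). 0 < Im \<mu>} \<subseteq> G" using r0(3) ball4_sub unfolding ball4_def by blast
    fix z assume z: "z \<in> ball (of_real t) (r / 4)" "0 < Im z"
    have "cmod (z - of_real t) < r / 4" using z(1) by (simp add: dist_norm norm_minus_commute)
    then have "\<bar>Re z - t\<bar> < r / 4" "\<bar>Im z\<bar> < r / 4"
      using abs_Re_le_cmod[of "z - of_real t"] abs_Im_le_cmod[of "z - of_real t"] by auto
    then have "\<bar>Re z - t\<bar> < r" "\<bar>Im z\<bar> < r" using r(1) by auto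
    then have "z \<in> box a1 a3" using z(2) by (auto simp: in_box_complex_iff a1_def a3_def abs_less_iff)
    note above[OF this]
    moreover have "Gam.transform z = Off.transform z + J z" using Gam_ball[of z] z(1) by (simp only: ball4_def)
    moreover have "Del.transform z = Off.transform z - B z" by (rule Del_split) (use z in simp)
    ultimately show "Gam.transform z = Del.transform z + 2 * of_real pi * \<i> * k z"
      by (metis add_diff_cancel_left' add_diff_eq diff_add_eq diff_diff_eq2)
  qed (use r in simp)
qed

lemma transform_in_G:
  assumes z: "z \<in> G"
  shows "Gam.transform z = Del.transform z + 2 * of_real pi * \<i> * k z"
proof -
  obtain t r where tr: "\<alpha> < t" "0 < r" "{\<mu> \<in> ball (of_real t) r. 0 < Im \<mu>} \<subseteq> G"
    "\<And>z. z \<in> ball (of_real t) r \<Longrightarrow> 0 < Im z \<Longrightarrow> Gam.transform z = Del.transform z + 2 * of_real pi * \<i> * k z"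
    using local_jump by blast
  let ?U = "ball (complex_of_real t) r \<inter> {\<mu>. 0 < Im \<mu>}"
  have ImG: "0 < Im w" if "w \<in> G" for w using that G(3) D(3) by auto
  show ?thesis
  proof (rule analytic_continuation_open[of ?U G Gam.transform "\<lambda>z. Del.transform z + 2 * of_real pi * \<i> * k z"])
    show "open ?U" by (intro open_Int open_ball open_halfspace_Im_gt)
    have "of_real t + \<i> * of_real (r / 2) \<in> ?U" using tr(2) by (simp add: dist_norm norm_mult)
    then show "?U \<noteq> {}" by blast
    show "?U \<subseteq> G" using tr(3) by auto
    show "Gam.transform holomorphic_on G"
      unfolding holomorphic_on_def by (intro ballI field_differentiable_at_within[OF Gam_transform_differentiable]) simp
    have "Del.transform holomorphic_on G"
      unfolding holomorphic_on_def
      by (intro ballI field_differentiable_at_within[OF Del_transform_differentiable]) (use ImG in force)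
    then show "(\<lambda>z. Del.transform z + 2 * of_real pi * \<i> * k z) holomorphic_on G"
      by (intro holomorphic_intros holomorphic_on_subset[OF k_hol G(3)])
  qed (use z G tr(4) in auto)
qed

end

section \<open>Spectral measures and resolvents\<close>

lemma cinner_add_right: "cinner x (y + z) = cinner x y + cinner x (z :: 'a::complex_hilbert_space)"
  by (metis cinner_commute cinner_add_left complex_cnj_add)

lemma cinner_scaleC_right: "cinner x (c *\<^sub>C y) = cnj c * cinner x (y :: 'a::complex_hilbert_space)"
  by (metis cinner_commute cinner_scaleC_left complex_cnj_mult)

lemma cinner_zero_left [simp]: "cinner 0 (y :: 'a::complex_hilbert_space) = 0"
  using cinner_add_left[of 0 0 y] by simp

lemma cinner_zero_right [simp]: "cinner (x :: 'a::complex_hilbert_space) 0 = 0"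
  using cinner_add_right[of x 0 0] by simp

lemma cinner_diff_left: "cinner (x - y) z = cinner x z - cinner y (z :: 'a::complex_hilbert_space)"
  using cinner_add_left[of "x - y" y z] by simp

lemma cinner_diff_right: "cinner x (y - z) = cinner x y - cinner x (z :: 'a::complex_hilbert_space)"
  using cinner_add_right[of x "y - z" z] by simp

lemma cinner_self: "cinner x x = of_real ((norm (x :: 'a::complex_hilbert_space))\<^sup>2)"
proof -
  have "Im (cinner x x) = 0" using arg_cong[OF cinner_commute[of x x], of Im] by simp
  moreover have "Re (cinner x x) = (norm x)\<^sup>2"
    by (simp add: inner_eq_Re_cinner[symmetric] power2_norm_eq_inner)
  ultimately show ?thesis by (simp add: complex_eq_iff)
qed

lemma scaleC_one [simp]: "1 *\<^sub>C (x :: 'a::complex_hilbert_space) = x"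
  using scaleR_scaleC[of 1 x] by simp

lemma scaleC_zero_right [simp]: "c *\<^sub>C (0 :: 'a::complex_hilbert_space) = 0"
  using norm_scaleC[of c "0 :: 'a"] by simp

lemma scaleC_diff_right: "c *\<^sub>C (x - y) = c *\<^sub>C x - c *\<^sub>C (y :: 'a::complex_hilbert_space)"
  using scaleC_add_right[of c "x - y" y] by simp

text \<open>A unimodular factor on \<open>x\<close> makes the product real and nonnegative, which
  reduces the claim to the real Cauchy-Schwarz inequality.\<close>

lemma cinner_norm_le: "cmod (cinner x y) \<le> norm x * norm (y :: 'a::complex_hilbert_space)"
proof (cases "cinner x y = 0")
  case False
  define c where "c = cnj (cinner x y) / of_real (cmod (cinner x y))"
  have "c * cinner x y = of_real (cmod (cinner x y))"
    using False by (simp add: c_def complex_norm_square[symmetric] power2_eq_square mult.commute)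
  then have "cmod (cinner x y) = inner (c *\<^sub>C x) y"
    by (simp add: inner_eq_Re_cinner cinner_scaleC_left)
  also have "\<dots> \<le> norm (c *\<^sub>C x) * norm y" by (rule norm_cauchy_schwarz)
  also have "norm (c *\<^sub>C x) = norm x" using False by (simp add: norm_scaleC c_def norm_divide)
  finally show ?thesis .
qed simp

lemma bounded_linear_cinner_left: "bounded_linear (\<lambda>x. cinner x (y :: 'a::complex_hilbert_space))"
  by (rule bounded_linear_intro[where K = "norm y"])
     (simp_all add: cinner_add_left scaleR_scaleC[where 'a = 'a] cinner_scaleC_left cinner_norm_le scaleR_conv_of_real)

lemma bounded_linear_cinner_right: "bounded_linear (\<lambda>y. cinner (x :: 'a::complex_hilbert_space) y)"
proof (rule bounded_linear_intro[where K = "norm x"])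
  show "cmod (cinner x y) \<le> norm y * norm x" for y using cinner_norm_le[of x y] by (simp add: mult.commute)
qed (simp_all add: cinner_add_right scaleR_scaleC[where 'a = 'a] cinner_scaleC_right scaleR_conv_of_real)

lemma cinner_ext:
  assumes "\<And>z. cinner x z = cinner y (z :: 'a::complex_hilbert_space)"
  shows "x = y"
proof -
  have "cinner (x - y) (x - y) = 0" using assms[of "x - y"] by (simp add: cinner_diff_left)
  then show ?thesis by (simp add: cinner_self)
qed

lemma bounded_adjoint_sym: "bounded_adjoint B C \<Longrightarrow> bounded_adjoint C B"
  unfolding bounded_adjoint_def by (metis cinner_commute)

lemma bounded_adjoint_scaleC:
  assumes "bounded_adjoint B C"
  shows "B (c *\<^sub>C x) = c *\<^sub>C B x"
  using assms by (intro cinner_ext) (simp add: bounded_adjoint_def cinner_scaleC_left)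

lemma bounded_adjoint_diff:
  assumes "bounded_adjoint B C" "bounded_adjoint B' C'"
  shows "bounded_adjoint (B - B') (C - C')"
  using assms by (simp add: bounded_adjoint_def blinfun.diff_left cinner_diff_left cinner_diff_right)

lemma bounded_adjoint_norm_le:
  assumes "bounded_adjoint B C"
  shows "norm C \<le> norm B"
proof (rule norm_blinfun_bound)
  fix y
  have "complex_of_real ((norm (C y))\<^sup>2) = cinner (B (C y)) y"
    using assms by (simp add: bounded_adjoint_def cinner_self)
  then have "(norm (C y))\<^sup>2 = cmod (cinner (B (C y)) y)"
    by (metis abs_of_nonneg norm_of_real zero_le_power2)
  also have "\<dots> \<le> norm (B (C y)) * norm y" by (rule cinner_norm_le)
  also have "\<dots> \<le> norm B * norm (C y) * norm y" by (intro mult_right_mono norm_blinfun) simp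
  finally have "norm (C y) * norm (C y) \<le> norm (C y) * (norm B * norm y)"
    by (simp add: power2_eq_square mult_ac)
  then show "norm (C y) \<le> norm B * norm y"
    by (cases "norm (C y) = 0") (auto simp: mult_le_cancel_left)
qed simp

lemma bounded_adjoint_norm: "bounded_adjoint B C \<Longrightarrow> norm C = norm B"
  using bounded_adjoint_norm_le bounded_adjoint_sym by (metis order_antisym)

locale spectral_projections =
  fixes E :: "real set \<Rightarrow> 'a::complex_hilbert_space \<Rightarrow>\<^sub>L 'a"
  assumes pvm: "projection_valued_measure E"
begin

lemma E_idem: "S \<in> sets borel \<Longrightarrow> E S (E S x) = E S x"
  using pvm unfolding projection_valued_measure_def by (metis blinfun_apply_blinfun_compose)

lemma E_adj: "S \<in> sets borel \<Longrightarrow> cinner (E S x) y = cinner x (E S y)"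
  using pvm unfolding projection_valued_measure_def bounded_adjoint_def by metis

lemma E_scaleC: "S \<in> sets borel \<Longrightarrow> E S (c *\<^sub>C x) = c *\<^sub>C E S x"
  using pvm unfolding projection_valued_measure_def by (metis bounded_adjoint_scaleC)

lemma E_UNIV: "E UNIV x = x"
  using pvm unfolding projection_valued_measure_def by simp

lemma E_sums: "range F \<subseteq> sets borel \<Longrightarrow> disjoint_family F \<Longrightarrow> (\<lambda>n. E (F n) x) sums E (\<Union>n. F n) x"
  using pvm unfolding projection_valued_measure_def by metis

lemma E_empty [simp]: "E {} x = 0"
proof -
  have "(\<lambda>n::nat. E {} x) sums E (\<Union>n::nat. {}) x"
    by (rule E_sums) (auto simp: disjoint_family_on_def)
  then show ?thesis using sums_summable summable_const_iff by blast
qed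

lemma E_Un:
  assumes "S \<in> sets borel" "T \<in> sets borel" "S \<inter> T = {}"
  shows "E (S \<union> T) x = E S x + E T x"
proof -
  have "(\<lambda>n. E (binaryset S T n) x) sums E (\<Union>n. binaryset S T n) x"
    by (rule E_sums) (use assms in \<open>auto simp: binaryset_def disjoint_family_on_def\<close>)
  moreover have "(\<lambda>n. E (binaryset S T n) x) sums (\<Sum>n\<in>{0,1}. E (binaryset S T n) x)"
    by (rule sums_finite) (auto simp: binaryset_def)
  ultimately show ?thesis
    using sums_unique2 by (fastforce simp: UN_binaryset_eq binaryset_def)
qed

lemma norm_E: "S \<in> sets borel \<Longrightarrow> cinner (E S x) x = of_real ((norm (E S x))\<^sup>2)"
  by (metis E_adj E_idem cinner_self)

text \<open>For \<open>y\<close> in the range of \<open>E T\<close>, the vector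
  \<open>E S y + y\<close> is a projection of \<open>y\<close> itself, so its squared norm is
  \<open>(norm (E S y))^2 + (norm y)^2\<close>; direct expansion gives
  \<open>2 * (norm (E S y))^2\<close> more.\<close>

lemma E_disjoint:
  assumes "S \<in> sets borel" "T \<in> sets borel" "S \<inter> T = {}"
  shows "E S (E T x) = 0"
proof -
  define y where "y = E T x"
  have y: "E T y = y" unfolding y_def by (rule E_idem[OF assms(2)])
  have Q: "E (S \<union> T) y = E S y + y" using E_Un[OF assms, of y] y by simp
  have "S \<union> T \<in> sets borel" using assms by auto
  from norm_E[OF this, of y] have "complex_of_real ((norm (E S y + y))\<^sup>2) = cinner (E S y) y + cinner y y"
    unfolding Q by (simp add: cinner_add_left)
  also have "\<dots> = of_real ((norm (E S y))\<^sup>2 + (norm y)\<^sup>2)"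
    by (simp add: norm_E[OF assms(1)] cinner_self)
  finally have 1: "(norm (E S y + y))\<^sup>2 = (norm (E S y))\<^sup>2 + (norm y)\<^sup>2"
    by (simp only: of_real_eq_iff)
  have "(norm (E S y + y))\<^sup>2 = (norm (E S y))\<^sup>2 + 2 * inner (E S y) y + (norm y)\<^sup>2"
    by (simp add: power2_norm_eq_inner inner_add_left inner_add_right inner_commute)
  moreover have "inner (E S y) y = (norm (E S y))\<^sup>2"
    by (simp add: inner_eq_Re_cinner norm_E[OF assms(1)])
  ultimately have "(norm (E S y))\<^sup>2 = 0" using 1 by simp
  then show ?thesis by (simp add: y_def)
qed

lemma E_Int:
  assumes "S \<in> sets borel" "T \<in> sets borel"
  shows "E S (E T x) = E (S \<inter> T) x"
proof -
  have "E ((S \<inter> T) \<union> (T - S)) x = E (S \<inter> T) x + E (T - S) x"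
    by (rule E_Un) (use assms in auto)
  moreover have "(S \<inter> T) \<union> (T - S) = T" by blast
  ultimately have "E T x = E (S \<inter> T) x + E (T - S) x" by simp
  then have "E S (E T x) = E S (E (S \<inter> T) x)"
    using E_disjoint[of S "T - S" x] assms by (simp add: blinfun.add_right)
  also have "E S y = E (S \<inter> T) y + E (S - T) y" for y
  proof -
    have "E ((S \<inter> T) \<union> (S - T)) y = E (S \<inter> T) y + E (S - T) y"
      by (rule E_Un) (use assms in auto)
    moreover have "(S \<inter> T) \<union> (S - T) = S" by blast
    ultimately show ?thesis by simp
  qed
  then have "E S (E (S \<inter> T) x) = E (S \<inter> T) (E (S \<inter> T) x) + E (S - T) (E (S \<inter> T) x)" .
  also have "\<dots> = E (S \<inter> T) x"
    using E_disjoint[of "S - T" "S \<inter> T" x] E_idem[of "S \<inter> T" x] assms by fastforce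
  finally show ?thesis .
qed

lemma E_Compl: "S \<in> sets borel \<Longrightarrow> E (- S) x = x - E S x"
  using E_Un[of S "- S" x] by (simp add: E_UNIV) (metis add_diff_cancel_left')

abbreviation \<mu> where "\<mu> \<equiv> scalar_spectral_measure E"

lemma space_\<mu> [simp]: "space (\<mu> x) = UNIV" and sets_\<mu> [simp, measurable_cong]: "sets (\<mu> x) = sets borel"
  by (simp_all add: scalar_spectral_measure_def sets.sigma_sets_eq[of borel, simplified])

text \<open>\<open>measure_of\<close> returns the prescribed values only for a countably additive
  set function; additivity comes from the strongly convergent sums of \<open>E\<close>.\<close>

lemma emeasure_\<mu>: "S \<in> sets borel \<Longrightarrow> emeasure (\<mu> x) S = ennreal ((norm (E S x))\<^sup>2)"
proof -
  assume S: "S \<in> sets borel"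
  have "emeasure (\<mu> x) S = ennreal (Re (cinner (E S x) x))"
  proof (rule emeasure_measure_of[OF scalar_spectral_measure_def])
    show "positive (sets (\<mu> x)) (\<lambda>S. ennreal (Re (cinner (E S x) x)))" by (simp add: positive_def)
    show "countably_additive (sets (\<mu> x)) (\<lambda>S. ennreal (Re (cinner (E S x) x)))"
      unfolding countably_additive_def
    proof (intro allI impI)
      fix F :: "nat \<Rightarrow> real set" assume F: "range F \<subseteq> sets (\<mu> x)" "disjoint_family F"
      have "bounded_linear (\<lambda>y. Re (cinner y x))"
        by (rule bounded_linear_compose[OF bounded_linear_Re bounded_linear_cinner_left])
      from bounded_linear.sums[OF this E_sums[of F x]] F
      have s: "(\<lambda>n. Re (cinner (E (F n) x) x)) sums Re (cinner (E (\<Union>n. F n) x) x)" by simp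
      have "F n \<in> sets borel" for n using F by auto
      then have "0 \<le> Re (cinner (E (F n) x) x)" for n by (simp add: norm_E)
      then show "(\<Sum>n. ennreal (Re (cinner (E (F n) x) x))) = ennreal (Re (cinner (E (\<Union>n. F n) x) x))"
        using s by (simp add: suminf_ennreal2 sums_summable sums_unique[symmetric])
    qed
  qed (use S in auto)
  then show ?thesis using S by (simp add: norm_E)
qed

sublocale \<mu>: finite_measure "\<mu> x" for x
  by standard (simp add: emeasure_\<mu>)

lemma measure_\<mu>: "S \<in> sets borel \<Longrightarrow> measure (\<mu> x) S = (norm (E S x))\<^sup>2"
  by (simp add: measure_def emeasure_\<mu>)

lemma \<mu>_E:
  assumes S: "S \<in> sets borel"
  shows "\<mu> (E S x) = density (\<mu> x) (indicator S)"
proof (rule measure_eqI)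
  fix T assume "T \<in> sets (\<mu> (E S x))"
  then have T: "T \<in> sets borel" by simp
  have "emeasure (density (\<mu> x) (indicator S)) T = (\<integral>\<^sup>+t. indicator S t * indicator T t \<partial>\<mu> x)"
    by (rule emeasure_density) (use S T in auto)
  also have "\<dots> = (\<integral>\<^sup>+t. indicator (S \<inter> T) t \<partial>\<mu> x)"
    by (rule nn_integral_cong) (simp add: indicator_def)
  also have "\<dots> = emeasure (\<mu> x) (S \<inter> T)" using S T by simp
  finally show "emeasure (\<mu> (E S x)) T = emeasure (density (\<mu> x) (indicator S)) T"
    using S T by (simp add: emeasure_\<mu> E_Int Int_commute)
qed simp

lemma E_tendsto_0:
  assumes S: "\<And>n. S n \<in> sets borel" "decseq S" and z: "E (\<Inter>n. S n) x = 0"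
  shows "(\<lambda>n. E (S n) x) \<longlonglongrightarrow> 0"
proof -
  have "(\<lambda>n. measure (\<mu> x) (S n)) \<longlonglongrightarrow> measure (\<mu> x) (\<Inter>n. S n)"
    by (rule \<mu>.finite_Lim_measure_decseq) (use S in auto)
  moreover have "(\<Inter>n. S n) \<in> sets borel" using S by auto
  ultimately have "(\<lambda>n. (norm (E (S n) x))\<^sup>2) \<longlonglongrightarrow> 0"
    using S z by (simp add: measure_\<mu>)
  then have "(\<lambda>n. sqrt ((norm (E (S n) x))\<^sup>2)) \<longlonglongrightarrow> sqrt 0" by (rule tendsto_real_sqrt)
  then show ?thesis by (simp add: tendsto_norm_zero_iff)
qed

end

section \<open>Spectral subspaces and resolvent of an unbounded selfadjoint operator\<close>

locale spectral_operator = spectral_projections E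
  for E :: "real set \<Rightarrow> 'a::complex_hilbert_space \<Rightarrow>\<^sub>L 'a" +
  fixes D :: "'a set" and A :: "'a \<Rightarrow> 'a"
  assumes selfadjoint: "selfadjoint_operator D A"
    and integral: "is_spectral_integral E (\<lambda>t. t) D A"
begin

lemma lin: "linear_operator D A" and dense: "closure D = UNIV"
  using selfadjoint by (auto simp: selfadjoint_operator_def adjoint_operator_def)

lemma D_add: "x \<in> D \<Longrightarrow> y \<in> D \<Longrightarrow> x + y \<in> D" and A_add: "x \<in> D \<Longrightarrow> y \<in> D \<Longrightarrow> A (x + y) = A x + A y"
  and D_scaleC: "x \<in> D \<Longrightarrow> c *\<^sub>C x \<in> D" and A_scaleC: "x \<in> D \<Longrightarrow> A (c *\<^sub>C x) = c *\<^sub>C A x"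
  using lin by (auto simp: linear_operator_def)

lemma scaleC_minus1: "(-1) *\<^sub>C x = - (x :: 'b::complex_hilbert_space)"
  using scaleR_scaleC[of "-1" x] by simp

lemma D_diff: "x \<in> D \<Longrightarrow> y \<in> D \<Longrightarrow> x - y \<in> D" and A_diff: "x \<in> D \<Longrightarrow> y \<in> D \<Longrightarrow> A (x - y) = A x - A y"
  using D_add[of x "(-1) *\<^sub>C y"] A_add[of x "(-1) *\<^sub>C y"] D_scaleC[of y "-1"] A_scaleC[of y "-1"]
  by (simp_all add: scaleC_minus1)

lemma A_sym: "x \<in> D \<Longrightarrow> y \<in> D \<Longrightarrow> cinner (A x) y = cinner x (A y)"
  using selfadjoint by (auto simp: selfadjoint_operator_def adjoint_operator_def)

lemma D_iff: "x \<in> D \<longleftrightarrow> (\<integral>\<^sup>+t. ennreal (t\<^sup>2) \<partial>\<mu> x) < \<infinity>"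
  and form: "x \<in> D \<Longrightarrow> cinner (A x) x = of_real (\<integral>t. t \<partial>\<mu> x)"
  using integral by (auto simp: is_spectral_integral_def spectral_integral_domain_def)

lemma D_E:
  assumes S: "S \<in> sets borel" and x: "x \<in> D"
  shows "E S x \<in> D"
proof -
  have "(\<integral>\<^sup>+t. ennreal (t\<^sup>2) \<partial>\<mu> (E S x)) = (\<integral>\<^sup>+t. indicator S t * ennreal (t\<^sup>2) \<partial>\<mu> x)"
    unfolding \<mu>_E[OF S] using S by (subst nn_integral_density) auto
  also have "\<dots> \<le> (\<integral>\<^sup>+t. ennreal (t\<^sup>2) \<partial>\<mu> x)"
    by (intro nn_integral_mono) (auto simp: indicator_def)
  finally show ?thesis using x unfolding D_iff by (rule le_less_trans)
qed

lemma E_bounded_D: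
  assumes S: "S \<in> sets borel" "\<And>t. t \<in> S \<Longrightarrow> \<bar>t\<bar> \<le> b"
  shows "E S x \<in> D"
proof -
  have "(\<integral>\<^sup>+t. ennreal (t\<^sup>2) \<partial>\<mu> (E S x)) = (\<integral>\<^sup>+t. indicator S t * ennreal (t\<^sup>2) \<partial>\<mu> x)"
    unfolding \<mu>_E[OF S(1)] using S by (subst nn_integral_density) auto
  also have "\<dots> \<le> (\<integral>\<^sup>+t. ennreal (b\<^sup>2) \<partial>\<mu> x)"
  proof (intro nn_integral_mono)
    show "indicator S t * ennreal (t\<^sup>2) \<le> ennreal (b\<^sup>2)" for t
      using power_mono[OF S(2), of t 2] by (auto simp: indicator_def intro!: ennreal_leI)
  qed
  also have "\<dots> < \<infinity>" by (simp add: emeasure_\<mu> ennreal_mult_less_top)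
  finally show ?thesis unfolding D_iff .
qed

lemma integrable_id:
  assumes "x \<in> D"
  shows "integrable (\<mu> x) (\<lambda>t. t)"
proof (rule Bochner_Integration.integrable_bound)
  have "integrable (\<mu> x) (\<lambda>t. t\<^sup>2)"
    using assms unfolding D_iff by (intro integrableI_bounded) auto
  then show "integrable (\<mu> x) (\<lambda>t. 1 + t\<^sup>2)" by (intro Bochner_Integration.integrable_add) auto
  have "\<bar>t\<bar> \<le> \<bar>1 + t\<^sup>2\<bar>" for t :: real
  proof -
    have "0 \<le> (\<bar>t\<bar> - 1)\<^sup>2" by simp
    then have "2 * \<bar>t\<bar> \<le> 1 + t\<^sup>2" by (simp add: power2_diff)
    then show ?thesis by linarith
  qed
  then show "AE t in \<mu> x. norm t \<le> norm (1 + t\<^sup>2)" by simp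
qed simp

lemma form_E:
  assumes S: "S \<in> sets borel" and x: "x \<in> D"
  shows "cinner (A (E S x)) (E S x) = of_real (\<integral>t. indicator S t * t \<partial>\<mu> x)"
proof -
  have "(\<integral>t. t \<partial>\<mu> (E S x)) = (\<integral>t. indicator S t *\<^sub>R t \<partial>\<mu> x)"
    unfolding \<mu>_E[OF S] ennreal_indicator[symmetric] using S by (subst integral_density) auto
  then show ?thesis using form[OF D_E[OF S x]] by simp
qed

lemma form_split:
  assumes S: "S \<in> sets borel" and x: "x \<in> D"
  shows "cinner (A x) x = cinner (A (E S x)) (E S x) + cinner (A (E (- S) x)) (E (- S) x)"
proof -
  have S': "- S \<in> sets borel" using S by auto
  have i: "integrable (\<mu> x) (\<lambda>t. indicator T t * t)" if "T \<in> sets borel" for T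
    using integrable_mult_indicator[of T "\<mu> x" "\<lambda>t. t"] integrable_id[OF x] that by simp
  have "(\<integral>t. t \<partial>\<mu> x) = (\<integral>t. indicator S t * t + indicator (- S) t * t \<partial>\<mu> x)"
    by (intro Bochner_Integration.integral_cong) (auto simp: indicator_def)
  also have "\<dots> = (\<integral>t. indicator S t * t \<partial>\<mu> x) + (\<integral>t. indicator (- S) t * t \<partial>\<mu> x)"
    by (intro Bochner_Integration.integral_add i S S')
  finally show ?thesis using form[OF x] form_E[OF S x] form_E[OF S' x] by simp
qed

text \<open>The quadratic form splits over a set and its complement, so the cross terms of
  \<open>p + c *\<^sub>C r\<close> cancel for every \<open>c\<close>; the choices 1 and the
  imaginary unit kill both parts of the product.\<close>

lemma A_orthogonal:
  assumes S: "S \<in> sets borel" and p: "p \<in> D" "E S p = p" and r: "r \<in> D" "E S r = 0"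
  shows "cinner (A p) r = 0"
proof -
  have Re0: "Re (cinner (A p) (c *\<^sub>C r)) = 0" for c
  proof -
    let ?r = "c *\<^sub>C r"
    have rD: "?r \<in> D" and ES: "E S ?r = 0" using r D_scaleC by (simp_all add: E_scaleC[OF S])
    have 1: "E S (p + ?r) = p" using p ES by (simp add: blinfun.add_right)
    then have 2: "E (- S) (p + ?r) = ?r" by (simp add: E_Compl[OF S])
    have "cinner (A (p + ?r)) (p + ?r) = cinner (A p) p + cinner (A ?r) ?r"
      using form_split[OF S D_add[OF p(1) rD]] unfolding 1 2 .
    then have "cinner (A p) ?r + cinner (A ?r) p = 0"
      by (simp add: A_add[OF p(1) rD] cinner_add_left cinner_add_right add.commute)
    moreover have "cinner (A ?r) p = cnj (cinner (A p) ?r)"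
      using A_sym[OF rD p(1)] cinner_commute[of ?r "A p"] by simp
    ultimately show ?thesis by (simp add: complex_eq_iff)
  qed
  from Re0[of 1] Re0[of \<i>] show ?thesis by (simp add: cinner_scaleC_right complex_eq_iff)
qed

text \<open>The component of \<open>A p\<close> outside the range of \<open>E S\<close> is
  orthogonal to the dense domain \<open>D\<close>, by \<open>A_orthogonal\<close> applied to the
  part of each domain vector outside that range.\<close>

lemma A_invariant:
  assumes S: "S \<in> sets borel" and p: "p \<in> D" "E S p = p"
  shows "E S (A p) = A p"
proof -
  define y where "y = A p - E S (A p)"
  have Ey: "E S y = 0" by (simp add: y_def blinfun.diff_right E_idem[OF S])
  have "D \<subseteq> {r. cinner y r = 0}"
  proof
    fix r assume r: "r \<in> D"
    define q where "q = r - E S r"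
    have q: "q \<in> D" "E S q = 0"
      using D_diff[OF r D_E[OF S r]] by (auto simp: q_def blinfun.diff_right E_idem[OF S])
    have "cinner y (E S r) = 0" using E_adj[OF S, of y r] Ey by simp
    then have "cinner y r = cinner y q" by (simp add: q_def cinner_diff_right)
    also have "\<dots> = cinner (A p) q - cinner (A p) (E S q)"
      by (simp add: y_def cinner_diff_left E_adj[OF S])
    also have "\<dots> = 0" using A_orthogonal[OF S p q] q by simp
    finally show "r \<in> {r. cinner y r = 0}" by simp
  qed
  moreover have "closed {r. cinner y r = 0}"
    using closed_Collect_eq[OF linear_continuous_on[OF bounded_linear_cinner_right] continuous_on_const] .
  ultimately have "closure D \<subseteq> {r. cinner y r = 0}" by (rule closure_minimal)
  then have "cinner y y = 0" using dense by auto
  then show ?thesis by (simp add: cinner_self y_def)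
qed

text \<open>The scalar measure of \<open>p\<close> is concentrated on \<open>I\<close> with total
  mass \<open>(norm p)^2\<close>, and the form is the integral of \<open>t - c\<close> against
  it.\<close>

lemma A_local_form:
  assumes I: "I \<in> sets borel" and c: "\<And>t. t \<in> I \<Longrightarrow> \<bar>t - c\<bar> \<le> \<delta>" and p: "p \<in> D" "E I p = p"
  shows "\<bar>Re (cinner (A p - of_real c *\<^sub>C p) p)\<bar> \<le> \<delta> * (norm p)\<^sup>2"
proof -
  have "E (- I) p = 0" using E_Compl[OF I, of p] p(2) by simp
  then have "AE t in \<mu> p. t \<in> I"
    using I by (intro AE_I[where N = "- I"]) (auto simp: emeasure_\<mu>)
  then have ae: "AE t in \<mu> p. norm (t - c) \<le> \<delta>" by eventually_elim (simp add: c)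
  have i: "integrable (\<mu> p) (\<lambda>t. t - c)"
    by (intro Bochner_Integration.integrable_diff integrable_id p) simp
  have mp: "measure (\<mu> p) UNIV = (norm p)\<^sup>2" by (simp add: measure_\<mu> E_UNIV)
  have "Re (cinner (A p - of_real c *\<^sub>C p) p) = (\<integral>t. t \<partial>\<mu> p) - c * (norm p)\<^sup>2"
    by (simp add: cinner_diff_left cinner_scaleC_left form[OF p(1)] cinner_self)
  also have "\<dots> = (\<integral>t. t - c \<partial>\<mu> p)"
    using integrable_id[OF p(1)] mp by (subst Bochner_Integration.integral_diff) auto
  finally have "\<bar>Re (cinner (A p - of_real c *\<^sub>C p) p)\<bar> = norm (\<integral>t. t - c \<partial>\<mu> p)" by simp
  also have "\<dots> \<le> (\<integral>t. norm (t - c) \<partial>\<mu> p)" by (rule integral_norm_bound)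
  also have "\<dots> \<le> (\<integral>t. \<delta> \<partial>\<mu> p)"
    by (rule integral_mono_AE) (use i ae in \<open>auto intro: integrable_norm\<close>)
  also have "\<dots> = \<delta> * (norm p)\<^sup>2" using mp by simp
  finally show ?thesis .
qed

text \<open>A symmetric operator bounded in the form sense is bounded with the same constant, by polarization.\<close>

lemma A_local_bound:
  assumes I: "I \<in> sets borel" and c: "\<And>t. t \<in> I \<Longrightarrow> \<bar>t - c\<bar> \<le> \<delta>"
  shows "E I x \<in> D" and "norm (A (E I x) - of_real c *\<^sub>C E I x) \<le> \<delta> * norm (E I x)"
proof -
  have ID: "E I y \<in> D" for y
  proof (rule E_bounded_D[OF I])
    show "\<bar>t\<bar> \<le> \<delta> + \<bar>c\<bar>" if "t \<in> I" for t using c[OF that] by linarith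
  qed
  then show "E I x \<in> D" .
  define p where "p = E I x"
  have p: "p \<in> D" "E I p = p" using ID by (auto simp: p_def E_idem[OF I])
  define B where "B y = A y - of_real c *\<^sub>C y" for y
  have BV: "E I (B y) = B y" if "y \<in> D" "E I y = y" for y
    using A_invariant[OF I that] that by (simp add: B_def blinfun.diff_right E_scaleC[OF I])
  have B_add: "B (y + z) = B y + B z" and B_diff: "B (y - z) = B y - B z" if "y \<in> D" "z \<in> D" for y z
    using that scaleC_add_right[of "of_real c" "y - z" z]
    by (auto simp: B_def A_add A_diff scaleC_add_right algebra_simps)
  have B_sym: "cinner (B y) z = cinner y (B z)" if "y \<in> D" "z \<in> D" for y z
    using that by (simp add: B_def cinner_diff_left cinner_diff_right A_sym cinner_scaleC_left cinner_scaleC_right)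
  show "norm (A (E I x) - of_real c *\<^sub>C E I x) \<le> \<delta> * norm (E I x)"
  proof (cases "B p = 0")
    case True
    have "0 \<le> \<delta> * (norm p)\<^sup>2" using A_local_form[OF I c p] by linarith
    then have "0 \<le> \<delta> * norm p" by (cases "norm p = 0") (auto simp: zero_le_mult_iff)
    then show ?thesis using True by (simp add: B_def p_def)
  next
    case False
    \<comment> \<open>Scales \<open>B p\<close> to the norm of \<open>p\<close>: with equal norms
      the parallelogram identity in the polarization yields the constant \<open>\<delta>\<close>
      without loss.\<close>
    define l where "l = norm p / norm (B p)"
    define r where "r = of_real l *\<^sub>C B p"
    have nr: "norm r = norm p" using False by (simp add: r_def norm_scaleC l_def norm_divide)
    have rE: "E I r = r" by (simp add: r_def E_scaleC[OF I] BV[OF p])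
    then have rD: "r \<in> D" using ID[of r] by simp
    have sum: "p + r \<in> D" "E I (p + r) = p + r" and dif: "p - r \<in> D" "E I (p - r) = p - r"
      using p rD rE D_add D_diff by (auto simp: blinfun.add_right blinfun.diff_right)
    have "cinner (B r) p = cnj (cinner (B p) r)" using B_sym[OF rD p(1)] cinner_commute[of r "B p"] by simp
    then have "4 * Re (cinner (B p) r) = Re (cinner (B (p + r)) (p + r)) - Re (cinner (B (p - r)) (p - r))"
      by (simp add: B_add B_diff p rD cinner_add_left cinner_add_right cinner_diff_left cinner_diff_right)
    also have "\<dots> \<le> \<delta> * (norm (p + r))\<^sup>2 + \<delta> * (norm (p - r))\<^sup>2"
      using A_local_form[OF I c sum] A_local_form[OF I c dif] unfolding B_def[symmetric] by linarith
    also have "\<dots> = \<delta> * ((norm (p + r))\<^sup>2 + (norm (p - r))\<^sup>2)" by (simp add: distrib_left)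
    also have "(norm (p + r))\<^sup>2 + (norm (p - r))\<^sup>2 = 2 * (norm p)\<^sup>2 + 2 * (norm r)\<^sup>2"
      by (simp add: power2_norm_eq_inner inner_add_left inner_add_right inner_diff_left inner_diff_right inner_commute)
    also have "\<delta> * \<dots> = 4 * (\<delta> * (norm p)\<^sup>2)" by (simp add: nr)
    finally have "Re (cinner (B p) r) \<le> \<delta> * (norm p)\<^sup>2" by simp
    moreover have "Re (cinner (B p) r) = norm p * norm (B p)"
      using False by (simp add: r_def cinner_scaleC_right cinner_self l_def power2_eq_square)
    ultimately have "norm p * norm (B p) \<le> norm p * (\<delta> * norm p)" by (simp add: power2_eq_square mult_ac)
    moreover have "norm p \<noteq> 0"
    proof
      assume "norm p = 0"
      then have "p = 0" by simp
      then have "B p = 0" using A_scaleC[OF p(1), of 0] scaleR_scaleC[of 0 p] scaleR_scaleC[of 0 "A p"] by (simp add: B_def)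
      with False show False by simp
    qed
    ultimately show ?thesis by (simp add: B_def p_def mult_le_cancel_left)
  qed
qed

lemma resolvent:
  assumes "z \<notin> spectrum D A"
  shows "is_resolvent D A z (resolvent D A z)"
proof -
  obtain R where R: "is_resolvent D A z R" using assms by (auto simp: spectrum_def)
  show ?thesis
    unfolding resolvent_def
  proof (rule theI[of "is_resolvent D A z", OF R])
    fix R' assume R': "is_resolvent D A z R'"
    show "R' = R"
    proof (rule blinfun_eqI)
      fix x
      have "R x \<in> D" "z *\<^sub>C R x - A (R x) = x" using R by (auto simp: is_resolvent_def)
      then show "R' x = R x" using R' by (metis is_resolvent_def)
    qed
  qed
qed

lemma resolvent_scaleC:
  assumes "is_resolvent D A z R"
  shows "R (c *\<^sub>C x) = c *\<^sub>C R x"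
proof -
  have y: "R x \<in> D" "z *\<^sub>C R x - A (R x) = x" using assms by (auto simp: is_resolvent_def)
  have "z *\<^sub>C c *\<^sub>C R x - A (c *\<^sub>C R x) = c *\<^sub>C (z *\<^sub>C R x - A (R x))"
    by (simp add: scaleC_diff_right A_scaleC[OF y(1)] scaleC_scaleC mult.commute)
  then show ?thesis using assms D_scaleC[OF y(1), of c] y(2) by (metis is_resolvent_def)
qed

text \<open>On the range of \<open>E I\<close> the operator is \<open>c\<close> up to
  \<open>\<delta>\<close>, so its resolvent is nearly \<open>1 / (z - c)\<close>. The error contains
  both the length of \<open>I\<close> and the norm of \<open>E I x\<close>; for shrinking intervals
  it is therefore of smaller order than the length.\<close>

lemma resolvent_local:
  assumes R: "is_resolvent D A z R" and z: "z \<noteq> of_real c"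
    and I: "I \<in> sets borel" and c: "\<And>t. t \<in> I \<Longrightarrow> \<bar>t - c\<bar> \<le> \<delta>"
  shows "norm (R (E I x) - (1 / (z - of_real c)) *\<^sub>C E I x) \<le> norm R * \<delta> / cmod (z - of_real c) * norm (E I x)"
proof -
  define p where "p = E I x"
  define q where "q = A p - of_real c *\<^sub>C p"
  have p: "p \<in> D" and q: "norm q \<le> \<delta> * norm p" using A_local_bound[OF I c] by (auto simp: p_def q_def)
  let ?w = "z - of_real c"
  have "?w *\<^sub>C p = z *\<^sub>C p - of_real c *\<^sub>C p"
    using scaleC_add_left[of ?w "of_real c" p] by simp
  then have "z *\<^sub>C p - A p = ?w *\<^sub>C p - q" by (simp add: q_def)
  then have "p = R (?w *\<^sub>C p - q)" using R p by (metis is_resolvent_def)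
  then have 1: "?w *\<^sub>C R p = p + R q" by (simp add: blinfun.diff_right resolvent_scaleC[OF R] algebra_simps)
  have w: "?w \<noteq> 0" using z by simp
  have "R p = (1 / ?w) *\<^sub>C ?w *\<^sub>C R p" using w by (simp add: scaleC_scaleC)
  then have "R p - (1 / ?w) *\<^sub>C p = (1 / ?w) *\<^sub>C R q" unfolding 1 by (simp add: scaleC_add_right)
  then have "norm (R p - (1 / ?w) *\<^sub>C p) = norm (R q) / cmod ?w" by (simp add: norm_scaleC norm_divide)
  also have "\<dots> \<le> (norm R * (\<delta> * norm p)) / cmod ?w"
    by (intro divide_right_mono order_trans[OF norm_blinfun] mult_left_mono q) auto
  finally show ?thesis by (simp add: p_def mult_ac)
qed

text \<open>Near a regular point \<open>t\<close>, on the spectral subspace of a short interval,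
  \<open>t - A\<close> is nearly zero and yet bounded below, so the subspace is trivial. Countably
  many such intervals cover everything below \<open>a\<close>, and their union is null.\<close>

lemma E_below_spectrum:
  assumes spec: "\<And>t. t < a \<Longrightarrow> of_real t \<notin> spectrum D A"
  shows "E {..<a} x = 0"
proof -
  define \<F> where "\<F> = {U. open U \<and> E U x = 0}"
  have "\<exists>U\<in>\<F>. t \<in> U" if t: "t < a" for t
  proof -
    obtain R where R: "is_resolvent D A (of_real t) R" using spec[OF t] by (auto simp: spectrum_def)
    \<comment> \<open>Makes \<open>norm R * \<delta>\<close> at most \<open>1 / 2\<close>; the
      summand 1 keeps the denominator positive.\<close>
    define \<delta> where "\<delta> = 1 / (2 * (norm R + 1))"
    have \<delta>: "0 < \<delta>" by (simp add: \<delta>_def add_nonneg_pos)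
    define p where "p = E (ball t \<delta>) x"
    have p: "p \<in> D" "norm (A p - of_real t *\<^sub>C p) \<le> \<delta> * norm p"
      using A_local_bound[of "ball t \<delta>" t \<delta> x] by (auto simp: p_def dist_real_def)
    have "norm p = norm (R (of_real t *\<^sub>C p - A p))" using R p(1) by (simp add: is_resolvent_def)
    also have "\<dots> \<le> norm R * norm (of_real t *\<^sub>C p - A p)" by (rule norm_blinfun)
    also have "\<dots> \<le> norm R * (\<delta> * norm p)" using p(2) by (intro mult_left_mono) (auto simp: norm_minus_commute)
    also have "\<dots> = (norm R * \<delta>) * norm p" by simp
    also have "norm R * \<delta> \<le> 1 / 2" by (simp add: \<delta>_def divide_simps add_nonneg_pos)
    then have "(norm R * \<delta>) * norm p \<le> 1 / 2 * norm p" by (rule mult_right_mono) simp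
    finally have "p = 0" by simp
    then have "ball t \<delta> \<in> \<F>" by (simp add: \<F>_def p_def)
    then show ?thesis using \<delta> by (intro bexI[of _ "ball t \<delta>"]) auto
  qed
  then have cover: "{..<a} \<subseteq> \<Union>\<F>" by auto
  obtain \<F>' where F': "\<F>' \<subseteq> \<F>" "countable \<F>'" "\<Union>\<F>' = \<Union>\<F>"
    using Lindelof[of \<F>] by (auto simp: \<F>_def)
  have "U \<in> null_sets (\<mu> x)" if "U \<in> \<F>'" for U
    using that F'(1) by (auto simp: \<F>_def null_sets_def emeasure_\<mu>)
  then have "(\<Union>U\<in>\<F>'. U) \<in> null_sets (\<mu> x)" by (rule null_sets_UN'[OF F'(2)])
  then have "{..<a} \<in> null_sets (\<mu> x)"
    using cover F'(3) null_sets_subset[of _ "\<mu> x" "{..<a}"] by auto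
  then show ?thesis by (auto simp: null_sets_def emeasure_\<mu>)
qed

end

section \<open>Differentiating the resolvent along the spectral family\<close>

context spectral_operator
begin

context
  fixes \<alpha> :: real
begin

lemma E_increment:
  assumes "\<alpha> \<le> x" "x \<le> y"
  shows "E {\<alpha>..<y} v = E {\<alpha>..<x} v + E {x..<y} v"
    and "(norm (E {\<alpha>..<y} v))\<^sup>2 = (norm (E {\<alpha>..<x} v))\<^sup>2 + (norm (E {x..<y} v))\<^sup>2"
proof -
  have "{\<alpha>..<x} \<union> {x..<y} = {\<alpha>..<y}" using assms by auto
  then show 1: "E {\<alpha>..<y} v = E {\<alpha>..<x} v + E {x..<y} v"
    using E_Un[of "{\<alpha>..<x}" "{x..<y}" v] by auto
  have "complex_of_real ((norm (E {\<alpha>..<y} v))\<^sup>2) = of_real ((norm (E {\<alpha>..<x} v))\<^sup>2 + (norm (E {x..<y} v))\<^sup>2)"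
    using norm_E[of "{\<alpha>..<y}" v] norm_E[of "{\<alpha>..<x}" v] norm_E[of "{x..<y}" v]
    by (simp add: 1 cinner_add_left)
  then show "(norm (E {\<alpha>..<y} v))\<^sup>2 = (norm (E {\<alpha>..<x} v))\<^sup>2 + (norm (E {x..<y} v))\<^sup>2"
    by (simp only: of_real_eq_iff)
qed

text \<open>The square root is the norm of \<open>E {x..<y} v\<close>, by orthogonality of
  increments. In this form continuity of a single scalar function of the end point controls
  it.\<close>

lemma resolvent_increment:
  assumes R: "is_resolvent D A z R" and z: "z \<noteq> of_real c"
    and xy: "\<alpha> \<le> x" "x \<le> y" "x \<le> c" "c \<le> y"
  shows "cmod (cinner (R (E {\<alpha>..<y} v)) w - cinner (R (E {\<alpha>..<x} v)) w
      - (cinner (E {\<alpha>..<y} v) w - cinner (E {\<alpha>..<x} v) w) / (z - of_real c))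
    \<le> norm R * (y - x) / cmod (z - of_real c) * sqrt ((norm (E {\<alpha>..<y} v))\<^sup>2 - (norm (E {\<alpha>..<x} v))\<^sup>2) * norm w"
proof -
  let ?p = "E {x..<y} v"
  have "cinner (R (E {\<alpha>..<y} v)) w - cinner (R (E {\<alpha>..<x} v)) w
      - (cinner (E {\<alpha>..<y} v) w - cinner (E {\<alpha>..<x} v) w) / (z - of_real c)
      = cinner (R ?p - (1 / (z - of_real c)) *\<^sub>C ?p) w"
    by (simp add: E_increment(1)[OF xy(1,2), of v] blinfun.add_right cinner_add_left cinner_diff_left cinner_scaleC_left)
  also have "cmod \<dots> \<le> norm (R ?p - (1 / (z - of_real c)) *\<^sub>C ?p) * norm w"
    by (rule cinner_norm_le)
  also have "\<dots> \<le> norm R * (y - x) / cmod (z - of_real c) * norm ?p * norm w"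
    by (intro mult_right_mono resolvent_local[OF R z]) (use xy in auto)
  also have "norm ?p = sqrt ((norm (E {\<alpha>..<y} v))\<^sup>2 - (norm (E {\<alpha>..<x} v))\<^sup>2)"
    by (simp add: E_increment(2)[OF xy(1,2), of v])
  finally show ?thesis .
qed

text \<open>Between \<open>s\<close> and \<open>y\<close> the increment of the resolvent element
  differs from \<open>1 / (z - s)\<close> times that of the spectral function by a constant times
  \<open>\<bar>y - s\<bar>\<close> times the square root of an increment of the continuous function
  in the last hypothesis. This is of smaller order than \<open>y - s\<close>.\<close>

lemma resolvent_derivative:
  assumes R: "is_resolvent D A z R" and z: "z \<noteq> of_real s" and s: "\<alpha> < s"
    and m: "((\<lambda>s. cinner (E {\<alpha>..<s} v) w) has_vector_derivative m') (at s)"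
    and n: "isCont (\<lambda>s. (norm (E {\<alpha>..<s} v))\<^sup>2) s"
  shows "((\<lambda>s. cinner (R (E {\<alpha>..<s} v)) w) has_vector_derivative m' / (z - of_real s)) (at s)"
proof -
  define m where "m y = cinner (E {\<alpha>..<y} v) w" for y
  define \<rho> where "\<rho> y = cinner (R (E {\<alpha>..<y} v)) w" for y
  define n where "n y = (norm (E {\<alpha>..<y} v))\<^sup>2" for y
  let ?z = "z - of_real s"
  have z0: "?z \<noteq> 0" using z by simp
  define q where "q y = norm (m y - m s - (y - s) *\<^sub>R m') / norm (y - s)" for y
  have q: "(q \<longlongrightarrow> 0) (at s)"
    using m unfolding has_vector_derivative_def has_derivative_iff_norm q_def m_def by simp
  define K where "K = norm R / cmod ?z * norm w"
  have "((\<lambda>y. K * sqrt \<bar>n y - n s\<bar> + q y / cmod ?z) \<longlongrightarrow> K * sqrt \<bar>n s - n s\<bar> + 0 / cmod ?z) (at s)"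
    by (intro tendsto_intros q) (use assms(5) z0 in \<open>auto simp: isCont_def n_def\<close>)
  then have lim: "((\<lambda>y. K * sqrt \<bar>n y - n s\<bar> + q y / cmod ?z) \<longlongrightarrow> 0) (at s)" by simp
  have inc: "cmod (\<rho> y - \<rho> s - (m y - m s) / ?z) \<le> K * \<bar>y - s\<bar> * sqrt \<bar>n y - n s\<bar>" if y: "\<alpha> < y" for y
  proof (cases "s \<le> y")
    case True
    have "0 \<le> n y - n s" using E_increment(2)[of s y v] True s by (simp add: n_def)
    then show ?thesis
      using resolvent_increment[OF R z, of s y v w] True s
      by (simp add: K_def m_def \<rho>_def n_def mult_ac)
  next
    case False
    have "0 \<le> n s - n y" using E_increment(2)[of y s v] False y by (simp add: n_def)
    then have ab: "\<bar>y - s\<bar> = s - y" "\<bar>n y - n s\<bar> = n s - n y" using False by simp_all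
    have eqn: "\<rho> y - \<rho> s - (m y - m s) / ?z = - (\<rho> s - \<rho> y - (m s - m y) / ?z)"
      by (simp add: diff_divide_distrib)
    have "cmod (\<rho> s - \<rho> y - (m s - m y) / ?z) \<le> norm R * (s - y) / cmod ?z * sqrt (n s - n y) * norm w"
      using resolvent_increment[OF R z, of y s v w] False y unfolding \<rho>_def m_def n_def by simp
    then show ?thesis unfolding eqn norm_minus_cancel ab by (simp add: K_def mult_ac)
  qed
  have "((\<lambda>y. norm (\<rho> y - \<rho> s - (y - s) *\<^sub>R (m' / ?z)) / norm (y - s)) \<longlongrightarrow> 0) (at s)"
  proof (rule Lim_null_comparison[OF _ lim])
    have "\<forall>\<^sub>F y in at s. y \<in> {\<alpha><..}" by (rule eventually_at_in_open') (use s in auto)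
    moreover have "\<forall>\<^sub>F y in at s. y \<noteq> s" by (simp add: eventually_at_filter)
    ultimately show "\<forall>\<^sub>F y in at s. norm (norm (\<rho> y - \<rho> s - (y - s) *\<^sub>R (m' / ?z)) / norm (y - s)) \<le> K * sqrt \<bar>n y - n s\<bar> + q y / cmod ?z"
    proof eventually_elim
      case (elim y)
      have "\<rho> y - \<rho> s - (y - s) *\<^sub>R (m' / ?z) = (\<rho> y - \<rho> s - (m y - m s) / ?z) + (m y - m s - (y - s) *\<^sub>R m') / ?z"
        by (simp add: diff_divide_distrib scaleR_conv_of_real)
      also have "cmod \<dots> \<le> K * \<bar>y - s\<bar> * sqrt \<bar>n y - n s\<bar> + cmod ((m y - m s - (y - s) *\<^sub>R m') / ?z)"
        using inc[of y] elim by (intro order_trans[OF norm_triangle_ineq] add_right_mono) simp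
      also have "cmod ((m y - m s - (y - s) *\<^sub>R m') / ?z) = q y * \<bar>y - s\<bar> / cmod ?z"
        using elim by (simp add: q_def norm_divide)
      finally have "norm (\<rho> y - \<rho> s - (y - s) *\<^sub>R (m' / ?z)) \<le> (K * sqrt \<bar>n y - n s\<bar> + q y / cmod ?z) * \<bar>y - s\<bar>"
        by (simp add: algebra_simps)
      then show ?case using elim by (simp add: divide_le_eq)
    qed
  qed
  then have "((\<lambda>s. \<rho> s) has_vector_derivative m' / ?z) (at s)"
    unfolding has_vector_derivative_def has_derivative_iff_norm by (simp add: bounded_linear_scaleR_left)
  then show ?thesis by (simp add: \<rho>_def[abs_def])
qed

end

end

section \<open>Stieltjes representation of the resolvent\<close>

text \<open>To be used with \<open>\<iota>\<close> the operator \<open>B01\<close> and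
  \<open>\<kappa> x y s\<close> a matrix element of \<open>KB'\<close> at \<open>s\<close>; moving
  \<open>B10\<close> to the other side of the inner product leaves a statement about
  \<open>E\<close> alone.\<close>

locale spectral_density = spectral_operator E D A
  for E :: "real set \<Rightarrow> 'a::complex_hilbert_space \<Rightarrow>\<^sub>L 'a" and D A +
  fixes \<alpha> :: real and \<iota> :: "'b \<Rightarrow> 'a" and \<kappa> :: "'b \<Rightarrow> 'b \<Rightarrow> real \<Rightarrow> complex"
  assumes spectrum: "spectrum D A = of_real ` {\<alpha>..}"
    and abs_cont: "purely_absolutely_continuous E"
    and density: "\<And>x y s. \<alpha> < s \<Longrightarrow> ((\<lambda>s. cinner (E {\<alpha>..<s} (\<iota> x)) (\<iota> y)) has_vector_derivative \<kappa> x y s) (at s)"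
    and cont: "\<And>x y. continuous_on {\<alpha><..} (\<kappa> x y)"
begin

lemma E_singleton: "E {t} x = 0"
proof -
  have "{t} \<in> null_sets (\<mu> x)"
    using abs_cont finite_imp_null_set_lborel[OF finite.insertI[OF finite.emptyI], of t]
    unfolding purely_absolutely_continuous_def absolutely_continuous_def by blast
  then show ?thesis by (auto simp: null_sets_def emeasure_\<mu>)
qed

lemma E_below: "E {..<\<alpha>} x = 0"
  by (rule E_below_spectrum) (auto simp: spectrum)

lemma norm_derivative:
  assumes "\<alpha> < s"
  shows "((\<lambda>s. (norm (E {\<alpha>..<s} (\<iota> x)))\<^sup>2) has_real_derivative Re (\<kappa> x x s)) (at s)"
proof -
  have "((\<lambda>s. Re (cinner (E {\<alpha>..<s} (\<iota> x)) (\<iota> x))) has_vector_derivative Re (\<kappa> x x s)) (at s)"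
    by (rule bounded_linear.has_vector_derivative[OF bounded_linear_Re density[OF assms]])
  then show ?thesis by (simp add: norm_E has_real_derivative_iff_has_vector_derivative)
qed

text \<open>Cauchy-Schwarz on each spectral increment and the inequality of arithmetic and geometric
  means make \<open>(n x t + n y t) / 2 - m t\<close> increasing in \<open>t\<close>; the claim is
  the sign of its derivative.\<close>

lemma density_bound:
  assumes s: "\<alpha> < s"
  shows "cmod (\<kappa> x y s) \<le> (Re (\<kappa> x x s) + Re (\<kappa> y y s)) / 2"
proof -
  \<comment> \<open>A unimodular factor turning \<open>\<kappa> x y s\<close> into its
    modulus.\<close>
  define u where "u = (if \<kappa> x y s = 0 then 1 else cnj (\<kappa> x y s) / of_real (cmod (\<kappa> x y s)))"
  have u: "cmod u = 1" "u * \<kappa> x y s = of_real (cmod (\<kappa> x y s))"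
    by (auto simp: u_def norm_divide complex_norm_square[symmetric] power2_eq_square mult.commute[of "cnj _"])
  define n where "n x t = (norm (E {\<alpha>..<t} (\<iota> x)))\<^sup>2" for x t
  define m where "m t = Re (u * cinner (E {\<alpha>..<t} (\<iota> x)) (\<iota> y))" for t
  have md: "(m has_real_derivative cmod (\<kappa> x y s)) (at s)"
  proof -
    have "(m has_vector_derivative Re (u * \<kappa> x y s)) (at s)"
      unfolding m_def[abs_def]
      by (intro bounded_linear.has_vector_derivative[OF bounded_linear_Re] has_vector_derivative_mult_right density s)
    then show ?thesis by (simp add: u(2) has_real_derivative_iff_has_vector_derivative)
  qed
  have "mono_on {\<alpha><..} (\<lambda>t. (n x t + n y t) / 2 - m t)"
  proof (rule mono_onI)
    fix a b assume ab: "a \<in> {\<alpha><..}" "b \<in> {\<alpha><..}" "a \<le> b"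
    let ?p = "E {a..<b} (\<iota> x)" and ?q = "E {a..<b} (\<iota> y)"
    have "n x b - n x a = (norm ?p)\<^sup>2" "n y b - n y a = (norm ?q)\<^sup>2"
      using E_increment(2)[of \<alpha> a b] ab by (auto simp: n_def)
    moreover have "m b - m a = Re (u * cinner ?p ?q)"
    proof -
      have "cinner ?p (\<iota> y) = cinner ?p ?q" by (metis E_adj E_idem atLeastLessThan_borel)
      then show ?thesis using E_increment(1)[of \<alpha> a b "\<iota> x"] ab by (simp add: m_def cinner_add_left distrib_left)
    qed
    moreover have "Re (u * cinner ?p ?q) \<le> norm ?p * norm ?q"
      using complex_Re_le_cmod[of "u * cinner ?p ?q"] cinner_norm_le[of ?p ?q] u(1) by (simp add: norm_mult)
    moreover have "norm ?p * norm ?q \<le> ((norm ?p)\<^sup>2 + (norm ?q)\<^sup>2) / 2"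
      using sum_squares_bound[of "norm ?p" "norm ?q"] by simp
    ultimately show "(n x a + n y a) / 2 - m a \<le> (n x b + n y b) / 2 - m b" by argo
  qed
  moreover have "((\<lambda>t. (n x t + n y t) / 2 - m t) has_real_derivative (Re (\<kappa> x x s) + Re (\<kappa> y y s)) / 2 - cmod (\<kappa> x y s)) (at s)"
    using norm_derivative[OF s, of x] norm_derivative[OF s, of y]
    by (intro DERIV_diff[OF DERIV_cdivide[OF DERIV_add] md]) (simp_all add: n_def)
  ultimately have "0 \<le> (Re (\<kappa> x x s) + Re (\<kappa> y y s)) / 2 - cmod (\<kappa> x y s)"
    by (rule mono_on_imp_deriv_nonneg) (use s in \<open>simp add: interior_open\<close>)
  then show ?thesis by simp
qed

lemma diagonal_density_nonneg:
  assumes "\<alpha> < s"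
  shows "0 \<le> Re (\<kappa> x x s)"
  using order_trans[OF norm_ge_zero density_bound[OF assms, of x x]] by simp

lemma E_norm_le: "(norm (E {\<alpha>..<s} v))\<^sup>2 \<le> (norm v)\<^sup>2"
  using \<mu>.finite_measure_mono[of "{\<alpha>..<s}" UNIV v] by (simp add: measure_\<mu> E_UNIV)

lemma cont_shift: "continuous_on {0<..} (\<lambda>s. \<kappa> x y (\<alpha> + s))"
  by (rule continuous_on_compose2[OF cont]) (auto intro!: continuous_intros)

text \<open>The truncated integrals are increments of a squared norm bounded by
  \<open>(norm (\<iota> x))^2\<close>, and the integrand is nonnegative. Truncation also at the
  lower end avoids \<alpha>, where no derivative is given.\<close>

lemma diagonal_density_integrable: "(\<lambda>s. Re (\<kappa> x x (\<alpha> + s))) integrable_on {0<..}"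
proof -
  define J where "J n = {1 / real (Suc n)..real (Suc n)}" for n
  define f where "f n s = (if s \<in> J n then Re (\<kappa> x x (\<alpha> + s)) else 0)" for n s
  have Jsub: "J n \<subseteq> {0<..}" for n by (auto simp: J_def intro: less_le_trans[rotated])
  have J_int: "((\<lambda>s. Re (\<kappa> x x (\<alpha> + s))) has_integral
      (norm (E {\<alpha>..<\<alpha> + real (Suc n)} (\<iota> x)))\<^sup>2 - (norm (E {\<alpha>..<\<alpha> + 1 / real (Suc n)} (\<iota> x)))\<^sup>2) (J n)" for n
    unfolding J_def
  proof (rule fundamental_theorem_of_calculus)
    show "1 / real (Suc n) \<le> real (Suc n)" by (simp add: divide_le_eq) (simp add: algebra_simps)
    fix s assume "s \<in> {1 / real (Suc n)..real (Suc n)}"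
    then have "0 < s" using Jsub[of n] by (auto simp: J_def)
    then have "((\<lambda>s. (norm (E {\<alpha>..<\<alpha> + s} (\<iota> x)))\<^sup>2) has_real_derivative Re (\<kappa> x x (\<alpha> + s))) (at s)"
      using norm_derivative[of "\<alpha> + s" x] DERIV_shift[of "\<lambda>s. (norm (E {\<alpha>..<s} (\<iota> x)))\<^sup>2" _ s \<alpha>]
      by (simp add: add.commute)
    then show "((\<lambda>s. (norm (E {\<alpha>..<\<alpha> + s} (\<iota> x)))\<^sup>2) has_vector_derivative Re (\<kappa> x x (\<alpha> + s)))
        (at s within {1 / real (Suc n)..real (Suc n)})"
      by (simp add: has_real_derivative_iff_has_vector_derivative has_vector_derivative_at_within)
  qed
  have f_int: "(f n has_integral
      (norm (E {\<alpha>..<\<alpha> + real (Suc n)} (\<iota> x)))\<^sup>2 - (norm (E {\<alpha>..<\<alpha> + 1 / real (Suc n)} (\<iota> x)))\<^sup>2) {0<..}" for n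
    unfolding f_def using J_int[of n] Jsub[of n] by (simp add: has_integral_restrict)
  have "(\<lambda>s. Re (\<kappa> x x (\<alpha> + s))) integrable_on {0<..} \<and>
      (\<lambda>n. integral {0<..} (f n)) \<longlonglongrightarrow> integral {0<..} (\<lambda>s. Re (\<kappa> x x (\<alpha> + s)))"
  proof (rule monotone_convergence_increasing)
    show "f n integrable_on {0<..}" for n using f_int by blast
    fix s :: real assume "s \<in> {0<..}" then have s: "0 < s" by simp
    show "f n s \<le> f (Suc n) s" for n
    proof -
      have "J n \<subseteq> J (Suc n)" unfolding J_def by (auto simp: field_simps)
      then show ?thesis using diagonal_density_nonneg[of "\<alpha> + s" x] s by (auto simp: f_def)
    qed
    have "\<forall>\<^sub>F n in sequentially. 1 / real (Suc n) < s"
      using order_tendstoD(2)[OF LIMSEQ_inverse_real_of_nat, of s] s by (simp add: inverse_eq_divide)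
    moreover have "\<forall>\<^sub>F n in sequentially. s < real (Suc n)"
      using filterlim_compose[OF filterlim_real_sequentially filterlim_Suc] by (simp add: filterlim_at_top_dense)
    ultimately have "\<forall>\<^sub>F n in sequentially. f n s = Re (\<kappa> x x (\<alpha> + s))"
      by eventually_elim (simp add: f_def J_def)
    then show "(\<lambda>n. f n s) \<longlonglongrightarrow> Re (\<kappa> x x (\<alpha> + s))" by (rule tendsto_eventually)
  next
    show "bounded (range (\<lambda>n. integral {0<..} (f n)))"
    proof (rule boundedI)
      fix r assume "r \<in> range (\<lambda>n. integral {0<..} (f n))"
      then obtain n where r: "r = (norm (E {\<alpha>..<\<alpha> + real (Suc n)} (\<iota> x)))\<^sup>2 - (norm (E {\<alpha>..<\<alpha> + 1 / real (Suc n)} (\<iota> x)))\<^sup>2"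
        using integral_unique[OF f_int] by auto
      show "norm r \<le> (norm (\<iota> x))\<^sup>2"
        using E_norm_le[of "\<alpha> + real (Suc n)" "\<iota> x"] E_norm_le[of "\<alpha> + 1 / real (Suc n)" "\<iota> x"]
        unfolding r real_norm_def abs_le_iff using zero_le_power2 by (smt (verit))
    qed
  qed
  then show ?thesis by blast
qed

text \<open>Off-diagonal densities are dominated by diagonal ones, which are integrable even before
  the weight is applied. This supplies \<open>weight_real\<close> for the contour problem.\<close>

lemma weighted_density: "weighted_curve (\<lambda>s. of_real (\<alpha> + s)) (\<lambda>s. 1) (\<lambda>s. \<kappa> x y (\<alpha> + s))"
proof
  show "continuous_on {0<..} (\<lambda>s. complex_of_real (\<alpha> + s))" by (intro continuous_intros)
  show "continuous_on {0<..} (\<lambda>s. \<kappa> x y (\<alpha> + s))" by (rule cont_shift)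
  show "(\<lambda>s. cmod (\<kappa> x y (\<alpha> + s)) / (1 + cmod (complex_of_real (\<alpha> + s)))) integrable_on {0<..}"
  proof (rule continuous_dominated_integrable)
    have "1 + cmod t \<noteq> 0" for t using norm_ge_zero[of t] by linarith
    then show "continuous_on {0<..} (\<lambda>s. cmod (\<kappa> x y (\<alpha> + s)) / (1 + cmod (complex_of_real (\<alpha> + s))))"
      by (auto intro!: continuous_intros cont_shift simp del: of_real_add)
    show "(\<lambda>s. Re (\<kappa> x x (\<alpha> + s)) + Re (\<kappa> y y (\<alpha> + s))) integrable_on {0<..}"
      by (intro integrable_add diagonal_density_integrable)
    fix s :: real assume s: "0 < s"
    have "cmod (\<kappa> x y (\<alpha> + s)) / (1 + cmod (complex_of_real (\<alpha> + s))) \<le> cmod (\<kappa> x y (\<alpha> + s)) / 1"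
      by (intro divide_left_mono) (auto simp: add_nonneg_pos simp del: of_real_add)
    also have "\<dots> \<le> Re (\<kappa> x x (\<alpha> + s)) + Re (\<kappa> y y (\<alpha> + s))"
      using density_bound[of "\<alpha> + s" x y] diagonal_density_nonneg[of "\<alpha> + s" x] diagonal_density_nonneg[of "\<alpha> + s" y] s
      by simp
    finally have "cmod (\<kappa> x y (\<alpha> + s)) / (1 + cmod (complex_of_real (\<alpha> + s))) \<le> Re (\<kappa> x x (\<alpha> + s)) + Re (\<kappa> y y (\<alpha> + s))" .
    moreover have "0 \<le> cmod (\<kappa> x y (\<alpha> + s)) / (1 + cmod (complex_of_real (\<alpha> + s)))" by (intro divide_nonneg_nonneg) auto
    ultimately show "\<bar>cmod (\<kappa> x y (\<alpha> + s)) / (1 + cmod (complex_of_real (\<alpha> + s)))\<bar> \<le> Re (\<kappa> x x (\<alpha> + s)) + Re (\<kappa> y y (\<alpha> + s))"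
      by linarith
  qed
qed (auto intro: integrable_const_ivl)

text \<open>The intervals shrink to the point \<alpha>, which absolute continuity makes a null
  set.\<close>

lemma E_initial: "(\<lambda>n. E {\<alpha>..<\<alpha> + 1 / real (Suc n)} v) \<longlonglongrightarrow> 0"
proof (rule E_tendsto_0)
  show "decseq (\<lambda>n. {\<alpha>..<\<alpha> + 1 / real (Suc n)})"
    by (intro decseq_SucI) (auto simp: field_simps)
  have "(\<Inter>n. {\<alpha>..<\<alpha> + 1 / real (Suc n)}) = {\<alpha>}"
  proof (intro equalityI subsetI)
    fix t assume t: "t \<in> (\<Inter>n. {\<alpha>..<\<alpha> + 1 / real (Suc n)})"
    have "t - \<alpha> \<le> 0"
    proof (rule LIMSEQ_le_const[OF LIMSEQ_inverse_real_of_nat])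
      show "\<exists>N. \<forall>n\<ge>N. t - \<alpha> \<le> inverse (real (Suc n))"
      proof (intro exI[of _ 0] allI impI)
        show "t - \<alpha> \<le> inverse (real (Suc n))" for n
        proof -
          have "t \<in> {\<alpha>..<\<alpha> + 1 / real (Suc n)}" using t by blast
          then show ?thesis by (simp add: inverse_eq_divide)
        qed
      qed
    qed
    then show "t \<in> {\<alpha>}" using t by force
  qed auto
  then show "E (\<Inter>n. {\<alpha>..<\<alpha> + 1 / real (Suc n)}) v = 0" by (simp add: E_singleton)
qed auto

text \<open>The complements shrink to the part of the line below \<alpha>, where
  \<open>E_below\<close> applies.\<close>

lemma E_exhaust: "(\<lambda>n. E {\<alpha>..<\<alpha> + real (Suc n)} v) \<longlonglongrightarrow> v"
proof -
  have "(\<lambda>n. E (- {\<alpha>..<\<alpha> + real (Suc n)}) v) \<longlonglongrightarrow> 0"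
  proof (rule E_tendsto_0)
    show "decseq (\<lambda>n. - {\<alpha>..<\<alpha> + real (Suc n)})" by (intro decseq_SucI) auto
    have "(\<Inter>n. - {\<alpha>..<\<alpha> + real (Suc n)}) = {..<\<alpha>}"
    proof (intro equalityI subsetI)
      fix t assume t: "t \<in> (\<Inter>n. - {\<alpha>..<\<alpha> + real (Suc n)})"
      obtain n where "t - \<alpha> < real n" using reals_Archimedean2 by blast
      moreover have "t \<notin> {\<alpha>..<\<alpha> + real (Suc n)}" using t by blast
      ultimately show "t \<in> {..<\<alpha>}" by auto
    qed auto
    then show "E (\<Inter>n. - {\<alpha>..<\<alpha> + real (Suc n)}) v = 0" by (simp add: E_below)
  qed auto
  then have "(\<lambda>n. v - E (- {\<alpha>..<\<alpha> + real (Suc n)}) v) \<longlonglongrightarrow> v - 0" by (intro tendsto_intros)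
  then show ?thesis by (simp add: E_Compl)
qed

lemma dist_halfline:
  assumes "z \<notin> of_real ` {\<alpha>..}"
  obtains d where "0 < d" "\<And>s. 0 \<le> s \<Longrightarrow> d \<le> cmod (z - of_real (\<alpha> + s))"
proof (cases "Im z = 0")
  case True
  then have z: "z = of_real (Re z)" by (simp add: complex_eq_iff)
  then have "Re z < \<alpha>" using assms by (metis atLeast_iff image_eqI not_le)
  then have "\<alpha> - Re z \<le> cmod (z - of_real (\<alpha> + s))" if "0 \<le> s" for s
    using abs_Re_le_cmod[of "z - of_real (\<alpha> + s)"] that by simp
  then show thesis using \<open>Re z < \<alpha>\<close> by (intro that[of "\<alpha> - Re z"]) auto
next
  case False
  have "\<bar>Im z\<bar> \<le> cmod (z - of_real (\<alpha> + s))" for s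
    using abs_Im_le_cmod[of "z - of_real (\<alpha> + s)"] by simp
  then show thesis using False by (intro that[of "\<bar>Im z\<bar>"]) auto
qed

text \<open>The integrand is the derivative given by \<open>resolvent_derivative\<close>, so
  truncated integrals are differences of resolvent elements of spectrally truncated vectors;
  \<open>E_exhaust\<close> and \<open>E_initial\<close> identify the two limits.\<close>

lemma resolvent_stieltjes:
  assumes z: "z \<notin> of_real ` {\<alpha>..}"
  shows "weighted_curve.transform (\<lambda>s. of_real (\<alpha> + s)) (\<lambda>s. 1) (\<lambda>s. \<kappa> x y (\<alpha> + s)) z =
    cinner (resolvent D A z (\<iota> x)) (\<iota> y)"
proof -
  define R where "R = resolvent D A z"
  have R: "is_resolvent D A z R" unfolding R_def by (rule resolvent) (simp add: spectrum z)
  interpret weighted_curve "\<lambda>s. of_real (\<alpha> + s)" "\<lambda>s. 1" "\<lambda>s. \<kappa> x y (\<alpha> + s)" by (rule weighted_density)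
  define \<rho> where "\<rho> s = cinner (R (E {\<alpha>..<\<alpha> + s} (\<iota> x))) (\<iota> y)" for s
  obtain d where d: "0 < d" "\<And>s. 0 \<le> s \<Longrightarrow> d \<le> cmod (z - of_real (\<alpha> + s))" using dist_halfline[OF z] by blast
  let ?h = "\<lambda>s. 1 * (1 * (1 / (z - of_real (\<alpha> + s)) * \<kappa> x y (\<alpha> + s)))"
  have h: "(?h has_integral \<rho> (real (Suc n)) - \<rho> (1 / real (Suc n))) {1 / real (Suc n)..real (Suc n)}" for n
  proof (rule fundamental_theorem_of_calculus)
    show "1 / real (Suc n) \<le> real (Suc n)" by (simp add: divide_le_eq) (simp add: algebra_simps)
    fix s assume s: "s \<in> {1 / real (Suc n)..real (Suc n)}"
    have "0 < 1 / real (Suc n)" by simp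
    also have "\<dots> \<le> s" using s by simp
    finally have s0: "\<alpha> < \<alpha> + s" by simp
    have zs: "z \<noteq> of_real (\<alpha> + s)" using d(1) d(2)[of s] s0 by auto
    have "isCont (\<lambda>s. (norm (E {\<alpha>..<s} (\<iota> x)))\<^sup>2) (\<alpha> + s)" using norm_derivative[OF s0] by (rule DERIV_isCont)
    from resolvent_derivative[OF R zs s0 density[OF s0] this, of y]
    have "((\<lambda>s. cinner (R (E {\<alpha>..<s} (\<iota> x))) (\<iota> y)) has_vector_derivative \<kappa> x y (\<alpha> + s) / (z - of_real (\<alpha> + s))) (at (\<alpha> + s))" .
    moreover have "((\<lambda>s. \<alpha> + s) has_vector_derivative 1) (at s)" by (auto intro!: derivative_eq_intros)
    ultimately have "((\<lambda>s. cinner (R (E {\<alpha>..<s} (\<iota> x))) (\<iota> y)) \<circ> (\<lambda>s. \<alpha> + s) has_vector_derivative 1 *\<^sub>R (\<kappa> x y (\<alpha> + s) / (z - of_real (\<alpha> + s)))) (at s)"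
      by (intro vector_diff_chain_at)
    then show "(\<rho> has_vector_derivative ?h s) (at s within {1 / real (Suc n)..real (Suc n)})"
      by (simp add: o_def \<rho>_def[abs_def] has_vector_derivative_at_within)
  qed
  have "(\<lambda>n. integral {1 / real (Suc n)..real (Suc n)} ?h) \<longlonglongrightarrow> integral {0<..} ?h"
  proof (rule truncation_limit[OF d(1)])
    show "(\<lambda>n. 1 / real (Suc n)) \<longlonglongrightarrow> 0" using LIMSEQ_inverse_real_of_nat by (simp add: inverse_eq_divide)
    show "filterlim (\<lambda>n. real (Suc n)) at_top sequentially"
      by (rule filterlim_compose[OF filterlim_real_sequentially filterlim_Suc])
  qed (use d in auto)
  moreover have "integral {0<..} ?h = transform z" unfolding transform_def mult_1 ..
  ultimately have 1: "(\<lambda>n. \<rho> (real (Suc n)) - \<rho> (1 / real (Suc n))) \<longlonglongrightarrow> transform z"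
    by (simp only: integral_unique[OF h])
  have bl: "bounded_linear (\<lambda>v. cinner (R v) (\<iota> y))"
    by (rule bounded_linear_compose[OF bounded_linear_cinner_left blinfun.bounded_linear_right])
  have 2: "(\<lambda>n. \<rho> (real (Suc n)) - \<rho> (1 / real (Suc n))) \<longlonglongrightarrow> cinner (R (\<iota> x)) (\<iota> y) - cinner (R 0) (\<iota> y)"
    unfolding \<rho>_def by (intro tendsto_diff bounded_linear.tendsto[OF bl] E_initial E_exhaust)
  show ?thesis using LIMSEQ_unique[OF 1 2] by (simp add: R_def)
qed

end

section \<open>Continuation of the transfer function\<close>

context halfplane_contour
begin

lemma contour_integral_eq_transform:
  "integral {0<..} (\<lambda>s. vector_derivative \<gamma> (at s) * (1 / (z - \<gamma> s) * k (\<gamma> s))) = Gam.transform z"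
proof -
  obtain N where N: "negligible N" "\<And>s. 0 < s \<Longrightarrow> s \<notin> N \<Longrightarrow> speed s = vector_derivative \<gamma> (at s)"
    using speed_ae by metis
  show ?thesis
    unfolding Gam.transform_def by (rule integral_spike[OF N(1)]) (use N(2) in auto)
qed

text \<open>The open half-line lies in the closure of the lower half-plane and of \<open>G\<close>,
  so its union with either is connected, and the two unions share it. Openness at a real point is
  \<open>half_disc\<close>.\<close>

lemma crossing_domain_open_connected:
  "open (crossing_domain 1 \<alpha> G)" "connected (crossing_domain 1 \<alpha> G)"
proof -
  let ?L = "{z. Im z < 0}" and ?I = "complex_of_real ` {\<alpha><..}"
  have eq: "crossing_domain 1 \<alpha> G = ?L \<union> ?I \<union> G" by (simp add: crossing_domain_def)
  show "open (crossing_domain 1 \<alpha> G)"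
    unfolding open_contains_ball
  proof
    fix z assume "z \<in> crossing_domain 1 \<alpha> G"
    then consider "z \<in> ?L" | "z \<in> G" | t where "\<alpha> < t" "z = of_real t" unfolding eq by auto
    then show "\<exists>e>0. ball z e \<subseteq> crossing_domain 1 \<alpha> G"
    proof cases
      case 1
      then obtain e where "0 < e" "ball z e \<subseteq> ?L" using open_halfspace_Im_lt open_contains_ball by blast
      then show ?thesis unfolding eq by blast
    next
      case 2
      then obtain e where "0 < e" "ball z e \<subseteq> G" using G(1) open_contains_ball by blast
      then show ?thesis unfolding eq by blast
    next
      case 3
      obtain r where r: "0 < r" "r < t - \<alpha>" "{\<mu> \<in> ball (of_real t) r. 0 < Im \<mu>} \<subseteq> G"
        using half_disc[OF 3(1)] by blast
      have "ball z r \<subseteq> ?L \<union> ?I \<union> G"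
      proof
        fix \<mu> assume \<mu>: "\<mu> \<in> ball z r"
        have "\<bar>t - Re \<mu>\<bar> < r" using abs_Re_le_cmod[of "z - \<mu>"] \<mu> 3(2) by (simp add: dist_norm)
        then have Re: "\<alpha> < Re \<mu>" using r(2) by linarith
        have "\<mu> \<in> ?I" if "Im \<mu> = 0" using that Re by (intro rev_image_eqI[of "Re \<mu>"]) (auto simp: complex_eq_iff)
        moreover have "\<mu> \<in> G" if "0 < Im \<mu>" using r(3) \<mu> 3(2) that by blast
        ultimately show "\<mu> \<in> ?L \<union> ?I \<union> G"
          using linorder_less_linear[of "Im \<mu>" 0] by blast
      qed
      then show ?thesis using r(1) unfolding eq by blast
    qed
  qed
  have "connected (?L \<union> ?I)"
  proof (rule connected_intermediate_closure)
    show "connected ?L" by (rule convex_connected[OF convex_halfspace_Im_lt])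
    have cl: "closure ?L = {z. Im z \<le> 0}"
      using closure_halfspace_lt[of \<i> "0::real"] by (simp add: inner_complex_def)
    show "?L \<union> ?I \<subseteq> closure ?L" unfolding cl by auto
  qed auto
  moreover have "connected (?I \<union> G)"
  proof (rule connected_intermediate_closure[OF G(2)])
    show "?I \<union> G \<subseteq> closure G" using G_frontier closure_subset[of G] by (auto simp: frontier_def)
  qed auto
  moreover have "complex_of_real (\<alpha> + 1) \<in> ?I" by (intro imageI) simp
  then have "(?L \<union> ?I) \<inter> (?I \<union> G) \<noteq> {}" by blast
  ultimately have "connected ((?L \<union> ?I) \<union> (?I \<union> G))" by (rule connected_Un)
  then show "connected (crossing_domain 1 \<alpha> G)" unfolding eq by (simp add: Un_ac)
qed

text \<open>The density \<open>\<kappa>\<close> and the continued function \<open>k\<close> agree on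
  the half-line, so \<open>Del.transform\<close> is at once the transform compared with the contour
  and, by \<open>resolvent_stieltjes\<close>, a resolvent element.\<close>

lemma contour_transform:
  assumes "spectral_density E A_dom A_op \<alpha> \<iota> \<kappa>"
    and \<kappa>: "\<And>s. 0 < s \<Longrightarrow> \<kappa> x y (\<alpha> + s) = k (of_real (\<alpha> + s))"
  defines "T \<equiv> \<lambda>z. cinner (resolvent A_dom A_op z (\<iota> x)) (\<iota> y)"
    and "I \<equiv> \<lambda>z. integral {0<..} (\<lambda>s. vector_derivative \<gamma> (at s) * (1 / (z - \<gamma> s) * k (\<gamma> s)))"
  shows "Im z < 0 \<Longrightarrow> I z = T z" and "z \<in> G \<Longrightarrow> I z = T z + 2 * of_real pi * \<i> * k z"
proof -
  interpret spectral_density E A_dom A_op \<alpha> \<iota> \<kappa> by fact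
  have "weighted_curve.transform (\<lambda>s. of_real (\<alpha> + s)) (\<lambda>s. 1) (\<lambda>s. \<kappa> x y (\<alpha> + s)) z = Del.transform z" for z
    unfolding Del.transform_def weighted_curve.transform_def[OF weighted_density]
    by (rule integral_cong) (simp add: \<kappa> del: of_real_add)
  then have T: "Del.transform z = T z" if "Im z \<noteq> 0" for z
    using resolvent_stieltjes[of z x y] that unfolding T_def by force
  show "I z = T z" if "Im z < 0"
    using transform_lower_halfplane[OF that] T[of z] that
    unfolding I_def contour_integral_eq_transform by (metis less_irrefl)
  show "I z = T z + 2 * of_real pi * \<i> * k z" if "z \<in> G"
  proof -
    have "0 < Im z" using that G(3) D(3) by auto
    then show ?thesis using transform_in_G[OF that] T[of z]
      unfolding I_def contour_integral_eq_transform by (metis less_irrefl)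
  qed
qed

end

section \<open>Reflection in the real axis, and the passage from matrix elements to
  operators\<close>

lemma frontier_cnj: "frontier (cnj ` S) = cnj ` frontier S"
proof -
  have cl: "closure (cnj ` S) = cnj ` closure S" for S
    using closure_injective_linear_image[of cnj S] bounded_linear.linear[OF bounded_linear_cnj]
    by (simp add: inj_def)
  have "interior (cnj ` S) = cnj ` interior S"
    using interior_injective_linear_image[of cnj S] bounded_linear.linear[OF bounded_linear_cnj]
    by (simp add: inj_def)
  then show ?thesis unfolding frontier_def cl by (simp add: image_set_diff inj_def)
qed

text \<open>A single chord is already an inscribed polygon.\<close>

lemma arc_length_parametrized_lipschitz:
  assumes "arc_length_parametrized \<gamma>" "0 \<le> x" "0 \<le> y"
  shows "dist (\<gamma> x) (\<gamma> y) \<le> dist x y"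
proof -
  have le: "dist (\<gamma> a) (\<gamma> b) \<le> b - a" if ab: "0 \<le> a" "a \<le> b" for a b
  proof -
    let ?p = "\<lambda>i::nat. if i = 0 then a else b"
    have "ereal (\<Sum>i<1. dist (\<gamma> (?p i)) (\<gamma> (?p (Suc i)))) \<le> curve_length \<gamma> a b"
      unfolding curve_length_def
      by (rule SUP_upper2[where i = "(1, ?p)"]) (use ab in \<open>auto simp: mono_def\<close>)
    also have "\<dots> = ereal (b - a)" using assms(1) ab by (simp add: arc_length_parametrized_def)
    finally show ?thesis by simp
  qed
  show ?thesis
    using le[of x y] le[of y x] assms(2,3) by (cases "x \<le> y") (auto simp: dist_real_def dist_commute)
qed

lemma op_holomorphic_cinner:
  assumes "op_holomorphic_on F S" "open S"
  shows "(\<lambda>z. cinner (F z x) y) holomorphic_on S"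
  unfolding holomorphic_on_def
proof
  fix z assume z: "z \<in> S"
  then obtain L where L: "(F has_derivative (\<lambda>h. h *\<^sub>C L)) (at z within S)"
    using assms(1) by (auto simp: op_holomorphic_on_def)
  have bl: "bounded_linear (\<lambda>T. cinner (blinfun_apply T x) y)"
    by (rule bounded_linear_compose[OF bounded_linear_cinner_left blinfun.bounded_linear_left])
  have "((\<lambda>z. cinner (F z x) y) has_derivative (\<lambda>h. cinner ((h *\<^sub>C L) x) y)) (at z within S)"
    by (rule bounded_linear.has_derivative[OF bl L])
  then show "(\<lambda>z. cinner (F z x) y) field_differentiable at z within S"
    unfolding field_differentiable_def has_field_derivative_def
    by (auto simp: cinner_scaleC_left mult.commute[of _ "cinner _ _"] intro!: exI[of _ "cinner (L x) y"])
qed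

text \<open>Relates the resolvents at conjugate points, which carries the identities to the mirror
  image \<open>l = -1\<close>. Both vectors are written through their preimages, and symmetry of
  \<open>A\<close> does the rest.\<close>

lemma resolvent_adjoint:
  assumes A: "selfadjoint_operator D A" and R: "is_resolvent D A z R" and R': "is_resolvent D A (cnj z) R'"
  shows "cinner (R x) y = cinner x (R' y)"
proof -
  have u: "R x \<in> D" "z *\<^sub>C R x - A (R x) = x" and w: "R' y \<in> D" "cnj z *\<^sub>C R' y - A (R' y) = y"
    using R R' by (auto simp: is_resolvent_def)
  have "cinner (R x) (A (R' y)) = cinner (A (R x)) (R' y)"
    using A u w by (auto simp: selfadjoint_operator_def adjoint_operator_def)
  then have "cinner (R x) (cnj z *\<^sub>C R' y - A (R' y)) = cinner (z *\<^sub>C R x - A (R x)) (R' y)"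
    by (simp add: cinner_diff_left cinner_diff_right cinner_scaleC_left cinner_scaleC_right)
  then show ?thesis by (simp add: u w)
qed

theorem lemma1p1:
  fixes D0 :: "'h0::complex_hilbert_space set" and A0 :: "'h0 \<Rightarrow> 'h0"
    and E0 :: "real set \<Rightarrow> 'h0 \<Rightarrow>\<^sub>L 'h0" and A0_inv_sqrt :: "'h0 \<Rightarrow> 'h0"
    and A1 A1t :: "'h1::complex_hilbert_space \<Rightarrow>\<^sub>L 'h1"
    and D10 :: "'h0 set" and T10 :: "'h0 \<Rightarrow> 'h1"
    and D01 :: "'h1 set" and T01 :: "'h1 \<Rightarrow> 'h0"
    and B10 :: "'h0 \<Rightarrow>\<^sub>L 'h1" and B01 :: "'h1 \<Rightarrow>\<^sub>L 'h0"
    and \<alpha>0 g C :: real and l :: int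
    and Dp G :: "complex set"
    and KB' :: "complex \<Rightarrow> 'h1 \<Rightarrow>\<^sub>L 'h1"
    and \<gamma> :: "real \<Rightarrow> complex"
  assumes separable: "separable_space (euclidean :: 'h0 topology)"
                     "separable_space (euclidean :: 'h1 topology)"
    and \<alpha>0_pos: "0 < \<alpha>0"
    and A0_selfadjoint: "selfadjoint_operator D0 A0"
    and A0_spectrum: "spectrum D0 A0 = of_real ` {\<alpha>0..}"
    and E0_spectral_measure: "is_spectral_measure E0 D0 A0"
    and A0_abs_cont: "purely_absolutely_continuous E0"
    and A1_selfadjoint: "bounded_adjoint A1 A1"
    and T10_linear: "linear_operator D10 T10"
    and T_adjoint: "adjoint_operator D01 T01 D10 T10"
    and T10_domain: "spectral_integral_domain E0 sqrt \<subseteq> D10"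
    and A0_inv_sqrt: "is_spectral_integral E0 (\<lambda>t. 1 / sqrt t) UNIV A0_inv_sqrt"
    and B10: "\<And>x. B10 x = T10 (A0_inv_sqrt x)"
    and B01: "bounded_adjoint B10 B01"
    and A1t: "A1t = A1 - (B10 o\<^sub>L B01)"
    and A1t_spectrum: "spectrum UNIV A1t \<subseteq> of_real ` {\<alpha>0..}"
    and Dp_domain: "open Dp" "connected Dp" "simply_connected Dp"
    and Dp_upper: "Dp \<subseteq> {z. 0 < Im z}"
    and Dp_boundary: "of_real ` {\<alpha>0..} \<subseteq> frontier Dp"
    and KB_deriv: "\<And>\<mu>. \<alpha>0 < \<mu> \<Longrightarrow>
          (K_B B10 B01 E0 \<alpha>0 has_vector_derivative KB' (of_real \<mu>)) (at \<mu>)"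
    and KB'_holomorphic: "op_holomorphic_on KB' Dp"
    and KB'_continuous: "continuous_on (of_real ` {\<alpha>0<..} \<union> Dp) KB'"
    and KB'_reflection: "\<And>\<mu>. \<mu> \<in> Dp \<Longrightarrow> bounded_adjoint (KB' \<mu>) (KB' (cnj \<mu>))"
    and KB'_bound: "0 < C" "-1 < g" "g \<le> 0"
          "\<And>\<mu>. \<mu> \<in> Dp \<union> cnj ` Dp \<Longrightarrow> norm (KB' \<mu>) \<le> C * cmod (\<mu> - of_real \<alpha>0) powr g"
    and l: "l = 1 \<or> l = -1"
    and \<gamma>_contour: "contour_in (signed_domain Dp l) \<alpha>0 \<gamma>"
    and \<gamma>_K_B_bounded: "Var1 KB' \<gamma> < \<infinity>"
    and G_domain: "open G" "connected G" "G \<subseteq> signed_domain Dp l"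
    and G_boundary: "frontier G = of_real ` {\<alpha>0..} \<union> \<gamma> ` {0..}"
  shows "(\<forall>z \<in> crossing_domain l \<alpha>0 G. curve_integrand \<gamma> (V1_integrand KB' z) integrable_on {0..})
    \<and> analytic_continuation
          (transfer_function A1t B10 B01 D0 A0) {z. of_int l * Im z < 0}
          (M1_continued A1t KB' \<gamma>) (crossing_domain l \<alpha>0 G)
    \<and> (\<forall>z \<in> signed_domain Dp l \<inter> G.
          M1_continued A1t KB' \<gamma> z =
          transfer_function A1t B10 B01 D0 A0 z + (2 * of_real pi * \<i> * of_int l * z) *\<^sub>C KB' z)"
  proof -
  interpret act: normed_complex_action "(*\<^sub>C) :: complex \<Rightarrow> ('h1 \<Rightarrow>\<^sub>L 'h1) \<Rightarrow> _"
    by (rule normed_complex_action_blinfun)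
  have SO: "spectral_operator E0 D0 A0"
    using E0_spectral_measure A0_selfadjoint by unfold_locales (auto simp: is_spectral_measure_def)
  have ev: "bounded_linear (\<lambda>T :: 'h1 \<Rightarrow>\<^sub>L 'h1. cinner (blinfun_apply T x) y)" for x y
    by (rule bounded_linear_compose[OF bounded_linear_cinner_left blinfun.bounded_linear_left])
  define \<kappa> where "\<kappa> x y s = cinner (KB' (of_real s) x) y" for x y :: 'h1 and s :: real
  have SD: "spectral_density E0 D0 A0 \<alpha>0 (blinfun_apply B01) \<kappa>"
  proof (intro spectral_density.intro SO spectral_density_axioms.intro A0_spectrum A0_abs_cont)
    fix x y s assume s: "\<alpha>0 < s"
    have "cinner (K_B B10 B01 E0 \<alpha>0 t x) y = cinner (E0 {\<alpha>0..<t} (B01 x)) (B01 y)" for t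
      using B01 by (simp add: K_B_def bounded_adjoint_def)
    then show "((\<lambda>s. cinner (E0 {\<alpha>0..<s} (B01 x)) (B01 y)) has_vector_derivative \<kappa> x y s) (at s)"
      using bounded_linear.has_vector_derivative[OF ev KB_deriv[OF s], of x y] by (simp add: \<kappa>_def)
  next
    fix x y
    have "continuous_on {\<alpha>0<..} (\<lambda>s. KB' (of_real s))"
      by (rule continuous_on_compose2[OF KB'_continuous]) (auto intro!: continuous_intros)
    then show "continuous_on {\<alpha>0<..} (\<kappa> x y)"
      unfolding \<kappa>_def[abs_def] by (rule bounded_linear.continuous_on[OF ev])
  qed
  have \<gamma>: "continuous_on {0..} \<gamma>" "\<gamma> 0 = of_real \<alpha>0" "\<And>s. 0 < s \<Longrightarrow> \<gamma> s \<in> signed_domain Dp l"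
    "filterlim \<gamma> at_infinity at_top"
    using \<gamma>_contour by (auto simp: contour_in_def)
  have lip: "dist (\<gamma> x) (\<gamma> y) \<le> dist x y" if "0 \<le> x" "0 \<le> y" for x y
    using \<gamma>_contour that by (auto simp: contour_in_def intro: arc_length_parametrized_lipschitz)
  have norm_cnj: "norm (KB' (cnj \<mu>)) = norm (KB' \<mu>)" if "\<mu> \<in> Dp" for \<mu>
    by (rule bounded_adjoint_norm[OF KB'_reflection[OF that]])
  have KB'_Dp: "continuous_on Dp KB'" by (rule continuous_on_subset[OF KB'_continuous]) auto
  \<comment> \<open>On the mirror domain continuity is inherited through adjoints: a difference of
    two values has the norm of the difference at the conjugate points.\<close>
  have KB'_signed: "continuous_on (signed_domain Dp l) KB'"
  proof (cases "l = 1")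
    case False
    have "continuous_on (cnj ` Dp) KB'"
      unfolding continuous_on_iff
    proof (intro ballI allI impI)
      fix \<mu> and e :: real assume \<mu>: "\<mu> \<in> cnj ` Dp" and e: "0 < e"
      then have "cnj \<mu> \<in> Dp" by auto
      then obtain d where d: "0 < d" "\<And>\<nu>. \<nu> \<in> Dp \<Longrightarrow> dist \<nu> (cnj \<mu>) < d \<Longrightarrow> dist (KB' \<nu>) (KB' (cnj \<mu>)) < e"
        using KB'_Dp e unfolding continuous_on_iff by metis
      have "dist (KB' \<nu>) (KB' \<mu>) < e" if \<nu>: "\<nu> \<in> cnj ` Dp" "dist \<nu> \<mu> < d" for \<nu>
      proof -
        have D: "cnj \<nu> \<in> Dp" "cnj \<mu> \<in> Dp" using \<mu> \<nu> by auto
        have "dist (cnj \<nu>) (cnj \<mu>) < d" using \<nu>(2) by (simp add: dist_norm flip: complex_cnj_diff)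
        then have "dist (KB' (cnj \<nu>)) (KB' (cnj \<mu>)) < e" by (rule d(2)[OF D(1)])
        moreover have "norm (KB' \<nu> - KB' \<mu>) = norm (KB' (cnj \<nu>) - KB' (cnj \<mu>))"
          using bounded_adjoint_norm[OF bounded_adjoint_diff[OF KB'_reflection[OF D(1)] KB'_reflection[OF D(2)]]] by simp
        ultimately show ?thesis by (simp add: dist_norm)
      qed
      then show "\<exists>d>0. \<forall>\<nu>\<in>cnj ` Dp. dist \<nu> \<mu> < d \<longrightarrow> dist (KB' \<nu>) (KB' \<mu>) < e" using d(1) by blast
    qed
    then show ?thesis using False by (simp add: signed_domain_def)
  qed (use KB'_Dp in \<open>simp add: signed_domain_def\<close>)
  have \<gamma>_cont: "continuous_on {0<..} \<gamma>" by (rule continuous_on_subset[OF \<gamma>(1)]) auto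
  have W: "continuous_on {0<..} (\<lambda>s. KB' (\<gamma> s))"
    by (rule continuous_on_compose2[OF KB'_signed \<gamma>_cont]) (use \<gamma>(3) in auto)
  define h where "h s = norm (KB' (\<gamma> s)) / (1 + cmod (\<gamma> s))" for s
  have h0: "0 \<le> h s" for s by (simp add: h_def add_nonneg_nonneg)
  \<comment> \<open>\<open>Var1\<close> is a Lebesgue integral; continuity on the open half-line
    gives the measurability needed to read its finiteness as gauge integrability.\<close>
  have h: "h integrable_on {0<..}"
  proof -
    have "1 + cmod t \<noteq> 0" for t using norm_ge_zero[of t] by linarith
    then have "continuous_on {0<..} h"
      unfolding h_def by (auto intro!: continuous_intros W \<gamma>_cont)
    then have m: "(\<lambda>s. indicator {0<..} s *\<^sub>R h s) \<in> borel_measurable borel"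
      by (intro borel_measurable_continuous_on_indicator) auto
    have "(\<integral>\<^sup>+s. ennreal (indicator {0<..} s *\<^sub>R h s) \<partial>lborel) = Var1 KB' \<gamma>"
      unfolding Var1_def by (intro nn_integral_cong) (auto simp: h_def indicator_def)
    then obtain r where "0 \<le> r" "(\<integral>\<^sup>+s. ennreal (indicator {0<..} s *\<^sub>R h s) \<partial>lborel) = ennreal r"
      using \<gamma>_K_B_bounded by (metis ennreal_cases less_irrefl infinity_ennreal_def)
    then have "((\<lambda>s. indicator {0<..} s *\<^sub>R h s) has_integral r) UNIV"
      using m h0 by (intro nn_integral_has_integral) (auto simp: indicator_def)
    then have "((\<lambda>s. if s \<in> {0<..} then h s else 0) has_integral r) UNIV"
      by (rule has_integral_eq[rotated]) (simp add: indicator_def)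
    then have "(h has_integral r) {0<..}" by (simp only: has_integral_restrict_UNIV)
    then show ?thesis by blast
  qed
  have bound_xy: "cmod (cinner (T x) y) \<le> norm T * (norm x * norm y)" for T :: "'h1 \<Rightarrow>\<^sub>L 'h1" and x y
    using order_trans[OF cinner_norm_le mult_right_mono[OF norm_blinfun norm_ge_zero], of T x y] by (simp add: mult.assoc)
  \<comment> \<open>Kept general in \<open>G'\<close> and \<open>\<gamma>'\<close> so as to apply to
    the given contour and to its mirror image; \<open>w'\<close> expresses that both carry the same
    weight \<open>h\<close>.\<close>
  have hc: "halfplane_contour Dp G' \<alpha>0 (C * (norm x * norm y) + 1) g (\<lambda>\<mu>. cinner (KB' \<mu> x) y) \<gamma>'"
    if G': "open G'" "connected G'" "G' \<subseteq> Dp" "frontier G' = of_real ` {\<alpha>0..} \<union> \<gamma>' ` {0..}"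
      and g': "\<gamma>' 0 = of_real \<alpha>0" "\<And>s. 0 < s \<Longrightarrow> \<gamma>' s \<in> Dp" "\<And>x y. 0 \<le> x \<Longrightarrow> 0 \<le> y \<Longrightarrow> dist (\<gamma>' x) (\<gamma>' y) \<le> dist x y"
        "filterlim \<gamma>' at_infinity at_top"
      and w': "\<And>s. 0 < s \<Longrightarrow> norm (KB' (\<gamma>' s)) / (1 + cmod (\<gamma>' s)) = h s"
    for G' \<gamma>' x y
  proof
    have cont: "continuous_on S (\<lambda>\<mu>. cinner (KB' \<mu> x) y)" if "continuous_on S KB'" for S
      using that by (rule bounded_linear.continuous_on[OF ev])
    show "continuous_on (of_real ` {\<alpha>0<..} \<union> Dp) (\<lambda>\<mu>. cinner (KB' \<mu> x) y)" by (rule cont[OF KB'_continuous])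
    show "(\<lambda>\<mu>. cinner (KB' \<mu> x) y) holomorphic_on Dp" by (rule op_holomorphic_cinner[OF KB'_holomorphic Dp_domain(1)])
    \<comment> \<open>The added 1 keeps the constant positive when \<open>x\<close> or
      \<open>y\<close> is zero.\<close>
    show "0 < C * (norm x * norm y) + 1" using KB'_bound(1) by (intro add_nonneg_pos mult_nonneg_nonneg) auto
    show "cmod (cinner (KB' \<mu> x) y) \<le> (C * (norm x * norm y) + 1) * cmod (\<mu> - of_real \<alpha>0) powr g" if "\<mu> \<in> Dp" for \<mu>
    proof -
      have "cmod (cinner (KB' \<mu> x) y) \<le> norm (KB' \<mu>) * (norm x * norm y)" by (rule bound_xy)
      also have "\<dots> \<le> C * cmod (\<mu> - of_real \<alpha>0) powr g * (norm x * norm y)"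
        using KB'_bound(4)[of \<mu>] that by (intro mult_right_mono) auto
      also have "\<dots> \<le> (C * (norm x * norm y) + 1) * cmod (\<mu> - of_real \<alpha>0) powr g"
        by (simp add: algebra_simps)
      finally show ?thesis .
    qed
    have g'c: "continuous_on {0<..} \<gamma>'"
      by (rule lipschitz_on_continuous_on[of 1], rule lipschitz_onI) (use g'(3) in auto)
    have nz: "1 + cmod t \<noteq> 0" for t using norm_ge_zero[of t] by linarith
    show "(\<lambda>s. cmod (cinner (KB' (\<gamma>' s) x) y) / (1 + cmod (\<gamma>' s))) integrable_on {0<..}"
    proof (rule continuous_dominated_integrable)
      have "continuous_on {0<..} (\<lambda>s. KB' (\<gamma>' s))"
        by (rule continuous_on_compose2[OF KB'_Dp g'c]) (use g'(2) in auto)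
      then have "continuous_on {0<..} (\<lambda>s. cinner (KB' (\<gamma>' s) x) y)" by (rule bounded_linear.continuous_on[OF ev])
      then show "continuous_on {0<..} (\<lambda>s. cmod (cinner (KB' (\<gamma>' s) x) y) / (1 + cmod (\<gamma>' s)))"
        using nz g'c by (auto intro!: continuous_intros)
      show "(\<lambda>s. (norm x * norm y) * h s) integrable_on {0<..}"
        using integrable_cmul[OF h, of "norm x * norm y"] by simp
      fix s :: real assume s: "0 < s"
      have "cmod (cinner (KB' (\<gamma>' s) x) y) / (1 + cmod (\<gamma>' s)) \<le> norm (KB' (\<gamma>' s)) * (norm x * norm y) / (1 + cmod (\<gamma>' s))"
        by (intro divide_right_mono bound_xy) (simp add: add_nonneg_nonneg)
      also have "\<dots> = (norm x * norm y) * h s" by (simp add: w'[OF s, symmetric])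
      finally show "\<bar>cmod (cinner (KB' (\<gamma>' s) x) y) / (1 + cmod (\<gamma>' s))\<bar> \<le> (norm x * norm y) * h s"
        by (simp add: abs_of_nonneg add_nonneg_nonneg)
    qed
    show "(\<lambda>s. cmod (cinner (KB' (of_real (\<alpha>0 + s)) x) y) / (1 + cmod (complex_of_real (\<alpha>0 + s)))) integrable_on {0<..}"
      using weighted_curve.weight[OF spectral_density.weighted_density[OF SD, of x y]] by (simp add: \<kappa>_def)
  qed (use Dp_domain Dp_upper KB'_bound G' g' in auto)
  define I where "I z x y = integral {0<..} (\<lambda>s. vector_derivative \<gamma> (at s) * (1 / (z - \<gamma> s) * cinner (KB' (\<gamma> s) x) y))" for z x y
  define T where "T z x y = cinner (resolvent D0 A0 z (B01 x)) (B01 y)" for z x y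
  \<comment> \<open>Both signs of \<open>l\<close> in one scalar statement; the operator identities
    are deduced from it without repeating the reflection.\<close>
  have main: "open (crossing_domain l \<alpha>0 G) \<and> connected (crossing_domain l \<alpha>0 G) \<and>
     (\<forall>z x y. (of_int l * Im z < 0 \<longrightarrow> I z x y = T z x y) \<and>
        (z \<in> G \<longrightarrow> I z x y = T z x y + 2 * of_real pi * \<i> * of_int l * cinner (KB' z x) y))"
  proof (cases "l = 1")
    case True
    then have G: "G \<subseteq> Dp" and \<gamma>D: "\<And>s. 0 < s \<Longrightarrow> \<gamma> s \<in> Dp" using G_domain(3) \<gamma>(3) by (auto simp: signed_domain_def)
    note HC = hc[OF G_domain(1,2) G G_boundary \<gamma>(2) \<gamma>D lip \<gamma>(4) h_def[symmetric]]
    have "I z x y = T z x y" if "Im z < 0" for z x y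
      using halfplane_contour.contour_transform(1)[OF HC SD _ that, of x y x y] unfolding I_def T_def by (simp add: \<kappa>_def)
    moreover have "I z x y = T z x y + 2 * of_real pi * \<i> * cinner (KB' z x) y" if "z \<in> G" for z x y
      using halfplane_contour.contour_transform(2)[OF HC SD _ that, of x y x y] unfolding I_def T_def by (simp add: \<kappa>_def)
    ultimately show ?thesis using halfplane_contour.crossing_domain_open_connected[OF HC[of 0 0]] True by simp
  next
    case False
    \<comment> \<open>Conjugation carries domain and contour into \<open>Dp\<close>, and reflection
      of \<open>KB'\<close> turns the matrix element for \<open>x\<close>, \<open>y\<close> into the
      conjugate of the one for \<open>y\<close>, \<open>x\<close>.\<close>
    then have l1: "l = -1" using l by simp
    have G: "cnj ` G \<subseteq> Dp" and \<gamma>D: "\<And>s. 0 < s \<Longrightarrow> cnj (\<gamma> s) \<in> Dp"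
      using G_domain(3) \<gamma>(3) l1 by (force simp: signed_domain_def)+
    have G_open: "open (cnj ` G)"
      unfolding image_cnj_conv_vimage_cnj using G_domain(1) by (intro open_vimage) (auto intro: continuous_intros)
    have G_conn: "connected (cnj ` G)"
      by (intro connected_continuous_image G_domain(2) continuous_intros)
    have G_front: "frontier (cnj ` G) = of_real ` {\<alpha>0..} \<union> (\<lambda>s. cnj (\<gamma> s)) ` {0..}"
      unfolding frontier_cnj G_boundary by (simp add: image_Un image_image)
    have \<gamma>0: "cnj (\<gamma> 0) = of_real \<alpha>0" by (simp add: \<gamma>(2))
    have \<gamma>_lip: "dist (cnj (\<gamma> x)) (cnj (\<gamma> y)) \<le> dist x y" if "0 \<le> x" "0 \<le> y" for x y
      using lip[OF that] by (simp add: dist_norm flip: complex_cnj_diff)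
    have \<gamma>_inf: "filterlim (\<lambda>s. cnj (\<gamma> s)) at_infinity at_top"
      using \<gamma>(4) unfolding filterlim_at_infinity[OF order_refl] by simp
    have w: "norm (KB' (cnj (\<gamma> s))) / (1 + cmod (cnj (\<gamma> s))) = h s" if "0 < s" for s
      using norm_cnj[OF \<gamma>D[OF that]] by (simp add: h_def)
    note HC = hc[OF G_open G_conn G G_front \<gamma>0 \<gamma>D \<gamma>_lip \<gamma>_inf w]
    obtain N where N: "negligible N" "\<And>s. 0 < s \<Longrightarrow> s \<notin> N \<Longrightarrow> (\<gamma> has_vector_derivative vector_derivative \<gamma> (at s)) (at s)"
      using lipschitz_ftc[of 0 \<gamma>, OF lip] by metis
    have KB'_cnj: "cinner (KB' \<mu> x) y = cnj (cinner (KB' (cnj \<mu>) y) x)" if "cnj \<mu> \<in> Dp" for \<mu> x y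
      using KB'_reflection[OF that] cinner_commute[of "KB' \<mu> x" y] by (simp add: bounded_adjoint_def)
    \<comment> \<open>The reflected curve has the conjugate derivative wherever \<gamma> is
      differentiable; elsewhere \<open>vector_derivative\<close> is unspecified, so the integrands
      are compared off the null set \<open>N\<close>.\<close>
    have I_cnj: "I z x y = cnj (integral {0<..} (\<lambda>s. vector_derivative (\<lambda>s. cnj (\<gamma> s)) (at s) *
        (1 / (cnj z - cnj (\<gamma> s)) * cinner (KB' (cnj (\<gamma> s)) y) x)))" for z x y
      unfolding I_def integral_cnj
    proof (rule integral_spike[OF N(1)])
      fix s assume s: "s \<in> {0<..} - N"
      have "vector_derivative (\<lambda>s. cnj (\<gamma> s)) (at s) = cnj (vector_derivative \<gamma> (at s))"
        using N(2)[of s] s by (intro vector_derivative_at has_vector_derivative_cnj) auto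
      then show "cnj (vector_derivative (\<lambda>s. cnj (\<gamma> s)) (at s) * (1 / (cnj z - cnj (\<gamma> s)) * cinner (KB' (cnj (\<gamma> s)) y) x)) =
          vector_derivative \<gamma> (at s) * (1 / (z - \<gamma> s) * cinner (KB' (\<gamma> s) x) y)"
        using KB'_cnj[of "\<gamma> s" x y] \<gamma>D[of s] s by simp
    qed
    have T_cnj: "T z x y = cnj (T (cnj z) y x)" if "Im z \<noteq> 0" for z x y
    proof -
      have nz: "z \<notin> spectrum D0 A0" "cnj z \<notin> spectrum D0 A0" using that by (auto simp: A0_spectrum complex_eq_iff)
      show ?thesis
        unfolding T_def
        using resolvent_adjoint[OF A0_selfadjoint spectral_operator.resolvent[OF SO nz(1)] spectral_operator.resolvent[OF SO nz(2)]]
          cinner_commute by metis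
    qed
    have "I z x y = T z x y" if z: "0 < Im z" for z x y
    proof -
      have "Im (cnj z) < 0" using z by simp
      from halfplane_contour.contour_transform(1)[OF HC SD _ this, of y x y x]
      show ?thesis unfolding I_cnj T_cnj[OF less_imp_neq[OF z, symmetric]] unfolding T_def by (simp add: \<kappa>_def)
    qed
    moreover have "I z x y = T z x y - 2 * of_real pi * \<i> * cinner (KB' z x) y" if z: "z \<in> G" for z x y
    proof -
      have zD: "cnj z \<in> Dp" using z G by auto
      then have "0 < Im (cnj z)" using Dp_upper by blast
      then have "Im z \<noteq> 0" by simp
      from halfplane_contour.contour_transform(2)[OF HC SD _ imageI[OF z], of y x y x]
      show ?thesis unfolding I_cnj T_cnj[OF \<open>Im z \<noteq> 0\<close>] KB'_cnj[OF zD] unfolding T_def by (simp add: \<kappa>_def)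
    qed
    moreover have "crossing_domain l \<alpha>0 G = cnj ` crossing_domain 1 \<alpha>0 (cnj ` G)"
    proof -
      have "cnj ` {z. Im z < 0} = {z. 0 < Im z}" by (force simp: image_iff intro: exI[of _ "cnj _"])
      then show ?thesis by (simp add: crossing_domain_def l1 image_Un image_image)
    qed
    moreover have "open (cnj ` crossing_domain 1 \<alpha>0 (cnj ` G))"
      unfolding image_cnj_conv_vimage_cnj[of "crossing_domain _ _ _"]
      using halfplane_contour.crossing_domain_open_connected(1)[OF HC[of 0 0]]
      by (intro open_vimage) (auto intro: continuous_intros)
    moreover have "connected (cnj ` crossing_domain 1 \<alpha>0 (cnj ` G))"
      by (intro connected_continuous_image halfplane_contour.crossing_domain_open_connected(2)[OF HC[of 0 0]] continuous_intros)
    ultimately show ?thesis by (simp add: l1)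
  qed
  \<comment> \<open>Operator-valued integral without the factor \<open>z\<close> of
    \<open>V1_integrand\<close>. Its norm derivative comes from \<open>cauchy_transform\<close>; the
    scalar identities only identify its values.\<close>
  define V where "V z = integral {0<..} (\<lambda>s. vector_derivative \<gamma> (at s) *\<^sub>C ((1 / (z - \<gamma> s)) *\<^sub>C KB' (\<gamma> s)))" for z
  obtain N where N: "negligible N" "\<And>s. 0 < s \<Longrightarrow> s \<notin> N \<Longrightarrow> norm (vector_derivative \<gamma> (at s)) \<le> 1"
    "\<And>b c. 0 \<le> b \<Longrightarrow> b \<le> c \<Longrightarrow> ((\<lambda>s. vector_derivative \<gamma> (at s)) has_integral \<gamma> c - \<gamma> b) {b..c}"
    using lipschitz_ftc[of 0 \<gamma>, OF lip] by metis
  have u: "(\<lambda>s. vector_derivative \<gamma> (at s)) integrable_on {a..b}" if "0 < a" for a b :: real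
    by (cases "a \<le> b") (use N(3)[of a b] that in \<open>auto simp: integrable_on_def\<close>)
  have far: "\<exists>d>0. \<forall>s>0. d \<le> cmod (z - \<gamma> s)" if z: "z \<in> crossing_domain l \<alpha>0 G" for z
  proof -
    have "z \<notin> \<gamma> ` {0..}"
    proof
      assume "z \<in> \<gamma> ` {0..}"
      then obtain s where s: "z = \<gamma> s" "0 \<le> s" by auto
      have "\<gamma> ` {0..} \<inter> G = {}" using G_boundary G_domain(1) by (auto simp: frontier_def interior_open)
      then have zG: "z \<notin> G" using s by auto
      have "0 < of_int l * Im (\<gamma> s)" if "0 < s"
        using \<gamma>(3)[OF that] Dp_upper l by (auto simp: signed_domain_def split: if_splits)
      then show False
        using z zG s \<gamma>(2) by (cases "s = 0") (auto simp: crossing_domain_def)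
    qed
    from dist_proper_curve[OF \<gamma>(1,4) this order_refl] show ?thesis by (metis less_imp_le)
  qed
  have V_int: "(\<lambda>s. vector_derivative \<gamma> (at s) *\<^sub>C ((1 / (z - \<gamma> s)) *\<^sub>C KB' (\<gamma> s))) integrable_on {0<..}"
    and V_deriv: "\<exists>L. (V has_derivative (\<lambda>h. h *\<^sub>C L)) (at z)" if z: "z \<in> crossing_domain l \<alpha>0 G" for z
  proof -
    obtain d where d: "0 < d" "\<And>s. 0 < s \<Longrightarrow> d \<le> cmod (z - \<gamma> s)" using far[OF z] by blast
    have w: "(\<lambda>s. norm (KB' (\<gamma> s)) / (1 + cmod (\<gamma> s))) integrable_on {0<..}" using h by (simp add: h_def[abs_def])
    show "(\<lambda>s. vector_derivative \<gamma> (at s) *\<^sub>C ((1 / (z - \<gamma> s)) *\<^sub>C KB' (\<gamma> s))) integrable_on {0<..}"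
      by (rule act.cauchy_transform(1)[OF u N(1,2) W \<gamma>_cont w d])
    show "\<exists>L. (V has_derivative (\<lambda>h. h *\<^sub>C L)) (at z)"
      using act.cauchy_transform(2)[OF u N(1,2) W \<gamma>_cont w d] unfolding V_def[abs_def] .
  qed
  have V_weak: "cinner (V z x) y = I z x y" if z: "z \<in> crossing_domain l \<alpha>0 G" for z x y
    using integral_linear[OF V_int[OF z] ev, of x y]
    unfolding V_def I_def by (simp add: o_def cinner_scaleC_left)
  have integrand: "curve_integrand \<gamma> (V1_integrand KB' z) s =
      z *\<^sub>C (vector_derivative \<gamma> (at s) *\<^sub>C ((1 / (z - \<gamma> s)) *\<^sub>C KB' (\<gamma> s)))" for z s
    by (simp add: curve_integrand_def V1_integrand_def act.prod_prod mult.left_commute mult.commute)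
  have C_int: "curve_integrand \<gamma> (V1_integrand KB' z) integrable_on {0..}"
    and C_eq: "curve_integral \<gamma> (V1_integrand KB' z) = z *\<^sub>C V z" if z: "z \<in> crossing_domain l \<alpha>0 G" for z
  proof -
    have bl: "bounded_linear (\<lambda>T :: 'h1 \<Rightarrow>\<^sub>L 'h1. z *\<^sub>C T)" by (rule act.bounded_linear_right)
    have i: "curve_integrand \<gamma> (V1_integrand KB' z) integrable_on {0<..}"
      using integrable_linear[OF V_int[OF z] bl] by (simp add: o_def integrand[abs_def])
    \<comment> \<open>At parameter 0 the two-sided derivative of \<gamma> is unspecified, but one
      point is negligible.\<close>
    show "curve_integrand \<gamma> (V1_integrand KB' z) integrable_on {0..}"
      by (rule integrable_spike_set[OF i]) (rule negligible_subset[OF negligible_sing[of 0]], force)+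
    have "curve_integral \<gamma> (V1_integrand KB' z) = integral {0<..} (curve_integrand \<gamma> (V1_integrand KB' z))"
      unfolding curve_integral_def
      by (rule integral_spike_set) (rule negligible_subset[OF negligible_sing[of 0]], force)+
    also have "\<dots> = z *\<^sub>C V z"
      using integral_linear[OF V_int[OF z] bl] by (simp add: o_def integrand[abs_def] V_def)
    finally show "curve_integral \<gamma> (V1_integrand KB' z) = z *\<^sub>C V z" .
  qed
  have T_eq: "T z x y = cinner ((B10 o\<^sub>L resolvent D0 A0 z o\<^sub>L B01) x) y" for z x y
    using B01 by (simp add: T_def bounded_adjoint_def)
  have holo: "op_holomorphic_on (M1_continued A1t KB' \<gamma>) (crossing_domain l \<alpha>0 G)"
    unfolding op_holomorphic_on_def
  proof
    fix z assume z: "z \<in> crossing_domain l \<alpha>0 G"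
    obtain L where L: "(V has_derivative (\<lambda>h. h *\<^sub>C L)) (at z)" using V_deriv[OF z] by blast
    \<comment> \<open>Product rule for \<open>z *\<^sub>C V z\<close>, together with the derivative
      of the linear term.\<close>
    let ?M = "z *\<^sub>C L + V z - id_blinfun"
    have "((\<lambda>z. A1t - z *\<^sub>C id_blinfun + z *\<^sub>C V z) has_derivative
        (\<lambda>h. 0 - (z *\<^sub>C 0 + h *\<^sub>C id_blinfun) + (z *\<^sub>C (h *\<^sub>C L) + h *\<^sub>C V z))) (at z)"
      by (intro has_derivative_add has_derivative_diff has_derivative_const act.FDERIV has_derivative_ident L)
    moreover have "0 - (z *\<^sub>C 0 + h *\<^sub>C id_blinfun) + (z *\<^sub>C (h *\<^sub>C L) + h *\<^sub>C V z) = h *\<^sub>C ?M" for h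
      by (simp add: act.add_right act.diff_right act.prod_prod act.zero_right mult.commute)
    ultimately have "((\<lambda>z. A1t - z *\<^sub>C id_blinfun + z *\<^sub>C V z) has_derivative (\<lambda>h. h *\<^sub>C ?M)) (at z within crossing_domain l \<alpha>0 G)"
      by (simp add: has_derivative_at_withinI)
    then have "(M1_continued A1t KB' \<gamma> has_derivative (\<lambda>h. h *\<^sub>C ?M)) (at z within crossing_domain l \<alpha>0 G)"
      by (rule has_derivative_transform[OF z, rotated]) (simp add: M1_continued_def C_eq)
    then show "\<exists>L. (M1_continued A1t KB' \<gamma> has_derivative (\<lambda>h. h *\<^sub>C L)) (at z within crossing_domain l \<alpha>0 G)" by blast
  qed
  have half_sub: "{z. of_int l * Im z < 0} \<subseteq> crossing_domain l \<alpha>0 G" and G_sub: "G \<subseteq> crossing_domain l \<alpha>0 G"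
    by (auto simp: crossing_domain_def)
  have below: "M1_continued A1t KB' \<gamma> z = transfer_function A1t B10 B01 D0 A0 z" if z: "of_int l * Im z < 0" for z
  proof -
    have zc: "z \<in> crossing_domain l \<alpha>0 G" using half_sub z by blast
    have "V z = B10 o\<^sub>L resolvent D0 A0 z o\<^sub>L B01"
      by (intro blinfun_eqI cinner_ext) (use main z V_weak[OF zc] T_eq in metis)
    then show ?thesis by (simp add: M1_continued_def transfer_function_def C_eq[OF zc])
  qed
  have jump: "M1_continued A1t KB' \<gamma> z = transfer_function A1t B10 B01 D0 A0 z + (2 * of_real pi * \<i> * of_int l * z) *\<^sub>C KB' z"
    if z: "z \<in> G" for z
  proof -
    have zc: "z \<in> crossing_domain l \<alpha>0 G" using G_sub z by blast
    have "V z = (B10 o\<^sub>L resolvent D0 A0 z o\<^sub>L B01) + (2 * of_real pi * \<i> * of_int l) *\<^sub>C KB' z"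
    proof (intro blinfun_eqI cinner_ext)
      fix x y
      have "cinner (V z x) y = T z x y + 2 * of_real pi * \<i> * of_int l * cinner (KB' z x) y"
        using main z V_weak[OF zc] by metis
      then show "cinner (V z x) y = cinner (((B10 o\<^sub>L resolvent D0 A0 z o\<^sub>L B01) + (2 * of_real pi * \<i> * of_int l) *\<^sub>C KB' z) x) y"
        by (simp add: T_eq blinfun.add_left cinner_add_left cinner_scaleC_left del: blinfun_apply_blinfun_compose)
    qed
    then show ?thesis
      by (simp add: M1_continued_def transfer_function_def C_eq[OF zc] act.add_right act.prod_prod mult.commute)
  qed
  have "open {z. of_int l * Im z < 0}" "{z. of_int l * Im z < 0} \<noteq> {}"
  proof -
    show "open {z. of_int l * Im z < 0}" by (intro open_Collect_less continuous_intros)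
    \<comment> \<open>At this witness \<open>of_int l * Im z\<close> is minus the square of
      \<open>l\<close>, that is -1.\<close>
    have "- \<i> * of_int l \<in> {z. of_int l * Im z < 0}" using l by auto
    then show "{z. of_int l * Im z < 0} \<noteq> {}" by blast
  qed
  then show ?thesis
    unfolding analytic_continuation_def using C_int main holo below half_sub jump by auto
qed

end
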